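(* Let $q$ be a prime power, let $F$ be an algebraic function field (in one variable) with full constant field $\mathbb{F}_q$, let $\mathcal{S}$ be a non-empty proper subset of the set $\mathbb{P}_F$ of places of $F$, and let $H=\bigcap_{P\in\mathcal{S}}\mathcal{O}_P$ be the associated holomorphy ring. Fix an integer $d>1$. Let $\mathcal{E}\subseteq H^d$ be the set of monic Eisenstein polynomials of degree $d$ with coefficients in $H$, where a monic polynomial $x^d+h_{d-1}x^{d-1}+\dots+h_0$ is identified with $(h_0,\dots,h_{d-1})\in H^d$. Then the density $\mathbb{D}(\mathcal{E})$ exists and \[\mathbb{D}(\mathcal{E})=1-\prod_{Q\in \mathcal{S}}\left(1-\frac{q^{\deg(Q)}-1}{q^{(d+1)\deg(Q)}}\right).\]
   Context: A polynomial $f=\sum_{i=0}^n a_ix^i\in R[x]$ over an integral domain $R$ is Eisenstein if there is a prime ideal $\mathfrak p$ of $R$ with $a_i\in\mathfrak p$ for all $0\le i\le n-1$, $a_0\notin\mathfrak p^2$ and $a_n\notin\mathfrak p$. The nonzero prime ideals of $H$ are exactly $P\cap H$ for $P\in\mathcal{S}$. For a divisor $D$ of $F$, $\mathcal{L}(D)$ is its Riemann–Roch space and $\ell(D)=\dim_{\mathbb{F}_q}\mathcal{L}(D)$. Let $\mathcal{D}$ be the set of positive (effective) divisors of $F$ whose support is disjoint from $\mathcal{S}$; it is a directed set under $D\le D'$ iff $D'-D\ge 0$, and $H=\bigcup_{D\in\mathcal{D}}\mathcal{L}(D)$. For $A\subseteq H^m$ the upper and lower densities are $\overline{\mathbb{D}}(A)=\limsup_{D\in\mathcal{D}}|A\cap\mathcal{L}(D)^m|/q^{m\ell(D)}$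 and $\underline{\mathbb{D}}(A)=\liminf_{D\in\mathcal{D}}|A\cap\mathcal{L}(D)^m|/q^{m\ell(D)}$, with limits in the sense of Moore–Smith convergence over the directed set $\mathcal{D}$; the density $\mathbb{D}(A)$ exists if these coincide, and is then their common value. *)

theory Defs
  imports
    "HOL-Algebra.Algebra"
    "HOL-Number_Theory.Prime_Powers"
    "HOL-Library.Liminf_Limsup"
    "HOL-Library.Extended_Real"
begin

section \<open>Algebraic function fields and places\<close>

definition function_field :: "('a, 'b) ring_scheme \<Rightarrow> 'a set \<Rightarrow> bool" where
  "function_field F K \<longleftrightarrow>
     field F \<and> subfield K F \<and>
     (\<exists>x\<in>carrier F. ring.transcendental F K x \<and>
        ring.finite_dimension F (generate_field F (insert x K)) (carrier F))"

definition full_constant_field :: "('a, 'b) ring_scheme \<Rightarrow> 'a set \<Rightarrow> bool" where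
  "full_constant_field F K \<longleftrightarrow> (\<forall>z\<in>carrier F. ring.algebraic F K z \<longrightarrow> z \<in> K)"

definition is_valuation_ring :: "('a, 'b) ring_scheme \<Rightarrow> 'a set \<Rightarrow> 'a set \<Rightarrow> bool" where
  "is_valuation_ring F K V \<longleftrightarrow>
     subring V F \<and> K \<subset> V \<and> V \<subset> carrier F \<and>
     (\<forall>z\<in>carrier F - {\<zero>\<^bsub>F\<^esub>}. z \<in> V \<or> inv\<^bsub>F\<^esub> z \<in> V)"

definition places :: "('a, 'b) ring_scheme \<Rightarrow> 'a set \<Rightarrow> 'a set set" where
  "places F K = {P. \<exists>V. is_valuation_ring F K V \<and> maximalideal P (F\<lparr>carrier := V\<rparr>)}"

text \<open>The valuation ring with maximal ideal \<open>P\<close> is unique, so \<open>THE\<close> is meaningful for every place.\<close>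

definition place_ring :: "('a, 'b) ring_scheme \<Rightarrow> 'a set \<Rightarrow> 'a set \<Rightarrow> 'a set" where
  "place_ring F K P = (THE V. is_valuation_ring F K V \<and> maximalideal P (F\<lparr>carrier := V\<rparr>))"

text \<open>
  The normalised discrete valuation at \<open>P\<close>: if \<open>P = t \<O>\<^sub>P\<close>, every \<open>z \<noteq> 0\<close> is \<open>t\<^sup>n u\<close> with \<open>u\<close> a unit
  of the valuation ring and \<open>n\<close> an integer independent of the choice of \<open>t\<close>.
  The value at \<open>0\<close> is meaningless; uses below treat \<open>0\<close> separately.
\<close>

definition place_val :: "('a, 'b) ring_scheme \<Rightarrow> 'a set \<Rightarrow> 'a set \<Rightarrow> 'a \<Rightarrow> int" where
  "place_val F K P z =
     (let V = F\<lparr>carrier := place_ring F K P\<rparr> in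
      THE n. \<exists>t\<in>carrier V. PIdl\<^bsub>V\<^esub> t = P \<and>
             (\<exists>u\<in>Units V. z = (t [^]\<^bsub>F\<^esub> n) \<otimes>\<^bsub>F\<^esub> u))"

text \<open>The degree is the dimension of the residue field over the image of \<open>K\<close> in it.\<close>

definition place_deg :: "('a, 'b) ring_scheme \<Rightarrow> 'a set \<Rightarrow> 'a set \<Rightarrow> nat" where
  "place_deg F K P =
     (let V = F\<lparr>carrier := place_ring F K P\<rparr>; k = V Quot P in
      ring.dim k ((\<lambda>c. P +>\<^bsub>V\<^esub> c) ` K) (carrier k))"

definition holomorphy_ring :: "('a, 'b) ring_scheme \<Rightarrow> 'a set \<Rightarrow> 'a set set \<Rightarrow> 'a set" where
  "holomorphy_ring F K S = (\<Inter>P\<in>S. place_ring F K P)"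

section \<open>Divisors and Riemann--Roch spaces\<close>

text \<open>
  Divisors are elements of the free abelian group on the places. The library order on
  \<^typ>\<open>'p \<Rightarrow>\<^sub>0 int\<close> is lexicographic, so the coefficientwise order is defined separately.
\<close>

definition divisor_le :: "('p \<Rightarrow>\<^sub>0 int) \<Rightarrow> ('p \<Rightarrow>\<^sub>0 int) \<Rightarrow> bool" where
  "divisor_le D D' \<longleftrightarrow> (\<forall>P. 0 \<le> Poly_Mapping.lookup (D' - D) P)"

definition RR_space :: "('a, 'b) ring_scheme \<Rightarrow> 'a set \<Rightarrow> ('a set \<Rightarrow>\<^sub>0 int) \<Rightarrow> 'a set" where
  "RR_space F K D =
     {z \<in> carrier F. z = \<zero>\<^bsub>F\<^esub> \<or> (\<forall>P\<in>places F K. - Poly_Mapping.lookup D P \<le> place_val F K P z)}"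

definition RR_dim :: "('a, 'b) ring_scheme \<Rightarrow> 'a set \<Rightarrow> ('a set \<Rightarrow>\<^sub>0 int) \<Rightarrow> nat" where
  "RR_dim F K D = ring.dim F K (RR_space F K D)"

definition pos_divisors_off ::
    "('a, 'b) ring_scheme \<Rightarrow> 'a set \<Rightarrow> 'a set set \<Rightarrow> ('a set \<Rightarrow>\<^sub>0 int) set" where
  "pos_divisors_off F K S =
     {D \<in> carrier (free_Abelian_group (places F K)). divisor_le 0 D \<and> Poly_Mapping.keys D \<inter> S = {}}"

section \<open>Density\<close>

text \<open>
  The section filter of a directed set: \<open>Limsup\<close> and \<open>Liminf\<close> along it are the Moore--Smith upper
  and lower limits.
\<close>

definition divisor_filter ::
    "('a, 'b) ring_scheme \<Rightarrow> 'a set \<Rightarrow> 'a set set \<Rightarrow> ('a set \<Rightarrow>\<^sub>0 int) filter" where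
  "divisor_filter F K S =
     (INF D\<in>pos_divisors_off F K S. principal {D' \<in> pos_divisors_off F K S. divisor_le D D'})"

text \<open>Elements of \<open>H\<^sup>m\<close> are lists of length \<open>m\<close>.\<close>

definition cartesian_power :: "'a set \<Rightarrow> nat \<Rightarrow> 'a list set" where
  "cartesian_power B m = {xs. length xs = m \<and> set xs \<subseteq> B}"

definition density_ratio ::
    "('a, 'b) ring_scheme \<Rightarrow> 'a set \<Rightarrow> nat \<Rightarrow> 'a list set \<Rightarrow> ('a set \<Rightarrow>\<^sub>0 int) \<Rightarrow> real" where
  "density_ratio F K m A D =
     real (card (A \<inter> cartesian_power (RR_space F K D) m)) / real (card K) ^ (m * RR_dim F K D)"

definition upper_density ::
    "('a, 'b) ring_scheme \<Rightarrow> 'a set \<Rightarrow> 'a set set \<Rightarrow> nat \<Rightarrow> 'a list set \<Rightarrow> ereal" where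
  "upper_density F K S m A = Limsup (divisor_filter F K S) (\<lambda>D. ereal (density_ratio F K m A D))"

definition lower_density ::
    "('a, 'b) ring_scheme \<Rightarrow> 'a set \<Rightarrow> 'a set set \<Rightarrow> nat \<Rightarrow> 'a list set \<Rightarrow> ereal" where
  "lower_density F K S m A = Liminf (divisor_filter F K S) (\<lambda>D. ereal (density_ratio F K m A D))"

definition has_density ::
    "('a, 'b) ring_scheme \<Rightarrow> 'a set \<Rightarrow> 'a set set \<Rightarrow> nat \<Rightarrow> 'a list set \<Rightarrow> real \<Rightarrow> bool" where
  "has_density F K S m A \<delta> \<longleftrightarrow>
     upper_density F K S m A = ereal \<delta> \<and> lower_density F K S m A = ereal \<delta>"

section \<open>Eisenstein polynomials\<close>

text \<open>
  Polynomials are coefficient lists with the leading coefficient first, and \<open>\<pp>\<^sup>2\<close> is the product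
  ideal \<open>\<pp> \<cdot> \<pp>\<close>.
\<close>

definition eisenstein :: "('a, 'b) ring_scheme \<Rightarrow> 'a list \<Rightarrow> bool" where
  "eisenstein R f \<longleftrightarrow>
     f \<in> carrier (poly_ring R) \<and>
     (\<exists>\<pp>. primeideal \<pp> R \<and>
        (\<forall>i<degree f. ring.coeff R f i \<in> \<pp>) \<and>
        ring.coeff R f 0 \<notin> ideal_prod R \<pp> \<pp> \<and>
        ring.coeff R f (degree f) \<notin> \<pp>)"

text \<open>The list \<open>[h\<^sub>0, \<dots>, h\<^sub>d\<^sub>-\<^sub>1]\<close> stands for \<open>x\<^sup>d + h\<^sub>d\<^sub>-\<^sub>1 x\<^sup>d\<^sup>-\<^sup>1 + \<dots> + h\<^sub>0\<close>.\<close>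

definition monic_eisenstein ::
    "('a, 'b) ring_scheme \<Rightarrow> 'a set \<Rightarrow> 'a set set \<Rightarrow> nat \<Rightarrow> 'a list set" where
  "monic_eisenstein F K S d =
     (let H = holomorphy_ring F K S in
      {hs \<in> cartesian_power H d. eisenstein (F\<lparr>carrier := H\<rparr>) (\<one>\<^bsub>F\<^esub> # rev hs)})"

section \<open>Products over arbitrary index sets\<close>

text \<open>
  The multiplicative analogue of \<open>has_sum\<close>: unordered convergence of the finite partial products.
  A limit of \<open>0\<close> is allowed.
\<close>

definition has_unordered_prod :: "('i \<Rightarrow> real) \<Rightarrow> real \<Rightarrow> 'i set \<Rightarrow> bool" where
  "has_unordered_prod f p I \<longleftrightarrow> ((\<lambda>T. \<Prod>i\<in>T. f i) \<longlongrightarrow> p) (finite_subsets_at_top I)"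

end

theory Submission
  imports Defs
begin

text \<open>
  A monic polynomial over \<open>H\<close> is Eisenstein iff for some \<open>Q \<in> S\<close> all its lower coefficients lie in
  \<open>Q\<close> and the constant one is not in \<open>Q\<^sup>2\<close>, because the nonzero primes of \<open>H\<close> are the \<open>Q \<inter> H\<close> and
  \<open>(Q \<inter> H)\<^sup>2 = {h \<in> H. v\<^sub>Q(h) \<ge> 2}\<close>. For finitely many \<open>Q\<close> and all sufficiently large \<open>D\<close>, the
  reduction of \<open>\<L>(D)\<close> modulo \<open>\<Prod> Q\<^sup>2\<close> is onto with equal fibres, so these conditions are independent
  and the non-Eisenstein proportion is exactly the finite product. The tuples that are Eisenstein at
  some other \<open>Q\<close> are few: \<open>\<ell>(D - Q) \<le> deg D - deg Q + 1\<close> if \<open>\<L>(D - Q) \<noteq> 0\<close>, while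
  \<open>\<ell>(D) \<ge> deg D - \<gamma>\<close> by Riemann's inequality, so their proportion is at most a constant times
  the tail of \<open>\<Sum> q\<^bsup>-2 deg Q\<^esup>\<close>, which converges.

  As \<open>K\<close> is finite, the function field theory needed (discreteness of places, product formula,
  Riemann's inequality, strong approximation) can be obtained by counting elements of finite
  \<open>K\<close>-vector spaces. The degree \<open>[F : K(x)]\<close> enters only as the largest dimension of a \<open>K\<close>-space
  whose bases are independent over \<open>K[x]\<close>; it bounds \<open>A/xA\<close> for every subring \<open>A\<close> containing \<open>x\<close>.
\<close>

section \<open>Finite vector spaces\<close>

text \<open>The hypotheses enter at definite points. As \<open>S\<close> omits a place
  \<open>P0\<close>, the admissible divisors include all \<open>m P0\<close> with \<open>m\<close>
  nonnegative; "sufficiently large" always means a large enough coefficient at this one place, which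
  supplies the degree that Riemann's inequality needs. The condition \<open>d > 1\<close> supplies
  the exponent 2 in the tail: places of degree \<open>m\<close> are counted by a multiple of
  \<open>m q^m\<close>, which is summable against \<open>q^(-2m)\<close> but not against
  \<open>q^(-m)\<close>. That reduction is onto with equal fibres is one counting statement: every
  fibre is empty or a translate of the same smaller space, and once the total is as large as
  possible no fibre can be deficient. The main obstacle is that finiteness of \<open>F\<close> is
  given over \<open>K(y)\<close> for a single \<open>y\<close>, whereas zeros and poles must be
  bounded for every \<open>x\<close>. Comparing exponential growth rates in lattices over
  \<open>K[y]\<close> transfers the finiteness to all \<open>x\<close>.\<close>

definition (in ring) lin_sub :: "'a set \<Rightarrow> 'a set \<Rightarrow> bool" where
  "lin_sub K W \<longleftrightarrow> W \<subseteq> carrier R \<and> \<zero> \<in> W \<and>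
     (\<forall>u\<in>W. \<forall>v\<in>W. u \<oplus> v \<in> W) \<and> (\<forall>k\<in>K. \<forall>v\<in>W. k \<otimes> v \<in> W)"

lemma (in ring) lin_subD:
  assumes "lin_sub K W"
  shows "W \<subseteq> carrier R" "\<zero> \<in> W" "\<And>u v. u \<in> W \<Longrightarrow> v \<in> W \<Longrightarrow> u \<oplus> v \<in> W"
    "\<And>k v. k \<in> K \<Longrightarrow> v \<in> W \<Longrightarrow> k \<otimes> v \<in> W"
  using assms unfolding lin_sub_def by auto

lemma (in ring) lin_sub_neg:
  assumes "lin_sub K W" "subfield K R" "v \<in> W"
  shows "\<ominus> v \<in> W"
proof -
  have "\<ominus> \<one> \<in> K" using subringE[OF subfieldE(1)[OF assms(2)]] by auto
  then have "(\<ominus> \<one>) \<otimes> v \<in> W" using lin_subD(4)[OF assms(1)] assms(3) by blast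
  then show ?thesis using lin_subD(1)[OF assms(1)] assms(3) by (simp add: l_minus subset_iff)
qed

lemma (in ring) lin_sub_minus:
  assumes "lin_sub K W" "subfield K R" "u \<in> W" "v \<in> W"
  shows "u \<ominus> v \<in> W"
  using lin_sub_neg[OF assms(1,2,4)] lin_subD(3)[OF assms(1)] assms(3) by (simp add: a_minus_def)

lemma (in ring) card_Span_independent:
  assumes K: "subfield K R" and fin: "finite K"
  shows "independent K Us \<Longrightarrow> finite (Span K Us) \<and> card (Span K Us) = card K ^ length Us"
proof (induction Us)
  case Nil
  then show ?case by simp
next
  case (Cons u Us)
  have ind: "u \<notin> Span K Us" "independent K Us" "u \<in> carrier R"
    using independent_backwards[OF Cons.prems] independent_in_carrier[OF Cons.prems] by auto
  have Us: "set Us \<subseteq> carrier R" using independent_in_carrier[OF ind(2)] .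
  have IH: "finite (Span K Us)" "card (Span K Us) = card K ^ length Us" using Cons.IH ind by auto
  have eq: "Span K (u # Us) = (\<lambda>(k, v). k \<otimes> u \<oplus> v) ` (K \<times> Span K Us)" (is "_ = ?f ` _")
    by (fastforce simp: line_extension_mem_iff image_iff)
  have Kc: "K \<subseteq> carrier R" using subfieldE(3)[OF K] .
  have "inj_on ?f (K \<times> Span K Us)"
  proof (rule inj_onI, clarify)
    fix k v k' v'
    assume A: "k \<in> K" "k' \<in> K" "v \<in> Span K Us" "v' \<in> Span K Us" "k \<otimes> u \<oplus> v = k' \<otimes> u \<oplus> v'"
    have c: "k \<in> carrier R" "k' \<in> carrier R" "v \<in> carrier R" "v' \<in> carrier R"
      using A Kc Span_subgroup_props(1)[OF K Us] by auto
    have "(k \<ominus> k') \<otimes> u = (k \<otimes> u \<oplus> v) \<ominus> (k' \<otimes> u \<oplus> v') \<oplus> (v' \<ominus> v)"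
      using c ind(3) by algebra
    also have "\<dots> = v' \<ominus> v" unfolding A(5) using c ind(3) by algebra
    finally have e: "(k \<ominus> k') \<otimes> u = v' \<ominus> v" .
    have "v' \<ominus> v \<in> Span K Us"
      unfolding a_minus_def using A(3,4) Span_subgroup_props(3,4)[OF K Us] by blast
    then have "k \<ominus> k' \<in> K - {\<zero>} \<Longrightarrow> u \<in> Span K Us"
      using Span_m_inv_simprule[OF K Us _ ind(3)] e by metis
    moreover have "k \<ominus> k' \<in> K"
      unfolding a_minus_def using A subringE[OF subfieldE(1)[OF K]] by auto
    ultimately have "k \<ominus> k' = \<zero>" using ind(1) by blast
    then have kk: "k = k'" using c by simp
    then show "k = k' \<and> v = v'" using A(5) c ind(3) by simp
  qed
  then have "card (Span K (u # Us)) = card (K \<times> Span K Us)" unfolding eq by (rule card_image)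
  then show ?case unfolding eq using IH fin by (simp add: card_cartesian_product)
qed

text \<open>A longest independent list in \<open>W\<close> spans it, and one exists because
  independent lists are distinct. This is the bridge between \<open>dim\<close> and counting: all
  later dimension estimates are proved as inequalities between cardinalities. It holds in any ring,
  so that it also applies to residue fields.\<close>

lemma (in ring) card_lin_sub:
  assumes K: "subfield K R" and fin: "finite K" "finite W" and W: "lin_sub K W"
  shows "card W = card K ^ dim K W"
proof -
  let ?P = "\<lambda>n. \<exists>Us. independent K Us \<and> set Us \<subseteq> W \<and> length Us = n"
  have "?P 0" by auto
  moreover have "\<forall>n. ?P n \<longrightarrow> n \<le> card W"
    using independent_distinct[OF K] distinct_card card_mono[OF fin(2)] by metis
  ultimately obtain n where n: "?P n" "\<And>m. ?P m \<Longrightarrow> m \<le> n"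
    using Nat.ex_has_greatest_nat[of ?P 0 "card W"] by blast
  then obtain Us where Us: "independent K Us" "set Us \<subseteq> W" "length Us = n" by blast
  have "Span K Us \<subseteq> W" using Us(2)
  proof (induction Us)
    case Nil
    then show ?case using lin_subD(2)[OF W] by auto
  next
    case (Cons u Us)
    show ?case
    proof
      fix y assume "y \<in> Span K (u # Us)"
      then obtain k v where "k \<in> K" "v \<in> Span K Us" "y = k \<otimes> u \<oplus> v"
        by (auto simp: line_extension_mem_iff)
      then show "y \<in> W" using lin_subD(3,4)[OF W] Cons by auto
    qed
  qed
  moreover have "W \<subseteq> Span K Us"
  proof
    fix u assume u: "u \<in> W"
    show "u \<in> Span K Us"
    proof (rule ccontr)
      assume "u \<notin> Span K Us"
      then have "independent K (u # Us)" using Us u lin_subD(1)[OF W] by (intro li_Cons) auto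
      then have "?P (Suc n)" using u Us by (intro exI[of _ "u # Us"]) auto
      then show False using n(2)[of "Suc n"] by simp
    qed
  qed
  ultimately have sp: "Span K Us = W" by blast
  then have "dim K W = length Us"
    using dimI[OF K dimensionI[OF K Us(1) sp]] by (simp add: over_def)
  then show ?thesis using card_Span_independent[OF K fin(1) Us(1)] sp by simp
qed

section \<open>Polynomial relations\<close>

text \<open>Horner form with the constant coefficient first and zeros allowed anywhere. Lists of
  fixed length are easy to count, and removing the head of a relation amounts to division by
  \<open>x\<close>.\<close>

fun (in ring) ev :: "'a \<Rightarrow> 'a list \<Rightarrow> 'a" where
  "ev x [] = \<zero>"
| "ev x (y # ys) = y \<oplus> x \<otimes> ev x ys"

context cring
begin

lemma ev_closed [simp, intro]: "x \<in> carrier R \<Longrightarrow> set ys \<subseteq> carrier R \<Longrightarrow> ev x ys \<in> carrier R"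
  by (induction ys) auto

lemma ev_append:
  "x \<in> carrier R \<Longrightarrow> set ys \<subseteq> carrier R \<Longrightarrow> set zs \<subseteq> carrier R \<Longrightarrow>
    ev x (ys @ zs) = ev x ys \<oplus> x [^] length ys \<otimes> ev x zs"
proof (induction ys)
  case (Cons y ys)
  have c: "y \<in> carrier R" "ev x ys \<in> carrier R" "ev x zs \<in> carrier R" "x [^] length ys \<in> carrier R"
    using Cons.prems by auto
  show ?case using Cons c by simp (use c Cons.prems(1) in algebra)
qed auto

lemma ev_replicate_zero: "x \<in> carrier R \<Longrightarrow> ev x (replicate n \<zero>) = \<zero>"
  by (induction n) auto

lemma ev_map2:
  "length as = length bs \<Longrightarrow> x \<in> carrier R \<Longrightarrow> set as \<subseteq> carrier R \<Longrightarrow> set bs \<subseteq> carrier R \<Longrightarrow>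
    ev x (map2 (\<oplus>) as bs) = ev x as \<oplus> ev x bs"
proof (induction as bs rule: list_induct2)
  case (Cons a as b bs)
  have c: "a \<in> carrier R" "b \<in> carrier R" "ev x as \<in> carrier R" "ev x bs \<in> carrier R"
    using Cons.prems by auto
  show ?case using Cons c by simp (use c Cons.prems(1) in algebra)
qed auto

lemma ev_smult:
  "x \<in> carrier R \<Longrightarrow> k \<in> carrier R \<Longrightarrow> set as \<subseteq> carrier R \<Longrightarrow>
    ev x (map ((\<otimes>) k) as) = k \<otimes> ev x as"
proof (induction as)
  case (Cons a as)
  have c: "a \<in> carrier R" "ev x as \<in> carrier R" using Cons.prems by auto
  show ?case using Cons c by simp (use c Cons.prems in algebra)
qed auto

text \<open>Values of polynomials of degree below \<open>l\<close>. The coefficient set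
  \<open>C\<close> may be an ideal instead of a ring, as Chevalley's argument requires.\<close>

definition evs :: "'a set \<Rightarrow> 'a \<Rightarrow> nat \<Rightarrow> 'a set" where
  "evs C x l = {ev x cs | cs. set cs \<subseteq> C \<and> length cs = l}"

lemma evs_I: "set cs \<subseteq> C \<Longrightarrow> length cs = l \<Longrightarrow> ev x cs \<in> evs C x l"
  unfolding evs_def by blast

lemma evs_E:
  assumes "p \<in> evs C x l" obtains cs where "set cs \<subseteq> C" "length cs = l" "p = ev x cs"
  using assms unfolding evs_def by blast

context
  fixes x C assumes x: "x \<in> carrier R" and C: "C \<subseteq> carrier R" "\<zero> \<in> C"
begin

lemma evs_carrier: "evs C x l \<subseteq> carrier R"
  unfolding evs_def using x C by (auto intro!: ev_closed)

lemma evs_add: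
  assumes "\<And>c d. c \<in> C \<Longrightarrow> d \<in> C \<Longrightarrow> c \<oplus> d \<in> C" and "p \<in> evs C x l" "r \<in> evs C x l"
  shows "p \<oplus> r \<in> evs C x l"
proof -
  obtain cs ds where c: "set cs \<subseteq> C" "length cs = l" "p = ev x cs"
    and d: "set ds \<subseteq> C" "length ds = l" "r = ev x ds"
    using assms(2,3) by (metis evs_E)
  have "p \<oplus> r = ev x (map2 (\<oplus>) cs ds)"
    using c d x by (simp add: ev_map2 subset_trans[OF _ C(1)])
  moreover have "set (map2 (\<oplus>) cs ds) \<subseteq> C"
    using c d by (auto elim!: in_set_zipE intro!: assms(1))
  ultimately show ?thesis using evs_I[of "map2 (\<oplus>) cs ds" C l x] c(2) d(2) by simp
qed

lemma evs_smult:
  assumes "k \<in> carrier R" "\<And>c. c \<in> C \<Longrightarrow> k \<otimes> c \<in> D" "p \<in> evs C x l"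
  shows "k \<otimes> p \<in> evs D x l"
proof -
  obtain cs where c: "set cs \<subseteq> C" "length cs = l" "p = ev x cs" using assms(3) by (metis evs_E)
  have "k \<otimes> p = ev x (map ((\<otimes>) k) cs)"
    using c assms(1) x by (simp add: ev_smult subset_trans[OF _ C(1)])
  moreover have "set (map ((\<otimes>) k) cs) \<subseteq> D" using c assms(2) by auto
  ultimately show ?thesis using evs_I[of "map ((\<otimes>) k) cs" D l x] c(2) by simp
qed

lemma evs_mult_x:
  assumes "p \<in> evs C x l" shows "x \<otimes> p \<in> evs C x (Suc l)"
proof -
  obtain cs where c: "set cs \<subseteq> C" "length cs = l" "p = ev x cs" using assms by (metis evs_E)
  have "ev x cs \<in> carrier R" using c x by (simp add: subset_trans[OF _ C(1)])
  then have "x \<otimes> p = ev x (\<zero> # cs)" using c x by simp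
  then show ?thesis using c C evs_I[of "\<zero> # cs" C "Suc l" x] by (auto simp del: ev.simps)
qed

lemma evs_mono:
  assumes "l \<le> m" shows "evs C x l \<subseteq> evs C x m"
proof
  fix p assume "p \<in> evs C x l"
  then obtain cs where c: "set cs \<subseteq> C" "length cs = l" "p = ev x cs" by (metis evs_E)
  have rz: "set (replicate (m - l) \<zero>) \<subseteq> carrier R" by auto
  have "p = ev x (cs @ replicate (m - l) \<zero>)"
    using c x ev_append[OF x _ rz, of cs] by (simp add: subset_trans[OF _ C(1)] ev_replicate_zero)
  moreover have "set (cs @ replicate (m - l) \<zero>) \<subseteq> C" using c C by auto
  ultimately show "p \<in> evs C x m" using c assms evs_I[of "cs @ replicate (m - l) \<zero>" C m x] by simp
qed

lemma zero_evs: "\<zero> \<in> evs C x l"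
proof -
  have "\<zero> \<in> evs C x 0" using evs_I[of "[]" C 0 x] by simp
  then show ?thesis using evs_mono[of 0 l] by blast
qed

lemma coeff_evs: "c \<in> C \<Longrightarrow> c \<in> evs C x 1"
  using evs_I[of "[c]" C 1 x] x C by auto

lemma x_evs: "\<one> \<in> C \<Longrightarrow> x \<in> evs C x 2"
  using evs_I[of "[\<zero>, \<one>]" C 2 x] x C by auto

end

lemma evs_mult:
  assumes x: "x \<in> carrier R" and C: "subring C R"
    and "p \<in> evs C x l" "r \<in> evs C x m" shows "p \<otimes> r \<in> evs C x (l + m)"
proof -
  note CE = subringE[OF C] and Cc = subringE(1,2)[OF C]
  obtain cs where c: "set cs \<subseteq> C" "length cs = l" "p = ev x cs" using assms by (metis evs_E)
  have r: "r \<in> carrier R" using assms(4) evs_carrier[OF x Cc] by blast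
  have "set cs \<subseteq> C \<Longrightarrow> ev x cs \<otimes> r \<in> evs C x (length cs + m)"
  proof (induction cs)
    case Nil
    then show ?case using r zero_evs[OF x Cc] by simp
  next
    case (Cons d cs)
    then have m: "d \<in> C" "d \<in> carrier R" "ev x cs \<in> carrier R"
      using x Cc(1) by auto
    have "ev x (d # cs) \<otimes> r = d \<otimes> r \<oplus> x \<otimes> (ev x cs \<otimes> r)"
      unfolding ev.simps using m(2,3) r x by algebra
    moreover have "d \<otimes> r \<in> evs C x (length (d # cs) + m)"
      using evs_smult[OF x Cc m(2) CE(6)[OF m(1)] assms(4)] evs_mono[OF x Cc, of m "length (d # cs) + m"] by auto
    moreover have "x \<otimes> (ev x cs \<otimes> r) \<in> evs C x (length (d # cs) + m)"
      using evs_mult_x[OF x Cc Cons.IH] Cons.prems by simp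
    ultimately show ?case using evs_add[OF x Cc CE(7)] by metis
  qed
  then show ?thesis using c by blast
qed

text \<open>The union is \<open>C[x]\<close>. It serves for \<open>K[y]\<close> and for adjoining
  one element to a maximal subring in \<open>exists_pole\<close>.\<close>

lemma subring_evs:
  assumes x: "x \<in> carrier R" and C: "subring C R"
  shows "subring (\<Union>l. evs C x l) R"
proof (rule subringI)
  note CE = subringE[OF C] and Cc = subringE(1,2)[OF C]
  show "(\<Union>l. evs C x l) \<subseteq> carrier R" using evs_carrier[OF x Cc] by blast
  show "\<one> \<in> (\<Union>l. evs C x l)" using coeff_evs[OF x Cc CE(3)] by blast
  show "\<ominus> h \<in> (\<Union>l. evs C x l)" if h: "h \<in> (\<Union>l. evs C x l)" for h
  proof -
    obtain l where l: "h \<in> evs C x l" using h by blast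
    have "\<ominus> \<one> \<in> C" using CE(3,5) by blast
    then have "(\<ominus> \<one>) \<otimes> h \<in> evs C x l" by (intro evs_smult[OF x Cc _ _ l] CE(6)) auto
    moreover have "h \<in> carrier R" using l evs_carrier[OF x Cc] by blast
    ultimately show ?thesis by (auto simp: l_minus)
  qed
  show "h1 \<otimes> h2 \<in> (\<Union>l. evs C x l)" if h: "h1 \<in> (\<Union>l. evs C x l)" "h2 \<in> (\<Union>l. evs C x l)" for h1 h2
    using h evs_mult[OF x C] by blast
  show "h1 \<oplus> h2 \<in> (\<Union>l. evs C x l)" if h: "h1 \<in> (\<Union>l. evs C x l)" "h2 \<in> (\<Union>l. evs C x l)" for h1 h2
  proof -
    obtain l m where "h1 \<in> evs C x l" "h2 \<in> evs C x m" using h by blast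
    then have "h1 \<in> evs C x (l + m)" "h2 \<in> evs C x (l + m)"
      using evs_mono[OF x Cc, of l "l + m"] evs_mono[OF x Cc, of m "l + m"] by auto
    then show ?thesis using evs_add[OF x Cc CE(7)] by blast
  qed
qed

lemma ev_rev_eq_eval:
  "x \<in> carrier R \<Longrightarrow> set p \<subseteq> carrier R \<Longrightarrow> ev x (rev p) = eval p x"
proof (induction p)
  case (Cons a p)
  have "eval p x \<in> carrier R" using Cons.prems by (simp add: eval_in_carrier)
  then show ?case using Cons by (simp add: ev_append a_comm m_comm)
qed auto

lemma eval_replicate_zero:
  "x \<in> carrier R \<Longrightarrow> set p \<subseteq> carrier R \<Longrightarrow> eval (replicate n \<zero> @ p) x = eval p x"
  by (induction n) (auto simp: eval_in_carrier)

end

text \<open>Substituting \<open>1/x\<close> reverses the coefficients. The factor \<open>x\<close>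
  on the right replaces the exponent \<open>length ys - 1\<close> on the left, so the empty list is
  no exception.\<close>

lemma (in field) ev_inv:
  assumes x: "x \<in> carrier R" "x \<noteq> \<zero>" and ys: "set ys \<subseteq> carrier R"
  shows "x [^] length ys \<otimes> ev (inv x) ys = x \<otimes> ev x (rev ys)"
  using ys
proof (induction ys)
  case Nil
  then show ?case using x by simp
next
  case (Cons y ys)
  have i: "inv x \<in> carrier R" "x \<otimes> inv x = \<one>" using x by (auto simp: field_Units)
  have c: "y \<in> carrier R" "set ys \<subseteq> carrier R" using Cons.prems by auto
  then have e: "ev (inv x) ys \<in> carrier R" "x [^] length ys \<in> carrier R" "ev x (rev ys) \<in> carrier R"
    using i x by auto
  have IH: "x [^] length ys \<otimes> ev (inv x) ys = x \<otimes> ev x (rev ys)" using Cons by auto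
  have "x [^] length (y # ys) \<otimes> ev (inv x) (y # ys)
      = x \<otimes> (x [^] length ys \<otimes> y) \<oplus> (x \<otimes> inv x) \<otimes> (x [^] length ys \<otimes> ev (inv x) ys)"
    unfolding list.size nat_pow_Suc2 ev.simps add_0_right add_Suc_right nat_pow_Suc
    using e i(1) x(1) c(1) by algebra
  also have "\<dots> = x \<otimes> ev x (rev (y # ys))"
    unfolding i(2) IH using e i x(1) c by (simp add: ev_append r_distr m_comm a_comm)
  finally show ?case .
qed

text \<open>\<open>transcendental_off_K\<close> is the contrapositive of
  \<open>full_constant_field\<close>.\<close>

locale global_function_field = field F for F :: "('a, 'b) ring_scheme" (structure) +
  fixes K :: "'a set"
  assumes K_subfield: "subfield K F"
    and finite_K [simp]: "finite K"
    and transcendental_off_K: "\<And>z. z \<in> carrier F \<Longrightarrow> z \<notin> K \<Longrightarrow> transcendental K z"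
    and ex_generator: "\<exists>x\<in>carrier F. finite_dimension (generate_field F (insert x K)) (carrier F)"
begin

abbreviation "q \<equiv> card K"

lemma K_props [simp, intro]:
  "k \<in> K \<Longrightarrow> k \<in> carrier F" "\<zero> \<in> K" "\<one> \<in> K" "k \<in> K \<Longrightarrow> \<ominus> k \<in> K"
  "k \<in> K \<Longrightarrow> l \<in> K \<Longrightarrow> k \<oplus> l \<in> K" "k \<in> K \<Longrightarrow> l \<in> K \<Longrightarrow> k \<otimes> l \<in> K"
  "k \<in> K \<Longrightarrow> k \<noteq> \<zero> \<Longrightarrow> inv k \<in> K"
  using subringE[OF subfieldE(1)[OF K_subfield]] subfield_m_inv(1)[OF K_subfield, of k] by auto

lemma K_sub: "K \<subseteq> carrier F" by auto

lemma q_ge_2: "q \<ge> 2"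
proof -
  have "card {\<zero>, \<one>} \<le> q" by (rule card_mono) auto
  then show ?thesis using one_not_zero by simp
qed

lemma inv_closed [simp, intro]: "z \<in> carrier F \<Longrightarrow> z \<noteq> \<zero> \<Longrightarrow> inv z \<in> carrier F"
  by (simp add: field_Units)

lemma r_inv_nz [simp]: "z \<in> carrier F \<Longrightarrow> z \<noteq> \<zero> \<Longrightarrow> z \<otimes> inv z = \<one>"
  by (simp add: field_Units)

lemma l_inv_nz [simp]: "z \<in> carrier F \<Longrightarrow> z \<noteq> \<zero> \<Longrightarrow> inv z \<otimes> z = \<one>"
  by (simp add: field_Units)

lemma inv_nz [simp]: "z \<in> carrier F \<Longrightarrow> z \<noteq> \<zero> \<Longrightarrow> inv z \<noteq> \<zero>"
  by (metis r_inv_nz r_null one_not_zero)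

lemma inv_inv_nz [simp]: "z \<in> carrier F \<Longrightarrow> z \<noteq> \<zero> \<Longrightarrow> inv (inv z) = z"
  by (simp add: field_Units)

lemma inv_mult_nz: 
  "z \<in> carrier F \<Longrightarrow> z \<noteq> \<zero> \<Longrightarrow> w \<in> carrier F \<Longrightarrow> w \<noteq> \<zero> \<Longrightarrow> inv (z \<otimes> w) = inv z \<otimes> inv w"
proof -
  assume c: "z \<in> carrier F" "z \<noteq> \<zero>" "w \<in> carrier F" "w \<noteq> \<zero>"
  have i: "inv z \<in> carrier F" "inv w \<in> carrier F" using c by auto
  have "z \<otimes> w \<otimes> (inv z \<otimes> inv w) = (z \<otimes> inv z) \<otimes> (w \<otimes> inv w)" using c(1,3) i by algebra
  then have "z \<otimes> w \<otimes> (inv z \<otimes> inv w) = \<one>" using c by simp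
  moreover from this have "inv z \<otimes> inv w \<otimes> (z \<otimes> w) = \<one>" using c i by (simp add: m_comm)
  ultimately show ?thesis using inv_unique'[of "z \<otimes> w" "inv z \<otimes> inv w"] c i by simp
qed

lemma inv_mem_K_iff: "z \<in> carrier F \<Longrightarrow> z \<noteq> \<zero> \<Longrightarrow> inv z \<in> K \<longleftrightarrow> z \<in> K"
  by (metis K_props(7) inv_inv_nz inv_nz)

lemma ev_K_eq_zero:
  assumes z: "z \<in> carrier F" "z \<notin> K" and cs: "set cs \<subseteq> K" and e: "ev z cs = \<zero>"
  shows "set cs \<subseteq> {\<zero>}"
proof -
  let ?p = "rev cs"
  have c: "set ?p \<subseteq> carrier F" "set ?p \<subseteq> K" using cs by auto
  have "eval ?p z = \<zero>" using ev_rev_eq_eval[OF z(1) c(1)] e by simp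
  moreover have "eval ?p z = eval (normalize ?p) z"
    using normalize_trick[of ?p] eval_replicate_zero[OF z(1) normalize_in_carrier[OF c(1)]] by metis
  moreover have "normalize ?p \<in> carrier (K[X])"
    using normalize_gives_polynomial[OF c(2)] by (simp add: univ_poly_def)
  ultimately have "normalize ?p = []"
    using eval_transcendental[of K z] transcendental_off_K[OF z] by (auto simp: over_def)
  then have "?p = replicate (length ?p) \<zero>" using normalize_trick[of ?p] by simp
  then show ?thesis by (metis in_set_replicate set_rev singleton_iff subsetI)
qed

section \<open>Bounded filtrations\<close>

abbreviation "PL \<equiv> evs K"

lemma PL_eq_image: "PL x l = ev x ` {cs. set cs \<subseteq> K \<and> length cs = l}"
  unfolding evs_def by blast

lemma finite_PL: "finite (PL x l)"
  unfolding PL_eq_image by (intro finite_imageI finite_lists_length_eq) simp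

lemma card_PL: "card (PL x l) \<le> q ^ l"
  unfolding PL_eq_image card_lists_length_eq[OF finite_K, symmetric]
  by (intro card_image_le finite_lists_length_eq) simp

lemma K_subring: "subring K F"
  using subfieldE(1)[OF K_subfield] .

context
  fixes x assumes x: "x \<in> carrier F"
begin

lemmas PL_carrier = evs_carrier[OF x K_sub K_props(2)]
  and PL_mono = evs_mono[OF x K_sub K_props(2)]
  and zero_PL = zero_evs[OF x K_sub K_props(2)]
  and K_PL = coeff_evs[OF x K_sub K_props(2)]
  and x_PL = x_evs[OF x K_sub K_props(2) K_props(3)]
  and PL_mult = evs_mult[OF x K_subring]

lemma PL_add: "p \<in> PL x l \<Longrightarrow> r \<in> PL x l \<Longrightarrow> p \<oplus> r \<in> PL x l"
  by (rule evs_add[OF x K_sub K_props(2)]) auto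

lemma PL_smult: "k \<in> K \<Longrightarrow> p \<in> PL x l \<Longrightarrow> k \<otimes> p \<in> PL x l"
  by (rule evs_smult[OF x K_sub K_props(2)]) auto

lemma PL_uminus: "p \<in> PL x l \<Longrightarrow> \<ominus> p \<in> PL x l"
  using PL_smult[of "\<ominus> \<one>" p l] PL_carrier[of l] by (auto simp: l_minus subset_iff)

section \<open>Clearing denominators over \<open>K[x]\<close>\<close>

lemma generate_field_fraction:
  assumes "z \<in> generate_field F (insert x K)"
  shows "\<exists>a b l m. z = a \<otimes> inv b \<and> a \<in> PL x l \<and> b \<in> PL x m \<and> b \<noteq> \<zero>"
proof -
  define Q where "Q = {z. \<exists>a b l m. z = a \<otimes> inv b \<and> a \<in> PL x l \<and> b \<in> PL x m \<and> b \<noteq> \<zero>}"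
  have QI: "z \<in> Q" if "z = a \<otimes> inv b" "a \<in> PL x l" "b \<in> PL x m" "b \<noteq> \<zero>" for z a b l m
    unfolding Q_def using that by blast
  have QE: thesis if "z \<in> Q" "\<And>a b l m. z = a \<otimes> inv b \<Longrightarrow> a \<in> PL x l \<Longrightarrow> b \<in> PL x m \<Longrightarrow> b \<noteq> \<zero>
      \<Longrightarrow> a \<in> carrier F \<Longrightarrow> b \<in> carrier F \<Longrightarrow> inv b \<in> carrier F \<Longrightarrow> thesis" for z thesis
    using that PL_carrier unfolding Q_def by (blast intro: inv_closed)
  have one: "\<one> \<in> PL x 1" using K_PL by simp
  have "z \<in> Q" using assms
  proof induction
    case one
    show ?case by (rule QI[of _ \<one> \<one>, OF _ K_PL K_PL]) auto
  next
    case (incl h)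
    have "h \<in> PL x 2" using incl x_PL K_PL[of h] PL_mono[of 1 2] by auto
    moreover have "h = h \<otimes> inv \<one>" using incl x by auto
    ultimately show ?case using QI one one_not_zero by blast
  next
    case (a_inv h)
    from a_inv(2) show ?case
    proof (rule QE)
      fix a b l m assume h: "h = a \<otimes> inv b" "a \<in> PL x l" "b \<in> PL x m" "b \<noteq> \<zero>"
        and c: "a \<in> carrier F" "b \<in> carrier F" "inv b \<in> carrier F"
      have "\<ominus> h = (\<ominus> a) \<otimes> inv b" using h(1) c by (simp add: l_minus)
      from QI[OF this PL_uminus[OF h(2)] h(3,4)] show ?thesis .
    qed
  next
    case (m_inv h)
    from m_inv(3) show ?case
    proof (rule QE)
      fix a b l m assume h: "h = a \<otimes> inv b" "a \<in> PL x l" "b \<in> PL x m" "b \<noteq> \<zero>"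
        and c: "a \<in> carrier F" "b \<in> carrier F" "inv b \<in> carrier F"
      have "a \<noteq> \<zero>" using m_inv(2) h c by auto
      moreover have "inv h = b \<otimes> inv a"
        using h c \<open>a \<noteq> \<zero>\<close> inv_mult_nz[of a "inv b"] inv_nz[of b] by (simp add: m_comm)
      ultimately show ?thesis using QI[OF _ h(3,2)] by blast
    qed
  next
    case (eng_add h1 h2)
    from eng_add(3) show ?case
    proof (rule QE)
      fix a b l m assume h: "h1 = a \<otimes> inv b" "a \<in> PL x l" "b \<in> PL x m" "b \<noteq> \<zero>"
        and c: "a \<in> carrier F" "b \<in> carrier F" "inv b \<in> carrier F"
      from eng_add(4) show ?thesis
      proof (rule QE)
        fix a' b' l' m' assume h': "h2 = a' \<otimes> inv b'" "a' \<in> PL x l'" "b' \<in> PL x m'" "b' \<noteq> \<zero>"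
          and c': "a' \<in> carrier F" "b' \<in> carrier F" "inv b' \<in> carrier F"
        have nz: "b \<otimes> b' \<noteq> \<zero>" using h h' c c' integral by blast
        have "h1 \<oplus> h2 = a \<otimes> inv b \<otimes> \<one> \<oplus> a' \<otimes> inv b' \<otimes> \<one>" using h(1) h'(1) c c' by simp
        also have "\<dots> = a \<otimes> inv b \<otimes> (b' \<otimes> inv b') \<oplus> a' \<otimes> inv b' \<otimes> (b \<otimes> inv b)"
          using h(4) h'(4) c(2) c'(2) by simp
        also have "\<dots> = (a \<otimes> b' \<oplus> a' \<otimes> b) \<otimes> (inv b \<otimes> inv b')" using c c' by algebra
        also have "inv b \<otimes> inv b' = inv (b \<otimes> b')" using inv_mult_nz[OF c(2) h(4) c'(2) h'(4)] by simp
        finally have e: "h1 \<oplus> h2 = (a \<otimes> b' \<oplus> a' \<otimes> b) \<otimes> inv (b \<otimes> b')" .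
        have "a \<otimes> b' \<in> PL x ((l + m') + (l' + m))" "a' \<otimes> b \<in> PL x ((l + m') + (l' + m))"
          using PL_mult[OF h(2) h'(3)] PL_mult[OF h'(2) h(3)] PL_mono[of "l + m'" "(l + m') + (l' + m)"]
            PL_mono[of "l' + m" "(l + m') + (l' + m)"] by auto
        from QI[OF e PL_add[OF this] PL_mult[OF h(3) h'(3)] nz] show ?thesis .
      qed
    qed
  next
    case (eng_mult h1 h2)
    from eng_mult(3) show ?case
    proof (rule QE)
      fix a b l m assume h: "h1 = a \<otimes> inv b" "a \<in> PL x l" "b \<in> PL x m" "b \<noteq> \<zero>"
        and c: "a \<in> carrier F" "b \<in> carrier F" "inv b \<in> carrier F"
      from eng_mult(4) show ?thesis
      proof (rule QE)
        fix a' b' l' m' assume h': "h2 = a' \<otimes> inv b'" "a' \<in> PL x l'" "b' \<in> PL x m'" "b' \<noteq> \<zero>"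
          and c': "a' \<in> carrier F" "b' \<in> carrier F" "inv b' \<in> carrier F"
        have nz: "b \<otimes> b' \<noteq> \<zero>" using h h' c c' integral by blast
        have "h1 \<otimes> h2 = (a \<otimes> a') \<otimes> (inv b \<otimes> inv b')" unfolding h(1) h'(1) using c c' by algebra
        also have "inv b \<otimes> inv b' = inv (b \<otimes> b')" using inv_mult_nz[OF c(2) h(4) c'(2) h'(4)] by simp
        finally have e: "h1 \<otimes> h2 = (a \<otimes> a') \<otimes> inv (b \<otimes> b')" .
        from QI[OF e PL_mult[OF h(2) h'(2)] PL_mult[OF h(3) h'(3)] nz] show ?thesis .
      qed
    qed
  qed
  then show ?thesis unfolding Q_def by blast
qed

text \<open>The truncated lattice of combinations of \<open>us\<close> with coefficients of degree
  below \<open>l\<close> in \<open>x\<close>. Truncation makes it finite, with the logarithm of its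
  size growing at most linearly in \<open>l\<close>.\<close>

fun Lam :: "'a list \<Rightarrow> nat \<Rightarrow> 'a set" where
  "Lam [] l = {\<zero>}"
| "Lam (u # us) l = (\<lambda>(p, z). p \<otimes> u \<oplus> z) ` (PL x l \<times> Lam us l)"

lemma finite_Lam: "finite (Lam us l)"
  by (induction us) (auto simp: finite_PL)

lemma card_Lam: "card (Lam us l) \<le> q ^ (l * length us)"
proof (induction us)
  case (Cons u us)
  have "card (Lam (u # us) l) \<le> card (PL x l \<times> Lam us l)"
    unfolding Lam.simps by (intro card_image_le finite_cartesian_product finite_PL finite_Lam)
  also have "\<dots> \<le> q ^ l * q ^ (l * length us)"
    unfolding card_cartesian_product by (intro mult_le_mono card_PL Cons.IH)
  finally show ?case by (simp add: power_add)
qed auto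

lemma PL_in_carrier: "p \<in> PL x l \<Longrightarrow> p \<in> carrier F"
  using PL_carrier by blast

lemma Lam_carrier: "set us \<subseteq> carrier F \<Longrightarrow> Lam us l \<subseteq> carrier F"
proof (induction us)
  case (Cons u us)
  then have "u \<in> carrier F" "Lam us l \<subseteq> carrier F" by simp_all
  then show ?case by (auto simp del: K_props intro: PL_in_carrier)
qed simp

lemma Lam_mono: "l \<le> m \<Longrightarrow> Lam us l \<subseteq> Lam us m"
proof (induction us)
  case (Cons u us)
  then show ?case using PL_mono[of l m] unfolding Lam.simps by (intro image_mono Sigma_mono) simp_all
qed simp

lemma zero_Lam: "set us \<subseteq> carrier F \<Longrightarrow> \<zero> \<in> Lam us l"
proof (induction us)
  case (Cons u us)
  then have "\<zero> = \<zero> \<otimes> u \<oplus> \<zero>" "\<zero> \<in> Lam us l" by simp_all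
  then show ?case unfolding Lam.simps using zero_PL by (intro image_eqI[of _ _ "(\<zero>, \<zero>)"]) simp_all
qed simp

lemma Lam_add:
  "set us \<subseteq> carrier F \<Longrightarrow> z \<in> Lam us l \<Longrightarrow> w \<in> Lam us l \<Longrightarrow> z \<oplus> w \<in> Lam us l"
proof (induction us arbitrary: z w)
  case (Cons u us)
  from Cons.prems obtain p z' r w' where
    zw: "p \<in> PL x l" "r \<in> PL x l" "z' \<in> Lam us l" "w' \<in> Lam us l" "z = p \<otimes> u \<oplus> z'" "w = r \<otimes> u \<oplus> w'"
    by auto
  have c: "p \<in> carrier F" "r \<in> carrier F" "z' \<in> carrier F" "w' \<in> carrier F" "u \<in> carrier F"
    using zw PL_carrier Lam_carrier[of us] Cons.prems(1) by auto
  have "z \<oplus> w = (p \<oplus> r) \<otimes> u \<oplus> (z' \<oplus> w')" unfolding zw(5,6) using c by algebra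
  moreover have "p \<oplus> r \<in> PL x l" "z' \<oplus> w' \<in> Lam us l" using zw PL_add Cons by auto
  ultimately show ?case by auto
qed auto

lemma Lam_mult:
  "set us \<subseteq> carrier F \<Longrightarrow> p \<in> PL x e \<Longrightarrow> z \<in> Lam us l \<Longrightarrow> p \<otimes> z \<in> Lam us (e + l)"
proof (induction us arbitrary: z)
  case Nil
  then have "p \<in> carrier F" using PL_carrier by blast
  then show ?case using Nil by simp
next
  case (Cons u us)
  from Cons.prems obtain r z' where
    z: "r \<in> PL x l" "z' \<in> Lam us l" "z = r \<otimes> u \<oplus> z'" by auto
  have c: "p \<in> carrier F" "r \<in> carrier F" "z' \<in> carrier F" "u \<in> carrier F"
    using z PL_carrier Lam_carrier[of us] Cons.prems by auto
  have "p \<otimes> z = (p \<otimes> r) \<otimes> u \<oplus> p \<otimes> z'" unfolding z(3) using c by algebra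
  moreover have "p \<otimes> r \<in> PL x (e + l)" "p \<otimes> z' \<in> Lam us (e + l)"
    using z Cons PL_mult[of p e r l] by auto
  ultimately show ?case by auto
qed

lemma Lam_basis: "set us \<subseteq> carrier F \<Longrightarrow> u \<in> set us \<Longrightarrow> u \<in> Lam us 1"
proof (induction us)
  case (Cons v us)
  show ?case
  proof (cases "u = v")
    case True
    then have "u = \<one> \<otimes> v \<oplus> \<zero>" using Cons.prems by simp
    then show ?thesis using K_PL[of \<one>] zero_Lam[of us 1] Cons.prems by force
  next
    case False
    then have u: "u \<in> Lam us 1" using Cons by auto
    have "u = \<zero> \<otimes> v \<oplus> u" using Cons.prems by (auto simp: subset_iff)
    then show ?thesis using zero_PL u by force
  qed
qed auto

text \<open>The elements that some nonzero polynomial moves into a lattice form a vector space over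
  \<open>K(x)\<close>: denominators multiply and degree bounds add. It contains \<open>us\<close>,
  hence their span.\<close>

lemma Lam_denominator:
  assumes us: "set us \<subseteq> carrier F" and z: "z \<in> Span (generate_field F (insert x K)) us"
  shows "\<exists>g e c. g \<in> PL x e \<and> g \<noteq> \<zero> \<and> g \<otimes> z \<in> Lam us c"
proof -
  let ?D = "{z \<in> carrier F. \<exists>g e c. g \<in> PL x e \<and> g \<noteq> \<zero> \<and> g \<otimes> z \<in> Lam us c}"
  let ?G = "generate_field F (insert x K)"
  have add: "z \<oplus> w \<in> ?D" if zw: "z \<in> ?D" "w \<in> ?D" for z w
  proof -
    from zw obtain g e c g' e' c' where
      g: "z \<in> carrier F" "g \<in> PL x e" "g \<noteq> \<zero>" "g \<otimes> z \<in> Lam us c" and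
      g': "w \<in> carrier F" "g' \<in> PL x e'" "g' \<noteq> \<zero>" "g' \<otimes> w \<in> Lam us c'" by blast
    have cc: "g \<in> carrier F" "g' \<in> carrier F" using g g' PL_carrier by auto
    have "(g \<otimes> g') \<otimes> (z \<oplus> w) = g' \<otimes> (g \<otimes> z) \<oplus> g \<otimes> (g' \<otimes> w)" using g(1) g'(1) cc by algebra
    moreover have "g' \<otimes> (g \<otimes> z) \<in> Lam us (e' + c + (e + c'))"
      using Lam_mult[OF us g'(2) g(4)] Lam_mono[of "e' + c" "e' + c + (e + c')"] by auto
    moreover have "g \<otimes> (g' \<otimes> w) \<in> Lam us (e' + c + (e + c'))"
      using Lam_mult[OF us g(2) g'(4)] Lam_mono[of "e + c'" "e' + c + (e + c')"] by auto
    ultimately have "(g \<otimes> g') \<otimes> (z \<oplus> w) \<in> Lam us (e' + c + (e + c'))" using Lam_add[OF us] by simp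
    moreover have "g \<otimes> g' \<noteq> \<zero>" using cc g g' integral by blast
    ultimately show ?thesis using PL_mult[OF g(2) g'(2)] g(1) g'(1) by blast
  qed
  have smult: "k \<otimes> z \<in> ?D" if k: "k \<in> ?G" and z: "z \<in> ?D" for k z
  proof -
    from z obtain g e c where g: "z \<in> carrier F" "g \<in> PL x e" "g \<noteq> \<zero>" "g \<otimes> z \<in> Lam us c" by blast
    obtain a b l m where h: "k = a \<otimes> inv b" "a \<in> PL x l" "b \<in> PL x m" "b \<noteq> \<zero>"
      using generate_field_fraction[OF k] by blast
    have cc: "g \<in> carrier F" "a \<in> carrier F" "b \<in> carrier F" using g h PL_carrier by blast+
    have ci: "inv b \<in> carrier F" using cc h by auto
    have "(b \<otimes> g) \<otimes> (k \<otimes> z) = (b \<otimes> inv b) \<otimes> (a \<otimes> (g \<otimes> z))"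
      unfolding h(1) using g(1) cc ci by algebra
    also have "\<dots> = a \<otimes> (g \<otimes> z)" using cc h g by simp
    finally have "(b \<otimes> g) \<otimes> (k \<otimes> z) \<in> Lam us (l + c)" using Lam_mult[OF us h(2) g(4)] by simp
    moreover have "b \<otimes> g \<noteq> \<zero>" using cc g h integral by blast
    moreover have "k \<otimes> z \<in> carrier F" using h(1) cc ci g(1) by simp
    ultimately show ?thesis using PL_mult[OF h(3) g(2)] by blast
  qed
  have basis: "u \<in> ?D" if "u \<in> set us" for u
    using Lam_basis[OF us that] K_PL[of \<one>] that us one_not_zero
    by (auto intro!: exI[of _ \<one>] simp: subset_iff)
  have "set vs \<subseteq> set us \<Longrightarrow> Span ?G vs \<subseteq> ?D" for vs
  proof (induction vs)
    case Nil
    then show ?case using zero_Lam[OF us] K_PL[of \<one>] one_not_zero by (auto intro!: exI[of _ \<one>])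
  next
    case (Cons v vs)
    show ?case
    proof
      fix y assume "y \<in> Span ?G (v # vs)"
      then obtain k w where y: "k \<in> ?G" "w \<in> Span ?G vs" "y = k \<otimes> v \<oplus> w"
        by (auto simp: line_extension_mem_iff)
      have "w \<in> ?D" using Cons y(2) by (meson set_subset_Cons subset_iff)
      moreover have "k \<otimes> v \<in> ?D" using smult[OF y(1) basis] Cons.prems by simp
      ultimately show "y \<in> ?D" using add y(3) by blast
    qed
  qed
  then show ?thesis using z by blast
qed

lemma Lam_denominator_finite:
  assumes us: "set us \<subseteq> carrier F" "Span (generate_field F (insert x K)) us = carrier F"
    and Z: "finite Z" "Z \<subseteq> carrier F"
  shows "\<exists>g e c. g \<in> PL x e \<and> g \<noteq> \<zero> \<and> (\<forall>z\<in>Z. g \<otimes> z \<in> Lam us c)"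
  using Z
proof (induction rule: finite_induct)
  case empty
  show ?case using K_PL[of \<one>] one_not_zero by blast
next
  case (insert w Z)
  then obtain g e c where g: "g \<in> PL x e" "g \<noteq> \<zero>" "\<forall>z\<in>Z. g \<otimes> z \<in> Lam us c" by auto
  have w: "w \<in> carrier F" using insert by auto
  obtain g' e' c' where g': "g' \<in> PL x e'" "g' \<noteq> \<zero>" "g' \<otimes> w \<in> Lam us c'"
    using Lam_denominator[OF us(1), of w] us(2) w by blast
  have cc: "g \<in> carrier F" "g' \<in> carrier F" using g g' PL_carrier by auto
  have "(g' \<otimes> g) \<otimes> z \<in> Lam us (e' + c + (e + c'))" if "z \<in> insert w Z" for z
  proof (cases "z = w")
    case True
    have "(g' \<otimes> g) \<otimes> w = g \<otimes> (g' \<otimes> w)" using cc w by algebra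
    then show ?thesis using True Lam_mult[OF us(1) g(1) g'(3)] Lam_mono[of "e + c'" "e' + c + (e + c')"] by auto
  next
    case False
    then have z: "z \<in> Z" "z \<in> carrier F" using that insert by auto
    have "(g' \<otimes> g) \<otimes> z = g' \<otimes> (g \<otimes> z)" using cc z by algebra
    then show ?thesis using Lam_mult[OF us(1) g'(1), of "g \<otimes> z" c] g(3) z Lam_mono[of "e' + c" "e' + c + (e + c')"] by auto
  qed
  moreover have "g' \<otimes> g \<noteq> \<zero>" using cc g g' integral by blast
  ultimately show ?case using PL_mult[OF g'(1) g(1)] by blast
qed

end

end

text \<open>If \<open>a\<close> exceeded \<open>b ^ B\<close>, the powers of the quotient would
  outgrow the constant \<open>b ^ A\<close>. Only the rate \<open>B\<close> survives, so an initial
  cost \<open>A\<close> may depend on anything.\<close>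

lemma le_power_of_growth:
  fixes a b A B :: nat
  assumes "b \<ge> 1" and growth: "\<And>n. a ^ n \<le> b ^ (A + n * B)"
  shows "a \<le> b ^ B"
proof (rule ccontr)
  assume "\<not> a \<le> b ^ B"
  then have "1 < real a / real b ^ B" using assms(1) by (simp add: field_simps flip: of_nat_power)
  then obtain n where n: "real b ^ A < (real a / real b ^ B) ^ n" using real_arch_pow by blast
  have "real a ^ n \<le> real b ^ (A + n * B)" using growth[of n] by (simp flip: of_nat_power)
  also have "\<dots> = real b ^ A * (real b ^ B) ^ n" by (simp add: power_add power_mult mult.commute)
  finally have "(real a / real b ^ B) ^ n \<le> real b ^ A" using assms(1) by (simp add: power_divide field_simps)
  then show False using n by simp
qed

context global_function_field
begin

section \<open>The degree over \<open>K(x)\<close>\<close>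

text \<open>\<open>xfree x W\<close> says that a \<open>K\<close>-basis of \<open>W\<close> is linearly independent over \<open>K(x)\<close>.\<close>

definition xfree :: "'a \<Rightarrow> 'a set \<Rightarrow> bool" where
  "xfree x W \<longleftrightarrow> finite W \<and> lin_sub K W \<and>
     (\<forall>ys. set ys \<subseteq> W \<longrightarrow> ev x ys = \<zero> \<longrightarrow> set ys \<subseteq> {\<zero>})"

lemma ev_map2_minus:
  "length as = length bs \<Longrightarrow> x \<in> carrier F \<Longrightarrow> set as \<subseteq> carrier F \<Longrightarrow> set bs \<subseteq> carrier F \<Longrightarrow>
    ev x (map2 (\<lambda>a b. a \<ominus> b) as bs) = ev x as \<ominus> ev x bs"
proof (induction as bs rule: list_induct2)
  case Nil
  then show ?case by (simp add: a_minus_def)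
next
  case (Cons a as b bs)
  have c: "a \<in> carrier F" "b \<in> carrier F" "ev x as \<in> carrier F" "ev x bs \<in> carrier F" 
    using Cons.prems by auto
  have IH: "ev x (map2 (\<lambda>a b. a \<ominus> b) as bs) = ev x as \<ominus> ev x bs" using Cons by simp
  show ?case unfolding zip_Cons_Cons list.map prod.case ev.simps IH
    using c Cons.prems(1) by algebra
qed

lemma inj_on_ev_xfree:
  assumes x: "x \<in> carrier F" and W: "xfree x W"
  shows "inj_on (ev x) {ys. set ys \<subseteq> W \<and> length ys = n}"
proof (rule inj_onI, clarify)
  fix as bs assume A: "set as \<subseteq> W" "set bs \<subseteq> W" "length bs = length as" "ev x as = ev x bs"
  have Ws: "lin_sub K W" using W by (simp add: xfree_def)
  note Wc = lin_subD(1)[OF Ws]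
  let ?ds = "map2 (\<lambda>a b. a \<ominus> b) as bs"
  have c: "set as \<subseteq> carrier F" "set bs \<subseteq> carrier F" using A Wc by auto
  have "ev x ?ds = ev x as \<ominus> ev x bs" using A c x by (intro ev_map2_minus) auto
  also have "\<dots> = \<zero>" using A(4) c x by (simp add: a_minus_def r_neg)
  finally have "ev x ?ds = \<zero>" .
  moreover have "set ?ds \<subseteq> W"
    using A(1,2) lin_sub_minus[OF Ws K_subfield] by (auto elim!: in_set_zipE)
  ultimately have z: "set ?ds \<subseteq> {\<zero>}" using W unfolding xfree_def by blast
  show "as = bs"
  proof (rule nth_equalityI)
    fix i assume i: "i < length as"
    then have "?ds ! i \<in> set ?ds" using A(3) by (intro nth_mem) simp
    then have "as ! i \<ominus> bs ! i = \<zero>" using z i A(3) by auto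
    moreover have "as ! i \<in> carrier F" "bs ! i \<in> carrier F" using c i A(3) by (auto simp: subset_iff)
    ultimately show "as ! i = bs ! i" by simp
  qed (use A in simp)
qed

lemma nat_pow_nonzero: "z \<in> carrier F \<Longrightarrow> z \<noteq> \<zero> \<Longrightarrow> z [^] (n::nat) \<noteq> \<zero>"
  by (induction n) (use integral in auto)

text \<open>The finite extension is known over \<open>K(y)\<close>, but \<open>x\<close> is
  arbitrary. By freeness the expressions \<open>ev x ys\<close> with \<open>n\<close> coefficients
  from \<open>W\<close> are \<open>card W ^ n\<close> distinct elements; after clearing denominators
  they lie in a lattice over \<open>K[y]\<close> whose level is linear in \<open>n\<close>.
  Comparing growth rates bounds \<open>card W\<close>.\<close>

lemma xfree_bounded:
  assumes x: "x \<in> carrier F"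
  shows "\<exists>N. \<forall>W. xfree x W \<longrightarrow> card W \<le> N"
proof -
  obtain y where y: "y \<in> carrier F" and fd: "finite_dimension (generate_field F (insert y K)) (carrier F)"
    using ex_generator by blast
  let ?G = "generate_field F (insert y K)"
  have G: "subfield ?G F" using y by (intro generate_field_is_subfield) auto
  obtain us where us: "set us \<subseteq> carrier F" "Span ?G us = carrier F"
    using finite_dimensionE'[OF fd] exists_base[OF G] by metis
  note y_carrier = PL_in_carrier[OF y] subsetD[OF Lam_carrier[OF y us(1)]]
  \<comment> \<open>\<open>g\<close> is a common denominator of the matrix of multiplication by
    \<open>x\<close> on the generators \<open>us\<close>, so multiplication by \<open>g x\<close>
    raises the lattice level by the fixed amount \<open>c\<close>.\<close>
  obtain g e c where g: "g \<in> PL y e" "g \<noteq> \<zero>" "\<And>u. u \<in> set us \<Longrightarrow> g \<otimes> (x \<otimes> u) \<in> Lam y us c"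
  proof -
    have "(\<lambda>u. x \<otimes> u) ` set us \<subseteq> carrier F" using us(1) x by (auto simp: subset_iff)
    from Lam_denominator_finite[OF y us _ this] show ?thesis using that by auto
  qed
  have gc: "g \<in> carrier F" using g(1) y_carrier by blast
  have step: "g \<otimes> (x \<otimes> z) \<in> Lam y us (l + c)" if "z \<in> Lam y us l" for z l
  proof -
    have "set vs \<subseteq> set us \<Longrightarrow> z \<in> Lam y vs l \<Longrightarrow> g \<otimes> (x \<otimes> z) \<in> Lam y us (l + c)" for vs
    proof (induction vs arbitrary: z)
      case Nil
      then show ?case using zero_Lam[OF y us(1)] y gc x by (simp add: Lam.simps)
    next
      case (Cons v vs)
      then obtain p w where pw: "p \<in> PL y l" "w \<in> Lam y vs l" "z = p \<otimes> v \<oplus> w"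
        using y by (auto simp: Lam.simps)
      have cc: "p \<in> carrier F" "v \<in> carrier F" "w \<in> carrier F"
        using pw y_carrier Cons.prems us Lam_carrier[OF y, of vs l] by (auto simp: subset_iff)
      have "g \<otimes> (x \<otimes> z) = p \<otimes> (g \<otimes> (x \<otimes> v)) \<oplus> g \<otimes> (x \<otimes> w)"
        unfolding pw(3) using cc gc x by algebra
      moreover have "p \<otimes> (g \<otimes> (x \<otimes> v)) \<in> Lam y us (l + c)"
        using Lam_mult[OF y us(1) pw(1) g(3)] Cons.prems by simp
      moreover have "g \<otimes> (x \<otimes> w) \<in> Lam y us (l + c)" using Cons pw by simp
      ultimately show ?case using Lam_add[OF y us(1)] by simp
    qed
    then show ?thesis using that by blast
  qed
  have "card W \<le> q ^ ((c + e) * length us)" if W: "xfree x W" for W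
  proof -
    have Wf: "finite W" "lin_sub K W" using W by (auto simp: xfree_def)
    note Wc = lin_subD(1)[OF Wf(2)]
    obtain h e' c' where h: "h \<in> PL y e'" "h \<noteq> \<zero>" "\<And>w. w \<in> W \<Longrightarrow> h \<otimes> w \<in> Lam y us c'"
      using Lam_denominator_finite[OF y us Wf(1) Wc] by blast
    have hc: "h \<in> carrier F" using h(1) y_carrier by blast
    have gpow: "g [^] n \<in> carrier F" for n :: nat using gc by simp
    have gn: "g [^] n \<in> PL y (Suc n * e + 1)" for n :: nat
    proof (induction n)
      case 0
      then show ?case using K_PL[OF y, of \<one>] PL_mono[OF y, of 1 "e + 1"] by auto
    next
      case (Suc n)
      then show ?case using PL_mult[OF y Suc g(1)] by (simp add: algebra_simps)
    qed
    \<comment> \<open>\<open>h\<close> clears the coefficients from \<open>W\<close> once; each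
      further factor \<open>x\<close> is paid for by one factor \<open>g\<close>.\<close>
    have main: "(h \<otimes> g [^] length ys) \<otimes> ev x ys \<in> Lam y us (c' + 1 + e + length ys * (c + e))"
      if "set ys \<subseteq> W" for ys
      using that
    proof (induction ys)
      case Nil
      then show ?case using zero_Lam[OF y us(1)] gpow hc by simp
    next
      case (Cons w ys)
      let ?n = "length ys" and ?l = "c' + 1 + e + length (w # ys) * (c + e)"
      have cc: "w \<in> carrier F" "ev x ys \<in> carrier F" "g [^] ?n \<in> carrier F" "g [^] Suc ?n \<in> carrier F"
        using Cons.prems Wc x gc by auto
      have gs: "g [^] Suc ?n = g [^] ?n \<otimes> g" by simp
      have "(h \<otimes> g [^] Suc ?n) \<otimes> (w \<oplus> x \<otimes> ev x ys)
          = g [^] Suc ?n \<otimes> (h \<otimes> w) \<oplus> g \<otimes> (x \<otimes> ((h \<otimes> g [^] ?n) \<otimes> ev x ys))"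
        unfolding gs using cc gc hc x by algebra
      moreover have "g [^] Suc ?n \<otimes> (h \<otimes> w) \<in> Lam y us ?l"
      proof -
        have "g [^] Suc ?n \<otimes> (h \<otimes> w) \<in> Lam y us (Suc (Suc ?n) * e + 1 + c')"
          by (rule Lam_mult[OF y us(1) gn h(3)]) (use Cons.prems in simp)
        then show ?thesis using Lam_mono[OF y, of "Suc (Suc ?n) * e + 1 + c'" ?l us] 
          by (auto simp: algebra_simps)
      qed
      moreover have "g \<otimes> (x \<otimes> ((h \<otimes> g [^] ?n) \<otimes> ev x ys)) \<in> Lam y us ?l"
      proof -
        have "g \<otimes> (x \<otimes> ((h \<otimes> g [^] ?n) \<otimes> ev x ys)) \<in> Lam y us (c' + 1 + e + ?n * (c + e) + c)"
          using step[OF Cons.IH] Cons.prems by simp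
        then show ?thesis using Lam_mono[OF y, of "c' + 1 + e + ?n * (c + e) + c" ?l us] 
          by (auto simp: algebra_simps)
      qed
      ultimately show ?case using Lam_add[OF y us(1)] by simp
    qed
    \<comment> \<open>Only the constant term of the exponent depends on \<open>W\<close> (through
      \<open>c'\<close>). The slope does not, so the bound obtained from it is uniform in
      \<open>W\<close>.\<close>
    have "card W ^ n \<le> q ^ ((c' + 1 + e) * length us + n * ((c + e) * length us))" for n
    proof -
      let ?Y = "{ys. set ys \<subseteq> W \<and> length ys = n}"
      let ?f = "\<lambda>ys. (h \<otimes> g [^] n) \<otimes> ev x ys"
      have hg: "h \<otimes> g [^] n \<in> carrier F" "h \<otimes> g [^] n \<noteq> \<zero>"
        using hc gc h(2) g(2) integral[of h "g [^] n"] nat_pow_nonzero[OF gc g(2)] by auto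
      have "inj_on ?f ?Y"
      proof (rule inj_onI)
        fix as bs assume A: "as \<in> ?Y" "bs \<in> ?Y" "?f as = ?f bs"
        then have "ev x as = ev x bs" using m_lcancel[OF hg(2,1), of "ev x as" "ev x bs"] Wc x by auto
        then show "as = bs" using inj_on_ev_xfree[OF x W, of n] A(1,2) by (auto dest: inj_onD)
      qed
      moreover have "?f ` ?Y \<subseteq> Lam y us (c' + 1 + e + n * (c + e))"
      proof (rule image_subsetI)
        fix ys assume "ys \<in> ?Y"
        then show "?f ys \<in> Lam y us (c' + 1 + e + n * (c + e))" using main[of ys] by simp
      qed
      ultimately have "card ?Y \<le> card (Lam y us (c' + 1 + e + n * (c + e)))"
        using finite_Lam[OF y] by (rule card_inj_on_le)
      also have "\<dots> \<le> q ^ ((c' + 1 + e + n * (c + e)) * length us)" by (rule card_Lam[OF y])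
      finally show ?thesis using card_lists_length_eq[OF Wf(1)] by (simp add: algebra_simps)
    qed
    then show ?thesis by (rule le_power_of_growth[rotated]) (use q_ge_2 in simp)
  qed
  then show ?thesis by blast
qed

text \<open>This is \<open>[F : K(x)]\<close> when \<open>x\<close> lies outside \<open>K\<close>.
  For \<open>x\<close> in \<open>K\<close> only the zero space is free, and the value is 0.\<close>

definition xrank :: "'a \<Rightarrow> nat" where
  "xrank x = Max {n. \<exists>W. xfree x W \<and> card W = q ^ n}"

lemma xfree_zero: "x \<in> carrier F \<Longrightarrow> xfree x {\<zero>}"
  by (auto simp: xfree_def lin_sub_def)

lemma
  assumes x: "x \<in> carrier F"
  shows xrank_attained: "\<exists>W. xfree x W \<and> card W = q ^ xrank x"
    and xfree_card_le: "xfree x W \<Longrightarrow> card W \<le> q ^ xrank x"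
proof -
  let ?S = "{n. \<exists>W. xfree x W \<and> card W = q ^ n}"
  obtain N where N: "\<And>W. xfree x W \<Longrightarrow> card W \<le> N" using xfree_bounded[OF x] by blast
  have "?S \<subseteq> {..N}"
  proof clarify
    fix n W assume "xfree x W" "card W = q ^ n"
    then have "q ^ n \<le> N" using N by metis
    moreover have "n < q ^ n" using q_ge_2 by (intro power_gt_expt) simp
    ultimately show "n \<le> N" by simp
  qed
  then have fin: "finite ?S" using finite_subset by blast
  have "0 \<in> ?S" using xfree_zero[OF x] by (auto intro!: exI[of _ "{\<zero>}"])
  then show "\<exists>W. xfree x W \<and> card W = q ^ xrank x"
    using Max_in[OF fin] unfolding xrank_def by blast
  show "card W \<le> q ^ xrank x" if W: "xfree x W"
  proof -
    have e: "card W = q ^ dim K W" using W K_subfield by (intro card_lin_sub) (auto simp: xfree_def)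
    then have "dim K W \<le> xrank x" unfolding xrank_def using W by (intro Max_ge[OF fin]) blast
    then show ?thesis using e q_ge_2 by (simp add: power_increasing)
  qed
qed

text \<open>Reversing a relation in \<open>1/x\<close> yields one in \<open>x\<close>. This symmetry
  is the reason that a function has as many zeros as poles.\<close>

lemma xfree_inv_aux:
  assumes x: "x \<in> carrier F" "x \<noteq> \<zero>" and W: "xfree x W"
  shows "xfree (inv x) W"
proof -
  have Wc: "W \<subseteq> carrier F" using W by (simp add: xfree_def lin_sub_def)
  have "set ys \<subseteq> {\<zero>}" if ys: "set ys \<subseteq> W" "ev (inv x) ys = \<zero>" for ys
  proof -
    have c: "set ys \<subseteq> carrier F" using ys Wc by auto
    have "x \<otimes> ev x (rev ys) = \<zero>" using ev_inv[OF x c] ys(2) x by simp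
    then have "ev x (rev ys) = \<zero>" using x c integral[of x "ev x (rev ys)"] by auto
    then have "set (rev ys) \<subseteq> {\<zero>}" using W ys(1) unfolding xfree_def by (metis set_rev)
    then show ?thesis by simp
  qed
  then show ?thesis using W by (auto simp: xfree_def)
qed

lemma xrank_inv: "x \<in> carrier F \<Longrightarrow> x \<noteq> \<zero> \<Longrightarrow> xrank (inv x) = xrank x"
  unfolding xrank_def using xfree_inv_aux[of x] xfree_inv_aux[of "inv x"] by (metis inv_closed inv_inv_nz inv_nz)

text \<open>A set of representatives of \<open>A/xA\<close> that is \<open>K\<close>-linear is free over \<open>K[x]\<close>, because a relation
  can be reduced modulo \<open>x\<close> and then divided by \<open>x\<close>.\<close>

lemma card_incongruent_le:
  assumes A: "subring A F" "K \<subseteq> A" and x: "x \<in> A" "x \<noteq> \<zero>"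
    and Y: "Y \<subseteq> A" "\<And>a b c. a \<in> Y \<Longrightarrow> b \<in> Y \<Longrightarrow> c \<in> A \<Longrightarrow> a \<ominus> b = x \<otimes> c \<Longrightarrow> a = b"
  shows "finite Y \<and> card Y \<le> q ^ xrank x"
proof -
  note AE = subringE[OF A(1)]
  have xc: "x \<in> carrier F" using x AE(1) by blast
  \<comment> \<open>The spaces that meet \<open>xA\<close> only in zero, so that they embed into
    \<open>A/xA\<close>. A largest one is a complement of \<open>xA\<close>.\<close>
  define good where "good W \<longleftrightarrow> finite W \<and> lin_sub K W \<and> W \<subseteq> A \<and> (\<forall>c\<in>A. x \<otimes> c \<in> W \<longrightarrow> c = \<zero>)" for W
  have free: "xfree x W" if W: "good W" for W
  proof -
    have "set ys \<subseteq> {\<zero>}" if "set ys \<subseteq> W" "ev x ys = \<zero>" for ys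
      using that
    proof (induction ys)
      case (Cons y ys)
      have Wl: "lin_sub K W" "W \<subseteq> A" using W by (auto simp: good_def)
      have "set vs \<subseteq> W \<Longrightarrow> ev x vs \<in> A" for vs
        using x AE Wl by (induction vs) auto
      then have e: "ev x ys \<in> A" using Cons.prems by simp
      then have c: "y \<in> carrier F" "ev x ys \<in> carrier F" using Cons.prems AE(1) Wl by auto
      have "x \<otimes> ev x ys = \<ominus> y" using Cons.prems(2) c xc minus_equality[of "x \<otimes> ev x ys" y] by (simp add: a_comm)
      then have "x \<otimes> ev x ys \<in> W" using lin_sub_neg[OF Wl(1) K_subfield] Cons.prems(1) by simp
      then have "ev x ys = \<zero>" using W e by (auto simp: good_def)
      then show ?case using Cons c xc by simp
    qed simp
    then show ?thesis using W by (auto simp: xfree_def good_def)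
  qed
  have g0: "good {\<zero>}" using AE xc x(2) integral[of x] by (auto simp: good_def lin_sub_def)
  let ?P = "\<lambda>n. \<exists>W. good W \<and> card W = n"
  have "?P 1" using g0 by (auto intro!: exI[of _ "{\<zero>}"])
  moreover have "\<forall>n. ?P n \<longrightarrow> n \<le> q ^ xrank x" using xfree_card_le[OF xc free] by blast
  ultimately obtain n where n: "?P n" "\<And>m. ?P m \<Longrightarrow> m \<le> n"
    using Nat.ex_has_greatest_nat[of ?P 1 "q ^ xrank x"] by blast
  then obtain W where W: "good W" "card W = n" by blast
  have Wl: "lin_sub K W" "W \<subseteq> A" "finite W" "\<And>c. c \<in> A \<Longrightarrow> x \<otimes> c \<in> W \<Longrightarrow> c = \<zero>"
    using W by (auto simp: good_def)
  have Wc: "W \<subseteq> carrier F" using lin_subD(1)[OF Wl(1)] .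
  \<comment> \<open>An element \<open>y\<close> outside \<open>W + xA\<close> could be adjoined to
    \<open>W\<close>: in \<open>x c = k y + w\<close> with \<open>k\<close> nonzero one could solve
    for \<open>y\<close>, contrary to its choice, and \<open>k = 0\<close> leads back to
    \<open>W\<close>.\<close>
  have cover: "\<exists>w\<in>W. \<exists>c\<in>A. y = w \<oplus> x \<otimes> c" if y: "y \<in> A" for y
  proof (rule ccontr)
    assume no: "\<not> ?thesis"
    have yc: "y \<in> carrier F" using y AE(1) by blast
    define W' where "W' = (\<lambda>(k, w). k \<otimes> y \<oplus> w) ` (K \<times> W)"
    have W'I: "k \<otimes> y \<oplus> w \<in> W'" if "k \<in> K" "w \<in> W" for k w unfolding W'_def using that by force
    have W'E: "\<exists>k w. k \<in> K \<and> w \<in> W \<and> v = k \<otimes> y \<oplus> w" if "v \<in> W'" for v using that unfolding W'_def by auto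
    have z: "\<zero> \<in> W" using lin_subD(2)[OF Wl(1)] .
    have "lin_sub K W'"
    proof (unfold lin_sub_def, intro conjI ballI)
      show "W' \<subseteq> carrier F" unfolding W'_def using yc Wc by auto
      show "\<zero> \<in> W'" using W'I[of \<zero> \<zero>] z yc by simp
    next
      fix u v assume "u \<in> W'" "v \<in> W'"
      then obtain k w k' w' where kw: "k \<in> K" "w \<in> W" "u = k \<otimes> y \<oplus> w" "k' \<in> K" "w' \<in> W" "v = k' \<otimes> y \<oplus> w'"
        using W'E by meson
      have c: "k \<in> carrier F" "k' \<in> carrier F" "w \<in> carrier F" "w' \<in> carrier F" using kw Wc by auto
      have "u \<oplus> v = (k \<oplus> k') \<otimes> y \<oplus> (w \<oplus> w')" unfolding kw(3,6) using c yc by algebra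
      then show "u \<oplus> v \<in> W'" using W'I[of "k \<oplus> k'" "w \<oplus> w'"] kw lin_subD(3)[OF Wl(1)] by simp
    next
      fix l v assume "l \<in> K" "v \<in> W'"
      then obtain k w where kw: "k \<in> K" "w \<in> W" "v = k \<otimes> y \<oplus> w" using W'E by meson
      have c: "k \<in> carrier F" "l \<in> carrier F" "w \<in> carrier F" using kw Wc \<open>l \<in> K\<close> by auto
      have "l \<otimes> v = (l \<otimes> k) \<otimes> y \<oplus> l \<otimes> w" unfolding kw(3) using c yc by algebra
      then show "l \<otimes> v \<in> W'" using W'I[of "l \<otimes> k" "l \<otimes> w"] kw lin_subD(4)[OF Wl(1)] \<open>l \<in> K\<close> by simp
    qed
    moreover have "finite W'" unfolding W'_def using Wl(3) by simp
    moreover have "W' \<subseteq> A"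
    proof
      fix v assume "v \<in> W'"
      then obtain k w where "k \<in> K" "w \<in> W" "v = k \<otimes> y \<oplus> w" using W'E by meson
      moreover from this have "k \<in> A" "w \<in> A" using A(2) Wl(2) by blast+
      ultimately show "v \<in> A" using AE(7)[OF AE(6)[OF _ y]] by simp
    qed
    moreover have "c = \<zero>" if c: "c \<in> A" "x \<otimes> c \<in> W'" for c
    proof -
      obtain k w where kw: "k \<in> K" "w \<in> W" "x \<otimes> c = k \<otimes> y \<oplus> w" using W'E[OF c(2)] by meson
      have cc: "k \<in> carrier F" "w \<in> carrier F" "c \<in> carrier F" using kw(1,2) Wc c(1) AE(1) K_sub by blast+
      show ?thesis
      proof (cases "k = \<zero>")
        case True
        then show ?thesis using kw(2,3) Wl(4)[OF c(1)] cc yc by simp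
      next
        case False
        then have ik: "inv k \<in> K" "inv k \<in> carrier F" using kw(1) by simp_all
        have "y = (inv k \<otimes> k) \<otimes> y" using False cc yc by simp
        also have "\<dots> = inv k \<otimes> ((k \<otimes> y \<oplus> w) \<ominus> w)" using ik(2) cc yc by algebra
        also have "\<dots> = inv k \<otimes> (x \<otimes> c \<ominus> w)" using kw(3) by simp
        also have "\<dots> = (\<ominus> (inv k \<otimes> w)) \<oplus> x \<otimes> (inv k \<otimes> c)" using ik(2) cc xc by algebra
        finally have "y = (\<ominus> (inv k \<otimes> w)) \<oplus> x \<otimes> (inv k \<otimes> c)" .
        moreover have "\<ominus> (inv k \<otimes> w) \<in> W" using lin_sub_neg[OF Wl(1) K_subfield] lin_subD(4)[OF Wl(1) ik(1) kw(2)] by blast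
        moreover have "inv k \<otimes> c \<in> A" using ik(1) A(2) c(1) AE(6) by blast
        ultimately show ?thesis using no by blast
      qed
    qed
    ultimately have "good W'" by (auto simp: good_def)
    then have "card W' \<le> card W" using n(2) W(2) by blast
    moreover have "W \<subseteq> W'"
    proof
      fix w assume "w \<in> W"
      then show "w \<in> W'" using W'I[of \<zero> w] Wc yc by auto
    qed
    ultimately have "W' = W" using \<open>finite W'\<close> by (metis card_seteq)
    moreover have "y \<in> W'" using W'I[of \<one> \<zero>] z yc by simp
    ultimately have "y \<in> W" by simp
    then show False using no AE(2) yc xc by (metis r_null r_zero)
  qed
  define f where "f y = (SOME w. w \<in> W \<and> (\<exists>c\<in>A. y = w \<oplus> x \<otimes> c))" for y
  have f: "f y \<in> W \<and> (\<exists>c\<in>A. y = f y \<oplus> x \<otimes> c)" if "y \<in> A" for y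
    unfolding f_def by (rule someI_ex) (use cover[OF that] in blast)
  have inj: "inj_on f Y"
  proof (rule inj_onI)
    fix a b assume ab: "a \<in> Y" "b \<in> Y" "f a = f b"
    then obtain c d where cd: "c \<in> A" "d \<in> A" "a = f a \<oplus> x \<otimes> c" "b = f a \<oplus> x \<otimes> d"
      using f Y(1) by (metis subsetD)
    have cc: "c \<in> carrier F" "d \<in> carrier F" "f a \<in> carrier F" using cd(1,2) AE(1) f[of a] ab(1) Y(1) Wc by blast+
    have "a \<ominus> b = x \<otimes> (c \<ominus> d)" by (subst cd(3), subst cd(4)) (use cc xc in algebra)
    moreover have "c \<ominus> d \<in> A" using cd(1,2) AE(5,7) by (simp add: a_minus_def)
    ultimately show "a = b" using Y(2) ab by blast
  qed
  have im: "f ` Y \<subseteq> W" using f Y(1) by blast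
  have "card Y \<le> card W" using card_inj_on_le[OF inj im Wl(3)] .
  also have "\<dots> \<le> q ^ xrank x" using xfree_card_le[OF xc free[OF W(1)]] .
  finally show ?thesis using inj_on_finite[OF inj im Wl(3)] by blast
qed

end

lemma (in cring) ideal_subringI:
  assumes V: "subring V R" and M: "M \<subseteq> V" "\<zero> \<in> M"
    and add: "\<And>a b. a \<in> M \<Longrightarrow> b \<in> M \<Longrightarrow> a \<oplus> b \<in> M"
    and mult: "\<And>v m. v \<in> V \<Longrightarrow> m \<in> M \<Longrightarrow> v \<otimes> m \<in> M"
  shows "ideal M (R\<lparr>carrier := V\<rparr>)"
proof (rule idealI[OF subring_is_ring[OF V]])
  interpret VR: ring "R\<lparr>carrier := V\<rparr>" using subring_is_ring[OF V] .
  note VE = subringE[OF V]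
  have Vc: "v \<in> V \<Longrightarrow> v \<in> carrier R" for v using VE(1) by blast
  show "subgroup M (add_monoid (R\<lparr>carrier := V\<rparr>))"
  proof (rule VR.add.subgroupI)
    fix a assume a: "a \<in> M"
    have "(\<ominus> \<one>) \<otimes> a \<in> M" using mult[OF VE(5)[OF VE(3)] a] .
    moreover have "\<ominus>\<^bsub>R\<lparr>carrier := V\<rparr>\<^esub> a = (\<ominus> \<one>) \<otimes> a"
      by (rule VR.minus_equality) (use a M VE Vc in \<open>auto simp: l_minus l_neg\<close>)
    ultimately show "\<ominus>\<^bsub>R\<lparr>carrier := V\<rparr>\<^esub> a \<in> M" by simp
  qed (use M add in auto)
  show "a \<otimes>\<^bsub>R\<lparr>carrier := V\<rparr>\<^esub> v \<in> M" if "a \<in> M" "v \<in> carrier (R\<lparr>carrier := V\<rparr>)" for a v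
    using mult[of v a] that m_comm[of a v] Vc M by auto
qed (use mult in auto)

lemma (in cring) subring_is_cring: "subring V R \<Longrightarrow> cring (R\<lparr>carrier := V\<rparr>)"
  using subcring_iff[of V] subcringI' subringE(1) by blast

context global_function_field
begin

section \<open>Valuation rings\<close>

lemma mult_nz: "z \<in> carrier F \<Longrightarrow> z \<noteq> \<zero> \<Longrightarrow> w \<in> carrier F \<Longrightarrow> w \<noteq> \<zero> \<Longrightarrow> z \<otimes> w \<noteq> \<zero>"
  using integral by blast

definition nonunits :: "'a set \<Rightarrow> 'a set" where
  "nonunits V = {z \<in> V. z = \<zero> \<or> inv z \<notin> V}"

context
  fixes V assumes V: "is_valuation_ring F K V"
begin

lemma valuation_ring_props:
  shows "subring V F" "K \<subseteq> V" "V \<subseteq> carrier F" "V \<noteq> carrier F"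
    "\<And>z. z \<in> carrier F \<Longrightarrow> z \<noteq> \<zero> \<Longrightarrow> z \<in> V \<or> inv z \<in> V"
  using V unfolding is_valuation_ring_def by auto

lemma valuation_ring_closed:
  "v \<in> V \<Longrightarrow> v \<in> carrier F" "\<zero> \<in> V" "\<one> \<in> V" "v \<in> V \<Longrightarrow> \<ominus> v \<in> V"
  "v \<in> V \<Longrightarrow> w \<in> V \<Longrightarrow> v \<oplus> w \<in> V" "v \<in> V \<Longrightarrow> w \<in> V \<Longrightarrow> v \<otimes> w \<in> V"
  using subringE[OF valuation_ring_props(1)] by auto

lemma nonunits_mult: "v \<in> V \<Longrightarrow> z \<in> nonunits V \<Longrightarrow> v \<otimes> z \<in> nonunits V"
proof -
  assume v: "v \<in> V" and z: "z \<in> nonunits V"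
  then have zV: "z \<in> V" "z \<in> carrier F" "v \<in> carrier F" using valuation_ring_closed(1) by (auto simp: nonunits_def)
  have "inv (v \<otimes> z) \<notin> V" if nz: "v \<otimes> z \<noteq> \<zero>"
  proof
    assume i: "inv (v \<otimes> z) \<in> V"
    have n: "v \<noteq> \<zero>" "z \<noteq> \<zero>" using nz zV by auto
    have iv: "inv v \<in> carrier F" "inv z \<in> carrier F" using n zV by auto
    have "v \<otimes> inv (v \<otimes> z) = v \<otimes> (inv v \<otimes> inv z)" using n zV inv_mult_nz by simp
    also have "\<dots> = (v \<otimes> inv v) \<otimes> inv z" using iv zV by (simp add: m_assoc)
    also have "\<dots> = inv z" using n zV iv by simp
    finally have "inv z \<in> V" using valuation_ring_closed(6)[OF v i] by simp
    then show False using z n by (simp add: nonunits_def)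
  qed
  then show ?thesis using valuation_ring_closed(6)[OF v zV(1)] by (auto simp: nonunits_def)
qed

text \<open>One of \<open>z/w\<close> and \<open>w/z\<close> lies in \<open>V\<close>, so the sum is
  a multiple of one of the two nonunits by an element of \<open>V\<close>.\<close>

lemma nonunits_add: "z \<in> nonunits V \<Longrightarrow> w \<in> nonunits V \<Longrightarrow> z \<oplus> w \<in> nonunits V"
proof -
  have aux: "z \<oplus> w \<in> nonunits V" if zw: "z \<in> nonunits V" "w \<in> nonunits V" "w \<noteq> \<zero>" "z \<otimes> inv w \<in> V" for z w
  proof -
    have c: "z \<in> carrier F" "w \<in> carrier F" using zw valuation_ring_closed(1) by (auto simp: nonunits_def)
    have ic: "inv w \<in> carrier F" using c zw by auto
    have "(\<one> \<oplus> z \<otimes> inv w) \<otimes> w = w \<oplus> z \<otimes> (inv w \<otimes> w)" using c ic by algebra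
    also have "\<dots> = z \<oplus> w" using c zw by (simp add: a_comm)
    finally show ?thesis
      using nonunits_mult[of "\<one> \<oplus> z \<otimes> inv w" w] valuation_ring_closed(3,5) zw by metis
  qed
  assume zw: "z \<in> nonunits V" "w \<in> nonunits V"
  have c: "z \<in> carrier F" "w \<in> carrier F" using zw valuation_ring_closed(1) by (auto simp: nonunits_def)
  show ?thesis
  proof (cases "z = \<zero> \<or> w = \<zero>")
    case True
    then show ?thesis using zw c by auto
  next
    case False
    then have n: "z \<otimes> inv w \<noteq> \<zero>" using c integral[of z "inv w"] by auto
    have "inv (z \<otimes> inv w) = w \<otimes> inv z" using False c inv_mult_nz[of z "inv w"] by (simp add: m_comm)
    then have "z \<otimes> inv w \<in> V \<or> w \<otimes> inv z \<in> V"
      using valuation_ring_props(5)[OF _ n] False c by auto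
    then show ?thesis using aux[OF zw] aux[OF zw(2,1)] False c a_comm by metis
  qed
qed

lemma nonunits_ideal: "ideal (nonunits V) (F\<lparr>carrier := V\<rparr>)"
  by (rule ideal_subringI[OF valuation_ring_props(1)])
    (use valuation_ring_closed(2) nonunits_add nonunits_mult in \<open>auto simp: nonunits_def\<close>)

lemma one_notin_nonunits: "\<one> \<notin> nonunits V"
  using valuation_ring_closed(3) by (auto simp: nonunits_def)

lemma ideal_subset_nonunits:
  assumes J: "ideal J (F\<lparr>carrier := V\<rparr>)" "J \<noteq> V"
  shows "J \<subseteq> nonunits V"
proof
  interpret J: ideal J "F\<lparr>carrier := V\<rparr>" by fact
  fix z assume z: "z \<in> J"
  then have zV: "z \<in> V" using J.Icarr by simp
  show "z \<in> nonunits V"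
  proof (rule ccontr)
    assume "z \<notin> nonunits V"
    then have "z \<noteq> \<zero>" "inv z \<in> V" using zV by (auto simp: nonunits_def)
    then have "\<one> \<in> J" using J.I_l_closed[OF z, of "inv z"] zV valuation_ring_closed(1) by simp
    then have "J = V" using J.one_imp_carrier by simp
    then show False using J(2) by simp
  qed
qed

lemma maximalideal_nonunits: "maximalideal P (F\<lparr>carrier := V\<rparr>) \<longleftrightarrow> P = nonunits V"
proof
  assume "maximalideal P (F\<lparr>carrier := V\<rparr>)"
  then interpret P: maximalideal P "F\<lparr>carrier := V\<rparr>" .
  have "P \<subseteq> nonunits V" using ideal_subset_nonunits[OF P.is_ideal] P.I_notcarr by auto
  then have "nonunits V = P \<or> nonunits V = V"
    using P.I_maximal[OF nonunits_ideal] by (auto simp: nonunits_def)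
  then show "P = nonunits V" using one_notin_nonunits valuation_ring_closed(3) by auto
next
  assume P: "P = nonunits V"
  show "maximalideal P (F\<lparr>carrier := V\<rparr>)"
  proof (rule maximalidealI)
    show "ideal P (F\<lparr>carrier := V\<rparr>)" using nonunits_ideal P by simp
    show "carrier (F\<lparr>carrier := V\<rparr>) \<noteq> P" using one_notin_nonunits valuation_ring_closed(3) P by auto
    show "J = P \<or> J = carrier (F\<lparr>carrier := V\<rparr>)"
      if "ideal J (F\<lparr>carrier := V\<rparr>)" "P \<subseteq> J" "J \<subseteq> carrier (F\<lparr>carrier := V\<rparr>)" for J
      using ideal_subset_nonunits[OF that(1)] that(2) P by auto
  qed
qed

end

text \<open>An element of \<open>V\<close> outside \<open>W\<close> would have an inverse that is a
  nonunit of \<open>W\<close>, hence of \<open>V\<close>, which is absurd. Together with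
  \<open>maximalideal_nonunits\<close> this makes the \<open>THE\<close> in
  \<open>place_ring\<close> well defined.\<close>

lemma nonunits_inj:
  assumes V: "is_valuation_ring F K V" "is_valuation_ring F K W" and eq: "nonunits V = nonunits W"
  shows "V \<subseteq> W"
proof
  fix z assume z: "z \<in> V"
  have zc: "z \<in> carrier F" using valuation_ring_closed(1)[OF V(1) z] .
  show "z \<in> W"
  proof (rule ccontr)
    assume nW: "z \<notin> W"
    then have nz: "z \<noteq> \<zero>" using valuation_ring_closed(2)[OF V(2)] by auto
    then have "inv z \<in> W" using valuation_ring_props(5)[OF V(2) zc] nW by blast
    then have "inv z \<in> nonunits W" using nW nz zc by (simp add: nonunits_def)
    then have "inv z \<in> nonunits V" using eq by simp
    then show False using z nz zc by (simp add: nonunits_def)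
  qed
qed

abbreviation "VR \<equiv> place_ring F K"
abbreviation "ord \<equiv> place_val F K"
abbreviation "Places \<equiv> places F K"

lemma place_ring_props:
  assumes "P \<in> Places"
  shows "is_valuation_ring F K (VR P)" "P = nonunits (VR P)"
proof -
  obtain V where V: "is_valuation_ring F K V" "maximalideal P (F\<lparr>carrier := V\<rparr>)"
    using assms unfolding places_def by blast
  have u: "W = V" if "is_valuation_ring F K W \<and> maximalideal P (F\<lparr>carrier := W\<rparr>)" for W
    using that V nonunits_inj maximalideal_nonunits by (metis subset_antisym)
  have "VR P = V" unfolding place_ring_def by (rule the_equality) (use V u in blast)+
  then show "is_valuation_ring F K (VR P)" "P = nonunits (VR P)"
    using V maximalideal_nonunits by auto
qed

lemma nonunits_place:
  assumes "is_valuation_ring F K V"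
  shows "nonunits V \<in> Places" "VR (nonunits V) = V"
proof -
  show *: "nonunits V \<in> Places"
    unfolding places_def using assms maximalideal_nonunits[OF assms] by blast
  show "VR (nonunits V) = V"
    using place_ring_props[OF *] assms nonunits_inj by (metis subset_antisym)
qed

lemma field_int_pow_mult:
  "t \<in> carrier F \<Longrightarrow> t \<noteq> \<zero> \<Longrightarrow> t [^] (a + b :: int) = t [^] a \<otimes> t [^] b"
  and field_int_pow_closed: "t \<in> carrier F \<Longrightarrow> t \<noteq> \<zero> \<Longrightarrow> t [^] (a :: int) \<in> carrier F - {\<zero>}"
  and field_int_pow_distrib: "t \<in> carrier F \<Longrightarrow> t \<noteq> \<zero> \<Longrightarrow> w \<in> carrier F \<Longrightarrow> w \<noteq> \<zero> \<Longrightarrow>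
    (t \<otimes> w) [^] (a :: int) = t [^] a \<otimes> w [^] a"
proof -
  interpret M: comm_group "units_of F" by (rule units_comm_group)
  have n: "z [^]\<^bsub>units_of F\<^esub> (m :: nat) = z [^] m" for z m
    by (simp add: nat_pow_def units_of_def)
  have e: "z [^]\<^bsub>units_of F\<^esub> (a :: int) = z [^] a" if "z \<in> carrier F" "z \<noteq> \<zero>" for z a
    using that nat_pow_nonzero[of z] by (auto simp: int_pow_def2 n units_of_inv field_Units simp del: pow_nat)
  have cu: "carrier (units_of F) = carrier F - {\<zero>}" "monoid.mult (units_of F) = monoid.mult F"
    by (simp_all add: units_of_def field_Units)
  show "t \<in> carrier F \<Longrightarrow> t \<noteq> \<zero> \<Longrightarrow> t [^] (a + b :: int) = t [^] a \<otimes> t [^] b"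
    using M.int_pow_mult[of t a b] e cu by simp
  show "t \<in> carrier F \<Longrightarrow> t \<noteq> \<zero> \<Longrightarrow> t [^] (a :: int) \<in> carrier F - {\<zero>}"
    using M.int_pow_closed[of t a] e cu by simp
  show "t \<in> carrier F \<Longrightarrow> t \<noteq> \<zero> \<Longrightarrow> w \<in> carrier F \<Longrightarrow> w \<noteq> \<zero> \<Longrightarrow>
    (t \<otimes> w) [^] (a :: int) = t [^] a \<otimes> w [^] a"
    using M.int_pow_distrib[of t w a] e[of t a] e[of w a] e[of "t \<otimes> w" a] cu mult_nz[of t w] by simp
qed

section \<open>Discreteness of places\<close>

context
  fixes P assumes P: "P \<in> Places"
begin

lemmas VR_props = valuation_ring_props[OF place_ring_props(1)[OF P]]
  and VR_closed = valuation_ring_closed[OF place_ring_props(1)[OF P]]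

lemma place_iff: "z \<in> P \<longleftrightarrow> z \<in> VR P \<and> (z = \<zero> \<or> inv z \<notin> VR P)"
  using place_ring_props(2)[OF P] unfolding nonunits_def by blast

lemma place_mult: "v \<in> VR P \<Longrightarrow> z \<in> P \<Longrightarrow> v \<otimes> z \<in> P"
  using nonunits_mult[OF place_ring_props(1)[OF P]] place_ring_props(2)[OF P] by simp

lemma one_notin_place: "\<one> \<notin> P"
  using one_notin_nonunits[OF place_ring_props(1)[OF P]] place_ring_props(2)[OF P] by simp

lemma place_subset: "P \<subseteq> VR P" "P \<subseteq> carrier F"
  using place_iff VR_closed(1) by blast+

lemma exists_nonzero_in_place: "\<exists>x\<in>P. x \<noteq> \<zero>"
proof -
  obtain z where z: "z \<in> carrier F" "z \<notin> VR P" using VR_props(3,4) by blast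
  then have nz: "z \<noteq> \<zero>" using VR_closed(2) by auto
  then have "inv z \<in> VR P" using VR_props(5)[OF z(1) nz] z by blast
  then have "inv z \<in> P" using z nz by (simp add: place_iff)
  then show ?thesis using z nz inv_nz by blast
qed

definition incongruent :: "'a \<Rightarrow> 'a set \<Rightarrow> bool" where
  "incongruent x Y \<longleftrightarrow> Y \<subseteq> VR P \<and> (\<forall>a\<in>Y. \<forall>b\<in>Y. \<forall>c\<in>VR P. a \<ominus> b = x \<otimes> c \<longrightarrow> a = b)"

text \<open>The order of \<open>V/xV\<close> for \<open>V = VR P\<close>, finite by
  \<open>card_incongruent_le\<close>. It plays the part of a valuation before discreteness is
  available.\<close>

definition idx :: "'a \<Rightarrow> nat" where
  "idx x = Max (card ` {Y. incongruent x Y})"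

lemma
  assumes x: "x \<in> VR P" "x \<noteq> \<zero>"
  shows idx_attained: "\<exists>Y. incongruent x Y \<and> finite Y \<and> card Y = idx x"
    and idx_max: "incongruent x Y \<Longrightarrow> card Y \<le> idx x"
proof -
  have b: "finite Y \<and> card Y \<le> q ^ xrank x" if "incongruent x Y" for Y
    by (rule card_incongruent_le[OF VR_props(1,2) x]) (use that in \<open>unfold incongruent_def, blast+\<close>)
  have fin: "finite (card ` {Y. incongruent x Y})"
    using finite_subset[of "card ` {Y. incongruent x Y}" "{..q ^ xrank x}"] b by blast
  have "incongruent x {}" by (simp add: incongruent_def)
  then have "idx x \<in> card ` {Y. incongruent x Y}" unfolding idx_def by (intro Max_in[OF fin]) blast
  then show "\<exists>Y. incongruent x Y \<and> finite Y \<and> card Y = idx x" using b by force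
  show "incongruent x Y \<Longrightarrow> card Y \<le> idx x" unfolding idx_def by (intro Max_ge[OF fin]) blast
qed

text \<open>A system incongruent modulo \<open>w\<close> remains so modulo \<open>w v\<close>, and
  it can be enlarged: \<open>y + w\<close> is congruent to \<open>y\<close> modulo \<open>w\<close>,
  but not modulo \<open>w v\<close>, since \<open>v\<close> is not a unit.\<close>

lemma idx_less:
  assumes w: "w \<in> VR P" "w \<noteq> \<zero>" and v: "v \<in> P" "v \<noteq> \<zero>"
  shows "idx w < idx (w \<otimes> v)"
proof -
  have c: "w \<in> carrier F" "v \<in> carrier F" "v \<in> VR P" using w v place_subset VR_closed(1) by auto
  obtain Y where Y: "incongruent w Y" "finite Y" "card Y = idx w" using idx_attained[OF w] by blast
  have "idx w \<ge> 1" using idx_max[OF w, of "{\<one>}"] VR_closed(3) by (simp add: incongruent_def)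
  then obtain y where y: "y \<in> Y" using Y by (metis card.empty ex_in_conv not_one_le_zero)
  have Yc: "Y \<subseteq> carrier F" "Y \<subseteq> VR P" using Y(1) VR_closed(1) by (auto simp: incongruent_def)
  have yc: "y \<in> carrier F" "y \<in> VR P" using y Yc by auto
  let ?y = "y \<oplus> w"
  have inc: "a = b" if "a \<in> Y" "b \<in> Y" "d \<in> VR P" "a \<ominus> b = w \<otimes> d" for a b d
    using that Y(1) unfolding incongruent_def by blast
  have new: False if a: "a \<in> Y" "d \<in> VR P" and e: "a \<ominus> ?y = (w \<otimes> v) \<otimes> d" for a d
  proof -
    have cc: "a \<in> carrier F" "d \<in> carrier F" using a Yc VR_closed(1) by auto
    have "a \<ominus> y = (a \<ominus> ?y) \<oplus> w" using cc yc c by algebra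
    also have "\<dots> = w \<otimes> (v \<otimes> d \<oplus> \<one>)" unfolding e using cc c by algebra
    finally have e2: "a \<ominus> y = w \<otimes> (v \<otimes> d \<oplus> \<one>)" .
    have "v \<otimes> d \<oplus> \<one> \<in> VR P" using a c VR_closed by simp
    then have "a = y" using inc[OF a(1) y _ e2] by simp
    then have "w \<otimes> (v \<otimes> d \<oplus> \<one>) = \<zero>" using e2 yc by (simp add: a_minus_def r_neg)
    then have "v \<otimes> d \<oplus> \<one> = \<zero>" using w(2) c cc integral by blast
    then have "\<one> = (\<ominus> d) \<otimes> v" using c cc by (metis a_comm l_minus m_closed m_comm minus_equality one_closed)
    then show False using place_mult[OF VR_closed(4)[OF a(2)] v(1)] one_notin_place by simp
  qed
  have "?y \<notin> Y"
  proof
    assume "?y \<in> Y"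
    moreover have "?y \<ominus> ?y = (w \<otimes> v) \<otimes> \<zero>" using yc c by (simp add: a_minus_def r_neg)
    ultimately show False using new VR_closed(2) by blast
  qed
  have "incongruent (w \<otimes> v) (insert ?y Y)"
    unfolding incongruent_def
  proof (intro conjI ballI impI)
    show "insert ?y Y \<subseteq> VR P" using Yc yc w VR_closed by auto
  next
    fix a b d assume A: "a \<in> insert ?y Y" "b \<in> insert ?y Y" "d \<in> VR P" "a \<ominus> b = (w \<otimes> v) \<otimes> d"
    have cc: "a \<in> carrier F" "b \<in> carrier F" "d \<in> carrier F" using A Yc yc c VR_closed(1) by auto
    show "a = b"
    proof (cases "a = ?y")
      case True
      have "b \<ominus> a = \<ominus> (a \<ominus> b)" using cc by algebra
      also have "\<dots> = (w \<otimes> v) \<otimes> (\<ominus> d)" unfolding A(4) using cc c by algebra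
      finally show ?thesis using new[of b "\<ominus> d"] A True VR_closed(4) by blast
    next
      case False
      show ?thesis
      proof (cases "b = ?y")
        case True
        then show ?thesis using new A False by blast
      next
        case b: False
        have "a \<ominus> b = w \<otimes> (v \<otimes> d)" unfolding A(4) using c cc by algebra
        moreover have "v \<otimes> d \<in> VR P" using c A VR_closed by simp
        ultimately show ?thesis using inc A False b by blast
      qed
    qed
  qed
  moreover have "w \<otimes> v \<in> VR P" "w \<otimes> v \<noteq> \<zero>" using VR_closed(6) w c v integral by blast+
  ultimately have "card (insert ?y Y) \<le> idx (w \<otimes> v)" using idx_max by blast
  then show ?thesis using Y \<open>?y \<notin> Y\<close> by simp
qed

section \<open>Uniformizers and the normalised valuation\<close>

definition uniformizer :: "'a \<Rightarrow> bool" where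
  "uniformizer t \<longleftrightarrow> t \<in> P \<and> t \<noteq> \<zero> \<and> (\<forall>z\<in>P. \<exists>v\<in>VR P. z = t \<otimes> v)"

definition punit :: "'a \<Rightarrow> bool" where
  "punit u \<longleftrightarrow> u \<in> VR P \<and> u \<noteq> \<zero> \<and> inv u \<in> VR P"

text \<open>Take \<open>t\<close> of least index in \<open>P\<close>. If \<open>z/t\<close> were not
  in the valuation ring for some \<open>z\<close> in \<open>P\<close>, then \<open>t\<close> would
  be \<open>z\<close> times a nonunit, and \<open>z\<close> would have smaller index.\<close>

lemma exists_uniformizer: "\<exists>t. uniformizer t"
proof -
  let ?S = "{x \<in> P. x \<noteq> \<zero>}"
  obtain t where t: "t \<in> ?S" "\<And>y. y \<in> ?S \<Longrightarrow> idx t \<le> idx y"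
    using exists_nonzero_in_place ex_has_least_nat[of "\<lambda>x. x \<in> ?S" _ idx] by auto
  have tc: "t \<in> carrier F" "t \<noteq> \<zero>" using t place_subset by auto
  have "\<exists>v\<in>VR P. z = t \<otimes> v" if z: "z \<in> P" for z
  proof (cases "z = \<zero>")
    case True
    then show ?thesis using VR_closed(2) tc by (intro bexI[of _ \<zero>]) auto
  next
    case False
    have zc: "z \<in> carrier F" "z \<in> VR P" using z place_subset by auto
    have e: "z = t \<otimes> (inv t \<otimes> z)"
    proof -
      have "z = (t \<otimes> inv t) \<otimes> z" using zc tc by simp
      then show ?thesis using tc zc by (simp add: m_assoc[symmetric])
    qed
    have "inv t \<otimes> z \<in> VR P"
    proof (rule ccontr)
      assume n: "inv t \<otimes> z \<notin> VR P"
      have nz: "inv t \<otimes> z \<in> carrier F" "inv t \<otimes> z \<noteq> \<zero>" using tc zc False mult_nz[of "inv t" z] by auto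
      let ?v = "inv (inv t \<otimes> z)"
      have "?v \<in> VR P" using VR_props(5)[OF nz] n by blast
      then have vP: "?v \<in> P" "?v \<noteq> \<zero>" using n nz by (auto simp: place_iff)
      have "?v = t \<otimes> inv z" using inv_mult_nz[of "inv t" z] tc zc False by simp
      then have "z \<otimes> ?v = (z \<otimes> inv z) \<otimes> t" using tc zc False m_lcomm[of z t "inv z"] by (simp add: m_comm)
      then have "z \<otimes> ?v = t" using tc zc False by simp
      then have "idx z < idx t" using idx_less[OF zc(2) False vP] by simp
      then show False using t(2)[of z] z False by simp
    qed
    then show ?thesis using e by blast
  qed
  then show ?thesis using t unfolding uniformizer_def by blast
qed

text \<open>Dividing by \<open>t\<close> lowers the index, so the division stops at a unit.\<close>

lemma factorization:
  assumes t: "uniformizer t"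
  shows "z \<in> VR P \<Longrightarrow> z \<noteq> \<zero> \<Longrightarrow> \<exists>n::nat. \<exists>u. punit u \<and> z = t [^] n \<otimes> u"
proof (induction "idx z" arbitrary: z rule: less_induct)
  case less
  have tc: "t \<in> carrier F" "t \<in> P" "t \<noteq> \<zero>" using t place_subset by (auto simp: uniformizer_def)
  show ?case
  proof (cases "z \<in> P")
    case False
    then have "punit z" using less.prems by (simp add: place_iff punit_def)
    then show ?thesis using less.prems VR_closed(1) by (intro exI[of _ 0] exI[of _ z]) auto
  next
    case True
    then obtain v where v: "v \<in> VR P" "z = t \<otimes> v" using t by (auto simp: uniformizer_def)
    have vc: "v \<in> carrier F" "v \<noteq> \<zero>" using v less.prems tc VR_closed(1) by auto
    have "idx v < idx z" using idx_less[OF v(1) vc(2) tc(2,3)] v(2) vc tc m_comm by simp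
    then obtain n u where nu: "punit u" "v = t [^] (n::nat) \<otimes> u" using less.hyps v vc by blast
    have uc: "u \<in> carrier F" using nu VR_closed(1) by (simp add: punit_def)
    have "z = t [^] Suc n \<otimes> u" unfolding v(2) nu(2) using tc uc by (simp add: m_ac)
    then show ?thesis using nu by blast
  qed
qed

lemma punit_carrier: "punit u \<Longrightarrow> u \<in> carrier F" "punit u \<Longrightarrow> u \<noteq> \<zero>"
  using VR_closed(1) by (auto simp: punit_def)

lemma punit_mult: "punit u \<Longrightarrow> punit v \<Longrightarrow> punit (u \<otimes> v)"
  using VR_closed(1,6) integral[of u v] inv_mult_nz[of u v] by (auto simp: punit_def)

lemma punit_inv: "punit u \<Longrightarrow> punit (inv u)"
  using VR_closed by (auto simp: punit_def)

lemma punit_pow: "punit u \<Longrightarrow> punit (u [^] (n::int))"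
proof -
  assume u: "punit u"
  have n: "punit (u [^] (n::nat))" if "punit u" for n u
    using that punit_mult VR_closed(1,3) by (induction n) (auto simp: punit_def)
  show ?thesis using n[OF u] punit_inv by (simp add: int_pow_def2 del: pow_nat)
qed

lemma uniformizer_carrier: "uniformizer t \<Longrightarrow> t \<in> carrier F" "uniformizer t \<Longrightarrow> t \<noteq> \<zero>"
  using place_subset by (auto simp: uniformizer_def)

lemma uniformizer_pow_in_VR:
  assumes t: "uniformizer t"
  shows "t [^] (n::int) \<in> VR P \<longleftrightarrow> 0 \<le> n"
proof -
  note tc = uniformizer_carrier[OF t]
  have tV: "t \<in> P" "t \<in> VR P" using t place_subset by (auto simp: uniformizer_def)
  have nat: "t [^] (n::nat) \<in> VR P" for n using tV VR_closed(3,6) by (induction n) auto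
  have natP: "t [^] Suc n \<in> P" for n
    using place_mult[OF nat tV(1), of n] by simp
  show ?thesis
  proof
    assume "0 \<le> n"
    then show "t [^] n \<in> VR P" using nat by (simp add: int_pow_def2 del: pow_nat)
  next
    assume A: "t [^] n \<in> VR P"
    show "0 \<le> n"
    proof (rule ccontr)
      assume "\<not> 0 \<le> n"
      then obtain m where m: "nat (- n) = Suc m" using gr0_implies_Suc by fastforce
      then have e: "t [^] n = inv (t [^] Suc m)" using \<open>\<not> 0 \<le> n\<close> by (simp add: int_pow_def2 del: nat_pow_Suc pow_nat)
      have "t [^] Suc m \<noteq> \<zero>" using nat_pow_nonzero tc by blast
      then show False using natP[of m] A e by (simp add: place_iff del: nat_pow_Suc)
    qed
  qed
qed

lemma punit_uniformizer_pow:
  assumes t: "uniformizer t" and u: "punit (t [^] (n::int))"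
  shows "n = 0"
proof -
  note tc = uniformizer_carrier[OF t]
  have "t [^] (-n) = inv (t [^] n)"
    using field_int_pow_mult[OF tc, of n "-n"] field_int_pow_closed[OF tc, of n] field_int_pow_closed[OF tc, of "-n"]
    by (intro inv_unique'[symmetric, of "t [^] n" "t [^] (-n)", symmetric]) (auto simp: m_comm)
  then have "t [^] (-n) \<in> VR P" "t [^] n \<in> VR P" using u by (auto simp: punit_def)
  then show ?thesis using uniformizer_pow_in_VR[OF t, of n] uniformizer_pow_in_VR[OF t, of "-n"] by simp
qed

lemma int_factorization:
  assumes t: "uniformizer t" and z: "z \<in> carrier F" "z \<noteq> \<zero>"
  shows "\<exists>n::int. \<exists>u. punit u \<and> z = t [^] n \<otimes> u"
proof (cases "z \<in> VR P")
  case True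
  then show ?thesis using factorization[OF t True z(2)] int_pow_int[of F t] by metis
next
  case False
  note tc = uniformizer_carrier[OF t]
  have "inv z \<in> VR P" using VR_props(5)[OF z] False by blast
  then obtain n u where nu: "punit u" "inv z = t [^] (n::nat) \<otimes> u" using factorization[OF t] z by (metis inv_nz)
  have uc: "u \<in> carrier F" "u \<noteq> \<zero>" using nu punit_carrier by auto
  have "z = inv (t [^] n \<otimes> u)" using nu z by (metis inv_inv_nz)
  also have "\<dots> = inv (t [^] n) \<otimes> inv u" using inv_mult_nz[of "t [^] n" u] nat_pow_nonzero[OF tc] tc uc by simp
  also have "inv (t [^] n) = t [^] (- int n)" 
    by (cases "n = 0") (simp_all add: int_pow_def2 del: pow_nat nat_pow_Suc)
  finally show ?thesis using punit_inv[OF nu(1)] by blast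
qed

lemma PIdl_eq_place_iff:
  assumes "t \<in> VR P"
  shows "PIdl\<^bsub>F\<lparr>carrier := VR P\<rparr>\<^esub> t = P \<longleftrightarrow> uniformizer t"
proof
  have tc: "t \<in> carrier F" using assms VR_closed(1) by simp
  have e: "PIdl\<^bsub>F\<lparr>carrier := VR P\<rparr>\<^esub> t = {v \<otimes> t | v. v \<in> VR P}" by (simp add: cgenideal_def)
  have m: "v \<otimes> t = t \<otimes> v" if "v \<in> VR P" for v using that tc VR_closed(1) by (simp add: m_comm)
  assume A: "PIdl\<^bsub>F\<lparr>carrier := VR P\<rparr>\<^esub> t = P"
  have "t \<in> {v \<otimes> t | v. v \<in> VR P}" using tc VR_closed(3) by force
  then have tP: "t \<in> P" unfolding e[symmetric] A .
  have zf: "\<exists>v\<in>VR P. z = t \<otimes> v" if "z \<in> P" for z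
  proof -
    have "z \<in> {v \<otimes> t | v. v \<in> VR P}" using that unfolding e[symmetric] A .
    then show ?thesis using m by blast
  qed
  have "t \<noteq> \<zero>" using exists_nonzero_in_place zf VR_closed(1) by auto
  then show "uniformizer t" using tP zf by (simp add: uniformizer_def)
next
  assume t: "uniformizer t"
  note tc = uniformizer_carrier[OF t]
  have tP: "t \<in> P" using t by (simp add: uniformizer_def)
  have "{v \<otimes> t | v. v \<in> VR P} = P"
    using t place_mult[OF _ tP] tc VR_closed(1) by (fastforce simp: uniformizer_def m_comm)
  then show "PIdl\<^bsub>F\<lparr>carrier := VR P\<rparr>\<^esub> t = P" by (simp add: cgenideal_def)
qed

lemma Units_VR: "Units (F\<lparr>carrier := VR P\<rparr>) = {u. punit u}"
proof -
  have "punit u" if u: "u \<in> VR P" "v \<in> VR P" "v \<otimes> u = \<one>" "u \<otimes> v = \<one>" for u v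
  proof -
    have "u \<noteq> \<zero>" using u VR_closed(1) by auto
    moreover have "inv u = v" using u VR_closed(1) by (metis inv_unique')
    ultimately show ?thesis using u by (simp add: punit_def)
  qed
  moreover have "\<exists>v\<in>VR P. v \<otimes> u = \<one> \<and> u \<otimes> v = \<one>" if "punit u" for u
    using that VR_closed(1) by (intro bexI[of _ "inv u"]) (auto simp: punit_def)
  ultimately show ?thesis by (auto simp: Units_def punit_def)
qed

text \<open>Two uniformizers differ by a unit, and \<open>t^n\<close> is a unit only for
  \<open>n = 0\<close>; hence the \<open>THE\<close> in \<open>place_val\<close> has a unique
  solution, whichever uniformizer is used.\<close>

lemma ord_eqI:
  assumes t: "uniformizer t" and u: "punit u" and z: "z = t [^] (n::int) \<otimes> u"
  shows "ord P z = n"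
proof -
  note tc = uniformizer_carrier[OF t]
  have tV: "t \<in> VR P" using t place_subset by (auto simp: uniformizer_def)
  have uniq: "m = n" if s: "uniformizer s" "punit v" "z = s [^] m \<otimes> v" for m :: int and s v
  proof -
    note sc = uniformizer_carrier[OF s(1)]
    have sP: "s \<in> P" "t \<in> P" using s t by (auto simp: uniformizer_def)
    obtain a where a: "a \<in> VR P" "s = t \<otimes> a" using t sP by (auto simp: uniformizer_def)
    obtain b where b: "b \<in> VR P" "t = s \<otimes> b" using s sP by (auto simp: uniformizer_def)
    have ab: "a \<in> carrier F" "b \<in> carrier F" "a \<noteq> \<zero>" using a b sc tc VR_closed(1) by auto
    have "t \<otimes> \<one> = t \<otimes> (a \<otimes> b)" using a b tc ab by (metis m_assoc r_one)
    then have "a \<otimes> b = \<one>" using m_lcancel[of t \<one> "a \<otimes> b"] tc ab by simp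
    then have "inv a = b" using ab by (metis inv_unique' m_comm)
    then have pa: "punit a" using a b ab by (simp add: punit_def)
    have pam: "punit (a [^] m)" using punit_pow[OF pa] .
    have tn: "t [^] n \<in> carrier F" "t [^] m \<in> carrier F" "t [^] m \<noteq> \<zero>" "t [^] (n - m) \<in> carrier F" 
      using field_int_pow_closed[OF tc] by auto
    have uc: "u \<in> carrier F" "v \<in> carrier F" "a [^] m \<in> carrier F" "u \<noteq> \<zero>" "inv u \<in> carrier F"
      using punit_carrier u s pam by auto
    have "t [^] n \<otimes> u = (t \<otimes> a) [^] m \<otimes> v" using s z a by simp
    also have "\<dots> = t [^] m \<otimes> (a [^] m \<otimes> v)" using field_int_pow_distrib[OF tc ab(1,3)] tn uc by (simp add: m_assoc)
    also have "t [^] n = t [^] m \<otimes> t [^] (n - m)" using field_int_pow_mult[OF tc, of m "n - m"] by simp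
    finally have "t [^] m \<otimes> (t [^] (n - m) \<otimes> u) = t [^] m \<otimes> (a [^] m \<otimes> v)" using tn uc by (simp add: m_assoc)
    then have "t [^] (n - m) \<otimes> u = a [^] m \<otimes> v" using m_lcancel tn uc by simp
    then have "(t [^] (n - m) \<otimes> u) \<otimes> inv u = (a [^] m \<otimes> v) \<otimes> inv u" by simp
    then have "t [^] (n - m) = (a [^] m \<otimes> v) \<otimes> inv u" using tn uc by (simp add: m_assoc)
    then have "punit (t [^] (n - m))" using punit_mult pam s(2) punit_inv[OF u] by simp
    then show ?thesis using punit_uniformizer_pow[OF t] by fastforce
  qed
  show ?thesis
    unfolding place_val_def Let_def
  proof (rule the_equality)
    show "\<exists>t\<in>carrier (F\<lparr>carrier := VR P\<rparr>). PIdl\<^bsub>F\<lparr>carrier := VR P\<rparr>\<^esub> t = P \<and>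
        (\<exists>u\<in>Units (F\<lparr>carrier := VR P\<rparr>). z = t [^] n \<otimes> u)"
      using tV t u z PIdl_eq_place_iff Units_VR by auto
  next
    fix m :: int assume "\<exists>t\<in>carrier (F\<lparr>carrier := VR P\<rparr>). PIdl\<^bsub>F\<lparr>carrier := VR P\<rparr>\<^esub> t = P \<and>
        (\<exists>u\<in>Units (F\<lparr>carrier := VR P\<rparr>). z = t [^] m \<otimes> u)"
    then show "m = n" using uniq PIdl_eq_place_iff Units_VR by auto
  qed
qed

lemma ord_mult:
  assumes "z \<in> carrier F" "z \<noteq> \<zero>" "w \<in> carrier F" "w \<noteq> \<zero>"
  shows "ord P (z \<otimes> w) = ord P z + ord P w"
proof -
  obtain t where t: "uniformizer t" using exists_uniformizer by blast
  note tc = uniformizer_carrier[OF t]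
  obtain n u m v where n: "punit u" "z = t [^] (n::int) \<otimes> u" and m: "punit v" "w = t [^] (m::int) \<otimes> v"
    using int_factorization[OF t] assms by meson
  have c: "t [^] n \<in> carrier F" "t [^] m \<in> carrier F" "u \<in> carrier F" "v \<in> carrier F"
    using field_int_pow_closed[OF tc] n m punit_carrier by auto
  have "z \<otimes> w = (t [^] n \<otimes> t [^] m) \<otimes> (u \<otimes> v)" unfolding n(2) m(2) using c by algebra
  then have "z \<otimes> w = t [^] (n + m) \<otimes> (u \<otimes> v)" using field_int_pow_mult[OF tc] by simp
  from ord_eqI[OF t punit_mult[OF n(1) m(1)] this] show ?thesis
    using ord_eqI[OF t n] ord_eqI[OF t m] by simp
qed

lemma ord_nonneg_iff:
  assumes z: "z \<in> carrier F" "z \<noteq> \<zero>"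
  shows "0 \<le> ord P z \<longleftrightarrow> z \<in> VR P"
proof -
  obtain t where t: "uniformizer t" using exists_uniformizer by blast
  note tc = uniformizer_carrier[OF t]
  obtain n u where n: "punit u" "z = t [^] (n::int) \<otimes> u" using int_factorization[OF t z] by blast
  have c: "t [^] n \<in> carrier F" "u \<in> carrier F" "u \<noteq> \<zero>" "inv u \<in> carrier F"
    using field_int_pow_closed[OF tc] n punit_carrier by auto
  have uV: "u \<in> VR P" "inv u \<in> VR P" using n by (auto simp: punit_def)
  have "t [^] n = z \<otimes> inv u" unfolding n(2) using c by (simp add: m_assoc)
  then have "z \<in> VR P \<longleftrightarrow> t [^] n \<in> VR P" using n(2) uV VR_closed(6) by metis
  then show ?thesis using uniformizer_pow_in_VR[OF t] ord_eqI[OF t n] by simp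
qed

lemma ord_inv:
  assumes z: "z \<in> carrier F" "z \<noteq> \<zero>"
  shows "ord P (inv z) = - ord P z"
proof -
  have o: "ord P (\<one> \<otimes> \<one>) = ord P \<one> + ord P \<one>" by (rule ord_mult) auto
  have "ord P (z \<otimes> inv z) = ord P z + ord P (inv z)" using z by (intro ord_mult) auto
  then show ?thesis using z o by simp
qed

lemma ord_eq_zero_iff:
  assumes z: "z \<in> carrier F" "z \<noteq> \<zero>"
  shows "ord P z = 0 \<longleftrightarrow> z \<in> VR P \<and> inv z \<in> VR P"
proof -
  have "0 \<le> ord P (inv z) \<longleftrightarrow> inv z \<in> VR P" using z by (intro ord_nonneg_iff) auto
  then show ?thesis using ord_nonneg_iff[OF z] ord_inv[OF z] by auto
qed

lemma ord_K: "k \<in> K \<Longrightarrow> k \<noteq> \<zero> \<Longrightarrow> ord P k = 0"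
  using ord_eq_zero_iff[of k] VR_props(2) by auto

lemma ord_pos_iff:
  assumes z: "z \<in> carrier F" "z \<noteq> \<zero>"
  shows "1 \<le> ord P z \<longleftrightarrow> z \<in> P"
proof -
  have "1 \<le> ord P z \<longleftrightarrow> 0 \<le> ord P z \<and> ord P z \<noteq> 0" by auto
  then show ?thesis using ord_nonneg_iff[OF z] ord_eq_zero_iff[OF z] z by (auto simp: place_iff)
qed

lemma ord_add:
  assumes z: "z \<in> carrier F" "z \<noteq> \<zero>" and w: "w \<in> carrier F" "w \<noteq> \<zero>" and s: "z \<oplus> w \<noteq> \<zero>"
  shows "min (ord P z) (ord P w) \<le> ord P (z \<oplus> w)"
proof -
  have aux: "ord P w \<le> ord P (z \<oplus> w)" if z: "z \<in> carrier F" "z \<noteq> \<zero>" and w: "w \<in> carrier F" "w \<noteq> \<zero>"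
      and s: "z \<oplus> w \<noteq> \<zero>" and le: "ord P w \<le> ord P z" for z w
  proof -
    have ic: "inv w \<in> carrier F" "inv w \<noteq> \<zero>" using w by auto
    have nz: "z \<otimes> inv w \<noteq> \<zero>" using z ic integral by blast
    have "ord P (z \<otimes> inv w) = ord P z - ord P w" using ord_mult[OF z ic] ord_inv[OF w] by simp
    then have "z \<otimes> inv w \<in> VR P" using le ord_nonneg_iff[of "z \<otimes> inv w"] nz z ic by simp
    then have v: "z \<otimes> inv w \<oplus> \<one> \<in> VR P" using VR_closed by simp
    have "(z \<otimes> inv w \<oplus> \<one>) \<otimes> w = z \<otimes> (inv w \<otimes> w) \<oplus> w" using z w ic by algebra
    then have e: "(z \<otimes> inv w \<oplus> \<one>) \<otimes> w = z \<oplus> w" using z w by simp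
    then have n1: "z \<otimes> inv w \<oplus> \<one> \<noteq> \<zero>" using s w by auto
    have c1: "z \<otimes> inv w \<oplus> \<one> \<in> carrier F" using z ic by simp
    have "ord P (z \<oplus> w) = ord P (z \<otimes> inv w \<oplus> \<one>) + ord P w" using ord_mult[OF c1 n1 w] e by simp
    moreover have "0 \<le> ord P (z \<otimes> inv w \<oplus> \<one>)" using ord_nonneg_iff[OF c1 n1] v by simp
    ultimately show ?thesis by simp
  qed
  show ?thesis
  proof (cases "ord P w \<le> ord P z")
    case True
    then show ?thesis using aux[OF z w s] by simp
  next
    case False
    then show ?thesis using aux[OF w z] s a_comm[of w z] z w by simp
  qed
qed

lemma exists_ord: "\<exists>z\<in>carrier F. z \<noteq> \<zero> \<and> ord P z = n"
proof -
  obtain t where t: "uniformizer t" using exists_uniformizer by blast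
  note tc = uniformizer_carrier[OF t]
  have "punit \<one>" using VR_closed(3) by (simp add: punit_def)
  moreover have "t [^] n = t [^] n \<otimes> \<one>" using field_int_pow_closed[OF tc] by simp
  ultimately have "ord P (t [^] n) = n" by (rule ord_eqI[OF t])
  then show ?thesis using field_int_pow_closed[OF tc, of n] by blast
qed

end


section \<open>Powers of a place\<close>

definition vpow :: "'a set \<Rightarrow> int \<Rightarrow> 'a set" where
  "vpow P k = {z \<in> carrier F. z = \<zero> \<or> k \<le> ord P z}"

lemma vpow_carrier: "vpow P k \<subseteq> carrier F"
  by (auto simp: vpow_def)

lemma zero_vpow: "\<zero> \<in> vpow P k"
  by (simp add: vpow_def)

lemma vpow_mono: "k \<le> l \<Longrightarrow> vpow P l \<subseteq> vpow P k"
  by (auto simp: vpow_def)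

context
  fixes P assumes P: "P \<in> Places"
begin

lemma vpow_add: "z \<in> vpow P k \<Longrightarrow> w \<in> vpow P k \<Longrightarrow> z \<oplus> w \<in> vpow P k"
  using ord_add[OF P, of z w] by (cases "z = \<zero>"; cases "w = \<zero>") (auto simp: vpow_def)

lemma vpow_mult:
  assumes "z \<in> vpow P k" "w \<in> vpow P l" shows "z \<otimes> w \<in> vpow P (k + l)"
proof (cases "z = \<zero> \<or> w = \<zero>")
  case True
  then show ?thesis using assms by (auto simp: vpow_def)
next
  case False
  then show ?thesis using assms ord_mult[OF P, of z w] by (auto simp: vpow_def)
qed

lemma vpow_0: "vpow P 0 = VR P"
proof -
  have "z \<in> vpow P 0 \<longleftrightarrow> z \<in> VR P" for z
    using ord_nonneg_iff[OF P, of z] VR_closed(1,2)[OF P] by (cases "z = \<zero>") (auto simp: vpow_def)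
  then show ?thesis by blast
qed

lemma vpow_1: "vpow P 1 = P"
proof -
  have "z \<in> vpow P 1 \<longleftrightarrow> z \<in> P" for z
    using ord_pos_iff[OF P, of z] place_subset(2)[OF P] place_iff[OF P, of \<zero>] VR_closed(2)[OF P]
    by (cases "z = \<zero>") (auto simp: vpow_def)
  then show ?thesis by blast
qed

lemma K_vpow: "k \<in> K \<Longrightarrow> k \<in> vpow P 0"
  using vpow_0 VR_props(2)[OF P] by auto

lemma vpow_lin_sub: "lin_sub K (vpow P k)"
  unfolding lin_sub_def
proof (intro conjI ballI)
  fix c v assume "c \<in> K" "v \<in> vpow P k"
  then show "c \<otimes> v \<in> vpow P k" using vpow_mult[OF K_vpow, of c v k] by simp
qed (use vpow_carrier zero_vpow vpow_add in auto)

lemmas vpow_minus = lin_sub_minus[OF vpow_lin_sub K_subfield]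
  and vpow_neg = lin_sub_neg[OF vpow_lin_sub K_subfield]

end

section \<open>Residue fields\<close>

text \<open>Representatives of \<open>A/B\<close> in place of the quotient group: the index becomes
  \<open>card T\<close>, and simultaneous residues at several places are elements of
  \<open>PiE\<close>.\<close>

definition transversal :: "'a set \<Rightarrow> 'a set \<Rightarrow> 'a set \<Rightarrow> bool" where
  "transversal T A B \<longleftrightarrow> T \<subseteq> A \<and> finite T \<and> (\<forall>z\<in>A. \<exists>!r. r \<in> T \<and> z \<ominus> r \<in> B)"

lemma transversal_ex: "transversal T A B \<Longrightarrow> z \<in> A \<Longrightarrow> \<exists>r\<in>T. z \<ominus> r \<in> B"
  unfolding transversal_def by blast

lemma transversal_uniq:
  "transversal T A B \<Longrightarrow> z \<in> A \<Longrightarrow> r \<in> T \<Longrightarrow> s \<in> T \<Longrightarrow> z \<ominus> r \<in> B \<Longrightarrow> z \<ominus> s \<in> B \<Longrightarrow> r = s"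
  unfolding transversal_def by blast

text \<open>Multiplicativity of the index along \<open>A\<close>, \<open>B\<close>,
  \<open>C\<close>: the sums of one representative from each step.\<close>

lemma transversal_trans:
  assumes T: "transversal T A B" and U: "transversal U B C"
    and lin: "lin_sub K A" "lin_sub K B" "lin_sub K C" and sub: "B \<subseteq> A" "C \<subseteq> B"
  shows "\<exists>W. transversal W A C \<and> card W = card T * card U"
proof -
  have Ac: "A \<subseteq> carrier F" using lin_subD(1)[OF lin(1)] .
  have TU: "T \<subseteq> A" "U \<subseteq> B" "finite T" "finite U" using T U by (auto simp: transversal_def)
  let ?f = "\<lambda>(r, s). r \<oplus> s"
  have key: "r = r' \<and> s = s'"
    if "z \<in> A" "r \<in> T" "s \<in> U" "r' \<in> T" "s' \<in> U" "z \<ominus> (r \<oplus> s) \<in> C" "z \<ominus> (r' \<oplus> s') \<in> C" for z r s r' s'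
  proof -
    have c: "z \<in> carrier F" "r \<in> carrier F" "s \<in> carrier F" "r' \<in> carrier F" "s' \<in> carrier F"
      using that TU Ac sub by blast+
    have e: "z \<ominus> r = (z \<ominus> (r \<oplus> s)) \<oplus> s" "z \<ominus> r' = (z \<ominus> (r' \<oplus> s')) \<oplus> s'"
      "(z \<ominus> r) \<ominus> s = z \<ominus> (r \<oplus> s)" "(z \<ominus> r') \<ominus> s' = z \<ominus> (r' \<oplus> s')"
      using c by algebra+
    have B: "z \<ominus> r \<in> B" "z \<ominus> r' \<in> B"
      unfolding e(1,2) using that sub TU lin_subD(3)[OF lin(2)] by blast+
    then have rr: "r = r'" using transversal_uniq[OF T that(1,2,4)] by blast
    have "(z \<ominus> r) \<ominus> s \<in> C" "(z \<ominus> r) \<ominus> s' \<in> C" using e(3,4) that(6,7) rr by simp_all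
    then have "s = s'" using transversal_uniq[OF U B(1) that(3,5)] by blast
    then show ?thesis using rr by simp
  qed
  have in_A: "r \<oplus> s \<in> A" if "r \<in> T" "s \<in> U" for r s
    using that TU sub lin_subD(3)[OF lin(1)] by blast
  have self: "z \<ominus> z \<in> C" if "z \<in> A" for z
    using that Ac lin_subD(2)[OF lin(3)] by (auto simp: a_minus_def r_neg subset_iff)
  have inj: "inj_on ?f (T \<times> U)"
  proof (rule inj_onI, clarify)
    fix r s r' s' assume A: "r \<in> T" "s \<in> U" "r' \<in> T" "s' \<in> U" "r \<oplus> s = r' \<oplus> s'"
    have "(r \<oplus> s) \<ominus> (r \<oplus> s) \<in> C" by (rule self[OF in_A[OF A(1,2)]])
    moreover from this have "(r \<oplus> s) \<ominus> (r' \<oplus> s') \<in> C" using A(5) by simp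
    ultimately show "r = r' \<and> s = s'" by (rule key[OF in_A[OF A(1,2)] A(1-4)])
  qed
  have "transversal (?f ` (T \<times> U)) A C"
    unfolding transversal_def
  proof (intro conjI ballI)
    show "?f ` (T \<times> U) \<subseteq> A" using in_A by auto
    show "finite (?f ` (T \<times> U))" using TU by simp
    fix z assume z: "z \<in> A"
    obtain r where r: "r \<in> T" "z \<ominus> r \<in> B" using transversal_ex[OF T z] by blast
    obtain s where s: "s \<in> U" "(z \<ominus> r) \<ominus> s \<in> C" using transversal_ex[OF U r(2)] by blast
    have c: "z \<in> carrier F" "r \<in> carrier F" "s \<in> carrier F" using z r s TU Ac sub by blast+
    have "(z \<ominus> r) \<ominus> s = z \<ominus> (r \<oplus> s)" using c by algebra
    then have rs: "z \<ominus> (r \<oplus> s) \<in> C" using s by simp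
    show "\<exists>!w. w \<in> ?f ` (T \<times> U) \<and> z \<ominus> w \<in> C"
    proof (rule ex1I[of _ "r \<oplus> s"])
      show "r \<oplus> s \<in> ?f ` (T \<times> U) \<and> z \<ominus> (r \<oplus> s) \<in> C" using r s rs by force
      fix w assume "w \<in> ?f ` (T \<times> U) \<and> z \<ominus> w \<in> C"
      then obtain r' s' where w: "r' \<in> T" "s' \<in> U" "w = r' \<oplus> s'" "z \<ominus> (r' \<oplus> s') \<in> C" by auto
      show "w = r \<oplus> s" using key[OF z w(1,2) r(1) s(1) w(4) rs] w(3) by simp
    qed
  qed
  moreover have "card (?f ` (T \<times> U)) = card T * card U"
    using card_image[OF inj] by (simp add: card_cartesian_product)
  ultimately show ?thesis by blast
qed

context
  fixes P assumes P: "P \<in> Places"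
begin

abbreviation (input) "VRing \<equiv> F\<lparr>carrier := VR P\<rparr>"
abbreviation (input) "coset a \<equiv> P +>\<^bsub>F\<lparr>carrier := VR P\<rparr>\<^esub> a"

lemma coset_eq: "coset a = {h \<oplus> a | h. h \<in> P}"
  by (auto simp: a_r_coset_def r_coset_def)

lemma coset_eq_iff:
  assumes a: "a \<in> VR P" and b: "b \<in> VR P"
  shows "coset a = coset b \<longleftrightarrow> a \<ominus> b \<in> P"
proof -
  have c: "a \<in> carrier F" "b \<in> carrier F" using a b VR_closed(1)[OF P] by auto
  have z: "\<zero> \<in> P" using zero_vpow[of P 1] vpow_1[OF P] by simp
  have sub: "coset a \<subseteq> coset b" if "a \<in> carrier F" "b \<in> carrier F" "a \<ominus> b \<in> P" for a b
  proof
    fix y assume "y \<in> coset a"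
    then obtain h where h: "h \<in> P" "y = h \<oplus> a" by (auto simp: coset_eq)
    have hc: "h \<in> carrier F" using h place_subset(2)[OF P] by blast
    have "y = (h \<oplus> (a \<ominus> b)) \<oplus> b" unfolding h(2) using hc that(1,2) by algebra
    moreover have "h \<oplus> (a \<ominus> b) \<in> P" using vpow_add[OF P, of h 1 "a \<ominus> b"] vpow_1[OF P] h that by simp
    ultimately show "y \<in> coset b" by (auto simp: coset_eq)
  qed
  show ?thesis
  proof
    assume e: "coset a = coset b"
    have "\<zero> \<oplus> a \<in> coset a" unfolding coset_eq using z by blast
    then obtain h where h: "h \<in> P" "a = h \<oplus> b" using e c by (auto simp: coset_eq)
    have hc: "h \<in> carrier F" using h place_subset(2)[OF P] by blast
    have "a \<ominus> b = h" unfolding h(2) using hc c(2) by algebra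
    then show "a \<ominus> b \<in> P" using h by simp
  next
    assume A: "a \<ominus> b \<in> P"
    have "b \<ominus> a = \<ominus> (a \<ominus> b)" using c by algebra
    then have "b \<ominus> a \<in> P" using vpow_neg[OF P, of "a \<ominus> b" 1] vpow_1[OF P] A by simp
    then show "coset a = coset b" using sub c A by blast
  qed
qed

lemma minus_minus_minus:
  "a \<in> carrier F \<Longrightarrow> b \<in> carrier F \<Longrightarrow> c \<in> carrier F \<Longrightarrow> (c \<ominus> b) \<ominus> (c \<ominus> a) = a \<ominus> b"
  by algebra

text \<open>Translates \<open>place_deg\<close>, a dimension in the quotient ring, into a count. The
  residue field is finite because incongruence modulo a uniformizer falls under
  \<open>card_incongruent_le\<close>.\<close>

lemma residue_transversal:
  "\<exists>T. transversal T (VR P) P \<and> card T = q ^ place_deg F K P"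
proof -
  let ?k = "VRing Quot P"
  interpret I: ideal P VRing
    using nonunits_ideal[OF place_ring_props(1)[OF P]] place_ring_props(2)[OF P] by simp
  interpret k: ring ?k by (rule I.quotient_is_ring)
  have ck: "carrier ?k = coset ` VR P" by (auto simp: FactRing_def A_RCOSETS_def')
  define rep where "rep C = (SOME a. a \<in> VR P \<and> C = coset a)" for C
  have rep: "rep C \<in> VR P \<and> C = coset (rep C)" if "C \<in> carrier ?k" for C
    unfolding rep_def by (rule someI_ex) (use that ck in blast)
  let ?T = "rep ` carrier ?k"
  have T: "?T \<subseteq> VR P" using rep by blast
  have inj: "inj_on rep (carrier ?k)" by (rule inj_onI) (use rep in metis)
  obtain t where t: "uniformizer P t" using exists_uniformizer[OF P] by blast
  have tc: "t \<in> VR P" "t \<noteq> \<zero>" "t \<in> P"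
    using t place_subset(1)[OF P] by (auto simp: uniformizer_def[OF P])
  have uniq: "a = b" if ab: "a \<in> ?T" "b \<in> ?T" "a \<ominus> b \<in> P" for a b
  proof -
    obtain C D where CD: "C \<in> carrier ?k" "D \<in> carrier ?k" "a = rep C" "b = rep D" using ab by blast
    have "coset a = coset b" using coset_eq_iff ab T by blast
    then have "C = D" using rep CD by metis
    then show ?thesis using CD by simp
  qed
  have finT: "finite ?T"
  proof (rule conjunct1[OF card_incongruent_le[OF VR_props(1,2)[OF P] tc(1,2) T]])
    fix a b c assume ab: "a \<in> ?T" "b \<in> ?T" and c: "c \<in> VR P" and e: "a \<ominus> b = t \<otimes> c"
    have "t \<otimes> c = c \<otimes> t" using tc(1) c VR_closed(1)[OF P] by (simp add: m_comm)
    then have "a \<ominus> b \<in> P" using place_mult[OF P c tc(3)] e by simp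
    then show "a = b" using uniq ab by blast
  qed
  then have fink: "finite (carrier ?k)" using inj finite_imageD by blast
  have tr: "transversal ?T (VR P) P"
    unfolding transversal_def
  proof (intro conjI ballI)
    fix z assume z: "z \<in> VR P"
    have r: "rep (coset z) \<in> VR P" "coset z = coset (rep (coset z))" using rep[of "coset z"] z ck by auto
    then have zr: "z \<ominus> rep (coset z) \<in> P" using coset_eq_iff[OF z r(1)] by blast
    show "\<exists>!r. r \<in> ?T \<and> z \<ominus> r \<in> P"
    proof (rule ex1I[of _ "rep (coset z)"])
      show "rep (coset z) \<in> ?T \<and> z \<ominus> rep (coset z) \<in> P" using z zr ck by blast
      fix r assume r': "r \<in> ?T \<and> z \<ominus> r \<in> P"
      then have rV: "r \<in> VR P" using T by blast
      have c: "r \<in> carrier F" "z \<in> carrier F" "rep (coset z) \<in> carrier F" using rV z r(1) VR_closed(1)[OF P] by auto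
      have "r \<ominus> rep (coset z) = (z \<ominus> rep (coset z)) \<ominus> (z \<ominus> r)"
        using minus_minus_minus c by simp
      then have "r \<ominus> rep (coset z) \<in> P"
        using vpow_minus[OF P, of "z \<ominus> rep (coset z)" 1 "z \<ominus> r"] vpow_1[OF P] zr r' by simp
      then show "r = rep (coset z)" using uniq r' z ck by blast
    qed
  qed (use T finT in auto)
  let ?K' = "(\<lambda>c. coset c) ` K"
  have "subfield K VRing"
    using ring.subfield_iff(1)[OF subring_is_ring[OF VR_props(1)[OF P]], of K] subfield_iff(2)[OF K_subfield] VR_props(2)[OF P] by simp
  moreover have "\<one>\<^bsub>?k\<^esub> \<noteq> \<zero>\<^bsub>?k\<^esub>"
  proof
    assume "\<one>\<^bsub>?k\<^esub> = \<zero>\<^bsub>?k\<^esub>"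
    then have "coset \<one> = P" by (simp add: FactRing_def)
    moreover have "\<zero> \<oplus> \<one> \<in> coset \<one>" unfolding coset_eq using zero_vpow[of P 1] vpow_1[OF P] by blast
    ultimately show False using one_notin_place[OF P] by simp
  qed
  ultimately have K': "inj_on (\<lambda>c. coset c) K" "subfield ?K' ?k" by (rule ring_hom_ring.img_is_subfield[OF I.rcos_ring_hom_ring])+
  have "k.lin_sub ?K' (carrier ?k)"
    unfolding k.lin_sub_def using k.subfield_iff subringE(1)[OF subfieldE(1)[OF K'(2)]] by auto
  then have "card (carrier ?k) = card ?K' ^ k.dim ?K' (carrier ?k)"
    using k.card_lin_sub[OF K'(2) _ fink] by simp
  also have "card ?K' = q" using card_image[OF K'(1)] .
  finally have "card (carrier ?k) = q ^ place_deg F K P" by (simp add: place_deg_def Let_def)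
  then show ?thesis using tr card_image[OF inj] by metis
qed

text \<open>The residues of 0 and 1 differ, so there are at least two classes.\<close>

lemma place_deg_pos: "place_deg F K P \<ge> 1"
proof -
  obtain T where T: "transversal T (VR P) P" "card T = q ^ place_deg F K P" using residue_transversal by blast
  have T': "T \<subseteq> VR P" "finite T" using T by (auto simp: transversal_def)
  obtain r where r: "r \<in> T" "\<one> \<ominus> r \<in> P" using transversal_ex[OF T(1) VR_closed(3)[OF P]] by blast
  obtain s where s: "s \<in> T" "\<zero> \<ominus> s \<in> P" using transversal_ex[OF T(1) VR_closed(2)[OF P]] by blast
  have "r \<noteq> s"
  proof
    assume e: "r = s"
    have c: "s \<in> carrier F" using s T' VR_closed(1)[OF P] by blast
    have "\<one> = (\<one> \<ominus> s) \<ominus> (\<zero> \<ominus> s)" using c by algebra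
    moreover have "(\<one> \<ominus> s) \<ominus> (\<zero> \<ominus> s) \<in> P"
      using vpow_minus[OF P, of "\<one> \<ominus> s" 1 "\<zero> \<ominus> s"] vpow_1[OF P] r s e by simp
    ultimately show False using one_notin_place[OF P] by simp
  qed
  moreover have "card {r, s} \<le> card T" using r s T' by (intro card_mono) auto
  ultimately have "2 \<le> q ^ place_deg F K P" using T(2) by simp
  then show ?thesis by (cases "place_deg F K P") auto
qed

text \<open>Multiplication by an element of order \<open>m\<close> carries the residue field onto
  \<open>P^m/P^(m+1)\<close>, so every step of the chain has the same index.\<close>

lemma vpow_transversal:
  "\<exists>T. transversal T (vpow P k) (vpow P (k + int n)) \<and> card T = q ^ (n * place_deg F K P)"
proof (induction n)
  case 0
  have c: "vpow P k \<subseteq> carrier F" by (rule vpow_carrier)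
  have "transversal {\<zero>} (vpow P k) (vpow P (k + int 0))"
    using c zero_vpow[of P k] by (auto simp: transversal_def a_minus_def subset_iff)
  then show ?case by (intro exI[of _ "{\<zero>}"]) simp
next
  case (Suc n)
  let ?m = "k + int n"
  obtain T where T: "transversal T (vpow P k) (vpow P ?m)" "card T = q ^ (n * place_deg F K P)" using Suc by blast
  obtain U where U: "transversal U (VR P) P" "card U = q ^ place_deg F K P" using residue_transversal by blast
  have U': "U \<subseteq> VR P" "finite U" using U by (auto simp: transversal_def)
  obtain z where z: "z \<in> carrier F" "z \<noteq> \<zero>" "ord P z = ?m" using exists_ord[OF P] by blast
  have iz: "inv z \<in> carrier F" "inv z \<noteq> \<zero>" "ord P (inv z) = - ?m" using z ord_inv[OF P] by auto
  have scale: "y \<in> vpow P l \<Longrightarrow> z \<otimes> y \<in> vpow P (?m + l)" "y \<in> vpow P l \<Longrightarrow> inv z \<otimes> y \<in> vpow P (l - ?m)" for y l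
    using vpow_mult[OF P, of z ?m y l] vpow_mult[OF P, of "inv z" "- ?m" y l] z iz by (auto simp: vpow_def)
  have Uc: "U \<subseteq> carrier F" using U' VR_closed(1)[OF P] by blast
  have zy: "z \<otimes> (inv z \<otimes> y) = y" if "y \<in> carrier F" for y
    using that z iz by (simp add: m_assoc[symmetric])
  have inj: "inj_on ((\<otimes>) z) U"
    by (rule inj_onI) (use m_lcancel[OF z(2,1)] Uc in blast)
  have tr: "transversal ((\<otimes>) z ` U) (vpow P ?m) (vpow P (?m + 1))"
    unfolding transversal_def
  proof (intro conjI ballI)
    show "(\<otimes>) z ` U \<subseteq> vpow P ?m" using scale(1)[of _ 0] U' vpow_0[OF P] by auto
    show "finite ((\<otimes>) z ` U)" using U' by simp
    fix y assume y: "y \<in> vpow P ?m"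
    have yc: "y \<in> carrier F" using y vpow_carrier by blast
    have iy: "inv z \<otimes> y \<in> VR P" using scale(2)[OF y] vpow_0[OF P] by simp
    have iff: "y \<ominus> z \<otimes> u \<in> vpow P (?m + 1) \<longleftrightarrow> (inv z \<otimes> y) \<ominus> u \<in> P" if u: "u \<in> U" for u
    proof -
      have uc: "u \<in> carrier F" using u Uc by blast
      have "z \<otimes> ((inv z \<otimes> y) \<ominus> u) = z \<otimes> (inv z \<otimes> y) \<ominus> z \<otimes> u" using z(1) iz(1) yc uc by algebra
      then have e1: "z \<otimes> ((inv z \<otimes> y) \<ominus> u) = y \<ominus> z \<otimes> u" using zy yc by simp
      have "inv z \<otimes> (y \<ominus> z \<otimes> u) = inv z \<otimes> y \<ominus> (inv z \<otimes> z) \<otimes> u" using z(1) iz(1) yc uc by algebra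
      then have e2: "inv z \<otimes> (y \<ominus> z \<otimes> u) = inv z \<otimes> y \<ominus> u" using z uc by simp
      show ?thesis
        using scale(1)[of "(inv z \<otimes> y) \<ominus> u" 1] scale(2)[of "y \<ominus> z \<otimes> u" "?m + 1"] e1 e2 vpow_1[OF P] by auto
    qed
    obtain u where u: "u \<in> U" "(inv z \<otimes> y) \<ominus> u \<in> P" using transversal_ex[OF U(1) iy] by blast
    show "\<exists>!r. r \<in> (\<otimes>) z ` U \<and> y \<ominus> r \<in> vpow P (?m + 1)"
    proof (rule ex1I[of _ "z \<otimes> u"])
      show "z \<otimes> u \<in> (\<otimes>) z ` U \<and> y \<ominus> z \<otimes> u \<in> vpow P (?m + 1)" using u iff by blast
      fix r assume "r \<in> (\<otimes>) z ` U \<and> y \<ominus> r \<in> vpow P (?m + 1)"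
      then obtain v where v: "v \<in> U" "r = z \<otimes> v" "(inv z \<otimes> y) \<ominus> v \<in> P" using iff by blast
      then show "r = z \<otimes> u" using transversal_uniq[OF U(1) iy v(1) u(1) v(3) u(2)] by simp
    qed
  qed
  obtain W where "transversal W (vpow P k) (vpow P (?m + 1))" "card W = card T * card ((\<otimes>) z ` U)"
    using transversal_trans[OF T(1) tr vpow_lin_sub[OF P] vpow_lin_sub[OF P] vpow_lin_sub[OF P]]
      vpow_mono[of k ?m P] vpow_mono[of ?m "?m + 1" P] by auto
  moreover have "?m + 1 = k + int (Suc n)" by simp
  ultimately show ?case using T(2) U(2) card_image[OF inj] by (auto simp: power_add mult.commute intro!: exI[of _ W])
qed

end

section \<open>Existence of places\<close>

text \<open>Chevalley's argument: a subring maximal with respect to containing \<open>y = 1/z\<close> but not \<open>z\<close> is a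
  valuation ring. If neither \<open>w\<close> nor \<open>1/w\<close> belonged to it, \<open>1\<close> would be a polynomial in \<open>w\<close> and
  a polynomial in \<open>1/w\<close> with coefficients divisible by \<open>y\<close>; the longer one can be shortened.\<close>

lemma shorten_relation:
  assumes R: "subring R F" and I: "I \<subseteq> R" "\<zero> \<in> I" "\<one> \<notin> I"
      "\<And>a b. a \<in> I \<Longrightarrow> b \<in> I \<Longrightarrow> a \<oplus> b \<in> I" "\<And>r a. r \<in> R \<Longrightarrow> a \<in> I \<Longrightarrow> r \<otimes> a \<in> I"
    and w: "w \<in> carrier F" "w \<noteq> \<zero>"
    and n: "\<one> \<in> evs I w n" and m: "\<one> \<in> evs I (inv w) m" and nm: "m \<le> n"
  shows "n \<noteq> 0 \<and> \<one> \<in> evs I w (n - 1)"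
proof -
  note RE = subringE[OF R]
  have Ic: "I \<subseteq> carrier F" using I(1) RE(1) by blast
  have iw: "inv w \<in> carrier F" using w by simp
  obtain cs where cs: "set cs \<subseteq> I" "length cs = m" "\<one> = ev (inv w) cs" using m by (metis evs_E)
  obtain bs where bs: "set bs \<subseteq> I" "length bs = n" "\<one> = ev w bs" using n by (metis evs_E)
  obtain c0 cs' where cs': "cs = c0 # cs'" using cs(3) one_not_zero by (cases cs) auto
  then have c0: "c0 \<in> I" "c0 \<in> carrier F" "set cs' \<subseteq> I" "set cs' \<subseteq> carrier F" using cs(1) Ic by auto
  have m2: "m = Suc (length cs')" using cs(2) cs' by simp
  \<comment> \<open>With a single coefficient the relation in \<open>1/w\<close> would read
    \<open>1 = c0\<close>, putting 1 into \<open>I\<close>.\<close>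
  have "cs' \<noteq> []" using cs(3) cs' c0 iw I(3) by auto
  then have m1: "m \<ge> 2" using m2 by (cases cs') auto
  obtain bs' b where bs': "bs = bs' @ [b]" using bs(2) nm m1 by (metis length_0_conv not_numeral_le_zero le_trans rev_exhaust)
  then have b: "b \<in> I" "b \<in> carrier F" "set bs' \<subseteq> I" "set bs' \<subseteq> carrier F" using bs(1) Ic by auto
  have lb: "length bs' = n - 1" using bs bs' by auto
  let ?E = "ev (inv w) cs'" and ?p = "w [^] (n - 1)"
  have Ec: "?E \<in> carrier F" "?p \<in> carrier F" "ev w bs' \<in> carrier F" using c0 iw w b by auto
  have e1: "\<one> = c0 \<oplus> inv w \<otimes> ?E" using cs(3) cs' by simp
  have e2: "\<one> = ev w bs' \<oplus> ?p \<otimes> b" using bs(3) bs' b w lb ev_append[OF w(1), of bs' "[b]"] by simp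
  define u where "u = w [^] (n - m)"
  define G where "G = ev w (rev cs')"
  have uc: "u \<in> carrier F" "G \<in> carrier F" using w c0 by (auto simp: u_def G_def)
  have "n - 1 = (n - m) + (m - 1)" using nm m1 by simp
  then have "?p = u \<otimes> w [^] length cs'" using w m2 unfolding u_def by (simp add: nat_pow_mult)
  then have "?p \<otimes> ?E = u \<otimes> (w [^] length cs' \<otimes> ?E)" using uc Ec w by (simp add: m_assoc)
  also have "\<dots> = u \<otimes> (w \<otimes> G)" using ev_inv[OF w c0(4)] by (simp add: G_def)
  finally have pE: "?p \<otimes> ?E = u \<otimes> (w \<otimes> G)" .
  have "?p \<otimes> (inv w \<otimes> ?E) = inv w \<otimes> (?p \<otimes> ?E)" using Ec iw by algebra
  also have "\<dots> = (inv w \<otimes> w) \<otimes> (u \<otimes> G)" unfolding pE using uc w(1) iw by algebra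
  also have "\<dots> = u \<otimes> G" using uc w by simp
  finally have pu: "?p \<otimes> (inv w \<otimes> ?E) = u \<otimes> G" .
  have s: "\<one> \<ominus> c0 = inv w \<otimes> ?E"
  proof -
    have "(c0 \<oplus> inv w \<otimes> ?E) \<ominus> c0 = inv w \<otimes> ?E" using c0(2) iw Ec by algebra
    then show ?thesis using e1 by simp
  qed
  \<comment> \<open>Only the part \<open>1 - c0\<close> of 1 is expanded by the long relation. In
    its top term \<open>1 - c0\<close> is replaced by \<open>(1/w) ?E\<close>, which turns
    \<open>w^(n-1) (1 - c0)\<close> into \<open>w^(n-m) G\<close>, of degree below
    \<open>n - 1\<close>.\<close>
  have "\<one> = c0 \<oplus> (\<one> \<ominus> c0) \<otimes> \<one>" using c0(2) by algebra
  also have "\<dots> = c0 \<oplus> (\<one> \<ominus> c0) \<otimes> (ev w bs' \<oplus> ?p \<otimes> b)" using e2 by simp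
  also have "\<dots> = c0 \<oplus> ((\<one> \<ominus> c0) \<otimes> ev w bs' \<oplus> b \<otimes> (?p \<otimes> (\<one> \<ominus> c0)))"
    using c0(2) Ec b(2) by algebra
  also have "\<dots> = c0 \<oplus> ((\<one> \<ominus> c0) \<otimes> ev w bs' \<oplus> b \<otimes> (u \<otimes> G))" unfolding s pu ..
  finally have sum: "\<one> = c0 \<oplus> ((\<one> \<ominus> c0) \<otimes> ev w bs' \<oplus> b \<otimes> (u \<otimes> G))" .
  note add = evs_add[OF w(1) Ic I(2) I(4)] and mono = evs_mono[OF w(1) Ic I(2)]
    and smult = evs_smult[OF w(1) Ic I(2)]
  have "c0 \<in> evs I w (n - 1)"
    using coeff_evs[OF w(1) Ic I(2) c0(1)] mono[of 1 "n - 1"] m1 nm le_diff_conv2[of 1 n 1] by auto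
  moreover have "(\<one> \<ominus> c0) \<otimes> ev w bs' \<in> evs I w (n - 1)"
  proof (rule smult[of _ I])
    show "\<one> \<ominus> c0 \<in> carrier F" using c0 by simp
    have "\<one> \<ominus> c0 \<in> R" using c0(1) I(1) RE(3,5,7) by (auto simp: a_minus_def)
    then show "(\<one> \<ominus> c0) \<otimes> a \<in> I" if "a \<in> I" for a using I(5) that by blast
    show "ev w bs' \<in> evs I w (n - 1)" by (rule evs_I[OF b(3) lb])
  qed
  moreover have "b \<otimes> (u \<otimes> G) \<in> evs I w (n - 1)"
  proof (rule smult[of _ I])
    show "b \<in> carrier F" by fact
    show "b \<otimes> a \<in> I" if "a \<in> I" for a using I(1,5) b(1) that by blast
    have G: "G \<in> evs I w (m - 1)" unfolding G_def by (rule evs_I) (use c0 m2 in auto)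
    have "w [^] j \<otimes> G \<in> evs I w (j + (m - 1))" for j :: nat
    proof (induction j)
      case (Suc j)
      have "w [^] Suc j \<otimes> G = w \<otimes> (w [^] j \<otimes> G)" using w uc by (simp add: m_ac)
      then show ?case using evs_mult_x[OF w(1) Ic I(2) Suc] by simp
    qed (use G uc in auto)
    from this[of "n - m"] show "u \<otimes> G \<in> evs I w (n - 1)" using nm m1 unfolding u_def by simp
  qed
  ultimately have "\<one> \<in> evs I w (n - 1)" using sum add by metis
  then show ?thesis using nm m1 by simp
qed

text \<open>This is where places come from; it is used through \<open>L_zero\<close>, that a
  function without poles is constant. The search starts at \<open>K[1/z]\<close>, which omits
  \<open>z\<close> because \<open>z = f(1/z)\<close> would be an algebraic equation for
  \<open>1/z\<close> over \<open>K\<close>.\<close>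

lemma exists_pole:
  assumes z: "z \<in> carrier F" "z \<notin> K"
  shows "\<exists>P\<in>Places. ord P z < 0"
proof -
  have nz: "z \<noteq> \<zero>" using z by auto
  define y where "y = inv z"
  have y: "y \<in> carrier F" "y \<noteq> \<zero>" "y \<notin> K" "y \<otimes> z = \<one>"
    using z nz inv_mem_K_iff[of z] by (auto simp: y_def)
  define \<A> where "\<A> = {R. subring R F \<and> K \<subseteq> R \<and> y \<in> R \<and> z \<notin> R}"
  let ?R0 = "\<Union>l. evs K y l"
  have "?R0 \<in> \<A>"
    unfolding \<A>_def
  proof (intro CollectI conjI)
    show "subring ?R0 F" by (rule subring_evs[OF y(1) K_subring])
    show "K \<subseteq> ?R0" using K_PL[OF y(1)] by blast
    show "y \<in> ?R0" using x_PL[OF y(1)] by blast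
    show "z \<notin> ?R0"
    proof
      assume "z \<in> ?R0"
      then obtain l where "z \<in> evs K y l" by blast
      then obtain cs where cs: "set cs \<subseteq> K" "z = ev y cs" by (metis evs_E)
      have "ev y ((\<ominus> \<one>) # cs) = \<ominus> \<one> \<oplus> y \<otimes> z" using cs by simp
      then have "ev y ((\<ominus> \<one>) # cs) = \<zero>" using y(4) by (simp add: l_neg)
      then have "\<ominus> \<one> = \<zero>" using ev_K_eq_zero[OF y(1,3), of "(\<ominus> \<one>) # cs"] cs(1) by auto
      then show False using one_not_zero by (metis minus_minus minus_zero one_closed)
    qed
  qed
  then have "\<A> \<noteq> {}" by blast
  moreover have "\<Union>\<C> \<in> \<A>" if ne: "\<C> \<noteq> {}" and ch: "subset.chain \<A> \<C>" for \<C>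
  proof -
    have sub: "\<And>R. R \<in> \<C> \<Longrightarrow> R \<in> \<A>" and lin: "\<And>R S. R \<in> \<C> \<Longrightarrow> S \<in> \<C> \<Longrightarrow> R \<subseteq> S \<or> S \<subseteq> R"
      using ch by (auto simp: subset_chain_def)
    have sr: "subring R F" if "R \<in> \<C>" for R using sub[OF that] by (simp add: \<A>_def)
    have pair: "\<exists>R\<in>\<C>. a \<in> R \<and> b \<in> R" if "a \<in> \<Union>\<C>" "b \<in> \<Union>\<C>" for a b
      using that lin by blast
    have "subring (\<Union>\<C>) F"
    proof (rule subringI)
      show "\<Union>\<C> \<subseteq> carrier F" using subringE(1)[OF sr] by blast
      show "\<one> \<in> \<Union>\<C>" using ne subringE(3)[OF sr] by blast
      show "\<ominus> h \<in> \<Union>\<C>" if "h \<in> \<Union>\<C>" for h using that subringE(5)[OF sr] by blast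
      show "a \<otimes> b \<in> \<Union>\<C>" if "a \<in> \<Union>\<C>" "b \<in> \<Union>\<C>" for a b
        using pair[OF that] subringE(6)[OF sr] by blast
      show "a \<oplus> b \<in> \<Union>\<C>" if "a \<in> \<Union>\<C>" "b \<in> \<Union>\<C>" for a b
        using pair[OF that] subringE(7)[OF sr] by blast
    qed
    then show ?thesis using ne sub unfolding \<A>_def by blast
  qed
  ultimately obtain V where V: "V \<in> \<A>" and max: "\<And>R. R \<in> \<A> \<Longrightarrow> V \<subseteq> R \<Longrightarrow> R = V"
    using subset_Zorn_nonempty[of \<A>] by blast
  have V': "subring V F" "K \<subseteq> V" "y \<in> V" "z \<notin> V" using V by (auto simp: \<A>_def)
  note VE = subringE[OF V'(1)]
  \<comment> \<open>That \<open>z = 1/y\<close> is missing from \<open>V\<close> means exactly that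
    the ideal \<open>yV\<close> is proper.\<close>
  define I where "I = (\<lambda>r. y \<otimes> r) ` V"
  have Vc: "v \<in> V \<Longrightarrow> v \<in> carrier F" for v using VE(1) by blast
  have I: "I \<subseteq> V" "\<zero> \<in> I" "\<one> \<notin> I"
    "\<And>a b. a \<in> I \<Longrightarrow> b \<in> I \<Longrightarrow> a \<oplus> b \<in> I" "\<And>r a. r \<in> V \<Longrightarrow> a \<in> I \<Longrightarrow> r \<otimes> a \<in> I"
  proof -
    show "I \<subseteq> V" using VE(6) V'(3) by (auto simp: I_def)
    show "\<zero> \<in> I" unfolding I_def using VE(2) y by (intro image_eqI[of _ _ \<zero>]) auto
    show "\<one> \<notin> I"
    proof
      assume "\<one> \<in> I"
      then obtain r where r: "r \<in> V" "\<one> = y \<otimes> r" by (auto simp: I_def)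
      have "y \<otimes> r = y \<otimes> z" using r y by simp
      then have "r = z" using m_lcancel[OF y(2,1)] Vc[OF r(1)] z by simp
      then show False using r V' by simp
    qed
    show "a \<oplus> b \<in> I" if ab: "a \<in> I" "b \<in> I" for a b
    proof -
      obtain r s where rs: "r \<in> V" "s \<in> V" "a = y \<otimes> r" "b = y \<otimes> s" using ab by (auto simp: I_def)
      have "a \<oplus> b = y \<otimes> (r \<oplus> s)" unfolding rs(3,4) using Vc rs(1,2) y(1) by (simp add: r_distr)
      then show ?thesis unfolding I_def using VE(7) rs by blast
    qed
    show "r \<otimes> a \<in> I" if r: "r \<in> V" and a: "a \<in> I" for r a
    proof -
      obtain s where s: "s \<in> V" "a = y \<otimes> s" using a by (auto simp: I_def)
      have "r \<otimes> a = y \<otimes> (r \<otimes> s)" unfolding s(2) using Vc s(1) r y(1) by (simp add: m_lcomm)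
      then show ?thesis unfolding I_def using VE(6) r s by blast
    qed
  qed
  have rel: "\<exists>l. \<one> \<in> evs I w l" if w: "w \<in> carrier F" "w \<notin> V" for w
  proof -
    let ?R = "\<Union>l. evs V w l"
    have VR: "V \<subseteq> ?R" using coeff_evs[OF w(1) VE(1,2)] by blast
    have wR: "w \<in> ?R" using x_evs[OF w(1) VE(1,2,3)] by blast
    have "z \<in> ?R"
    proof (rule ccontr)
      assume "z \<notin> ?R"
      then have "?R \<in> \<A>" using subring_evs[OF w(1) V'(1)] VR V' by (auto simp: \<A>_def)
      then have "?R = V" using max VR by blast
      then show False using wR w by blast
    qed
    then obtain l where l: "z \<in> evs V w l" by blast
    have "y \<otimes> z \<in> evs I w l" by (rule evs_smult[OF w(1) VE(1,2) y(1) _ l]) (simp add: I_def)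
    then show ?thesis using y(4) by auto
  qed
  have total: "w \<in> V \<or> inv w \<in> V" if w: "w \<in> carrier F" "w \<noteq> \<zero>" for w
  proof (rule ccontr)
    assume no: "\<not> ?thesis"
    have iw: "inv w \<in> carrier F" "inv w \<noteq> \<zero>" using w by auto
    obtain l l' where l: "\<one> \<in> evs I w l" "\<one> \<in> evs I (inv w) l'" using rel no w iw by blast
    \<comment> \<open>Both relations are taken of least length. Whichever is at least as long as the
      other can be shortened, and exchanging \<open>w\<close> with \<open>1/w\<close> covers both
      cases.\<close>
    define n where "n = (LEAST l. \<one> \<in> evs I w l)"
    define m where "m = (LEAST l. \<one> \<in> evs I (inv w) l)"
    have nm: "\<one> \<in> evs I w n" "\<one> \<in> evs I (inv w) m"
      unfolding n_def m_def using l by (auto intro: LeastI)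
    have least: "l < n \<Longrightarrow> \<one> \<notin> evs I w l" "l < m \<Longrightarrow> \<one> \<notin> evs I (inv w) l" for l
      unfolding n_def m_def by (auto dest: not_less_Least)
    show False
    proof (cases "m \<le> n")
      case True
      then show False using shorten_relation[OF V'(1) I w nm True] least(1)[of "n - 1"] by auto
    next
      case False
      then have le: "n \<le> m" by simp
      have "\<one> \<in> evs I (inv (inv w)) n" using nm(1) w by simp
      from shorten_relation[OF V'(1) I iw nm(2) this le] show False using least(2)[of "m - 1"] by auto
    qed
  qed
  have vr: "is_valuation_ring F K V"
    unfolding is_valuation_ring_def using V' y(3) z(1) VE(1) total by blast
  let ?P = "nonunits V"
  have P: "?P \<in> Places" "VR ?P = V" using nonunits_place[OF vr] by auto
  have "ord ?P z < 0" using ord_nonneg_iff[OF P(1) z(1) nz] P(2) V'(4) by simp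
  then show ?thesis using P by blast
qed


section \<open>Weak approximation\<close>

lemma ord_one: "P \<in> Places \<Longrightarrow> ord P \<one> = 0"
  using ord_K[of P \<one>] by simp

lemma ord_pow:
  assumes "P \<in> Places" "z \<in> carrier F" "z \<noteq> \<zero>"
  shows "ord P (z [^] (n::nat)) = int n * ord P z"
proof (induction n)
  case 0
  then show ?case using ord_one assms by simp
next
  case (Suc n)
  have "ord P (z [^] Suc n) = ord P (z [^] n) + ord P z"
    using ord_mult[OF assms(1), of "z [^] n" z] assms nat_pow_nonzero by simp
  then show ?case using Suc by (simp add: algebra_simps)
qed

lemma ord_add_strict:
  assumes P: "P \<in> Places" and z: "z \<in> carrier F" "z \<noteq> \<zero>" and w: "w \<in> carrier F" "w \<in> vpow P (ord P z + 1)"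
  shows "z \<oplus> w \<noteq> \<zero> \<and> ord P (z \<oplus> w) = ord P z"
proof -
  have n: "z \<oplus> w \<notin> vpow P (ord P z + 1)"
  proof
    assume A: "z \<oplus> w \<in> vpow P (ord P z + 1)"
    have "(z \<oplus> w) \<ominus> w = z" using z(1) w(1) by algebra
    then have "z \<in> vpow P (ord P z + 1)" using vpow_minus[OF P A w(2)] by simp
    then show False using z by (simp add: vpow_def)
  qed
  then have "z \<oplus> w \<noteq> \<zero>" using zero_vpow by metis
  moreover have "z \<oplus> w \<in> vpow P (ord P z)"
    using vpow_add[OF P, of z "ord P z" w] z w vpow_mono[of "ord P z" "ord P z + 1" P] by (auto simp: vpow_def)
  ultimately show ?thesis using n z w by (auto simp: vpow_def)
qed

text \<open>Discreteness excludes proper inclusions: if some \<open>z\<close> in \<open>VR Q\<close>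
  has a pole at \<open>P\<close>, a power of it matches any given pole at \<open>P\<close>, and then
  every element of \<open>F\<close> lies in \<open>VR Q\<close>.\<close>

lemma place_eqI:
  assumes P: "P \<in> Places" and Q: "Q \<in> Places" and sub: "VR P \<subseteq> VR Q"
  shows "P = Q"
proof -
  have "VR Q \<subseteq> VR P"
  proof (rule ccontr)
    assume "\<not> VR Q \<subseteq> VR P"
    then obtain z where z: "z \<in> VR Q" "z \<notin> VR P" by blast
    have zc: "z \<in> carrier F" "z \<noteq> \<zero>" using z VR_closed(1)[OF Q] VR_closed(2)[OF P] by auto
    have oz: "ord P z \<le> -1" using ord_nonneg_iff[OF P zc] z by simp
    have "y \<in> VR Q" if y: "y \<in> carrier F" for y
    proof (cases "y = \<zero>")
      case True
      then show ?thesis using VR_closed(2)[OF Q] by simp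
    next
      case False
      let ?k = "nat (- ord P y)" 
      let ?i = "inv (z [^] ?k)"
      have zk: "z [^] ?k \<in> carrier F" "z [^] ?k \<noteq> \<zero>" using zc nat_pow_nonzero by auto
      have i: "?i \<in> carrier F" "?i \<noteq> \<zero>" using zk by auto
      have "ord P (y \<otimes> ?i) = ord P y - int ?k * ord P z"
        using ord_mult[OF P y False i] ord_inv[OF P zk] ord_pow[OF P zc] by simp
      moreover have "int ?k * ord P z \<le> - int ?k" using oz mult_left_mono[of "ord P z" "-1" "int ?k"] by simp
      ultimately have "0 \<le> ord P (y \<otimes> ?i)" by linarith
      then have "y \<otimes> ?i \<in> VR P"
        using ord_nonneg_iff[OF P, of "y \<otimes> ?i"] y False i mult_nz by simp
      then have a: "y \<otimes> ?i \<in> VR Q" using sub by blast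
      have b: "z [^] n \<in> VR Q" for n :: nat using z(1) VR_closed(3,6)[OF Q] by (induction n) auto
      have "(y \<otimes> ?i) \<otimes> z [^] ?k = y \<otimes> (?i \<otimes> z [^] ?k)" using y i zk by (simp add: m_assoc)
      then have "(y \<otimes> ?i) \<otimes> z [^] ?k = y" using y zk by simp
      then show ?thesis using VR_closed(6)[OF Q a b] by metis
    qed
    then show False using VR_props(3,4)[OF Q] by blast
  qed
  then have "VR P = VR Q" using sub by blast
  then show ?thesis using place_ring_props(2)[OF P] place_ring_props(2)[OF Q] by simp
qed

lemma separate_two_places:
  assumes P: "P \<in> Places" and Q: "Q \<in> Places" and "P \<noteq> Q"
  shows "\<exists>u\<in>carrier F. u \<noteq> \<zero> \<and> 0 < ord P u \<and> ord Q u < 0"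
proof -
  have ex: "\<exists>z\<in>carrier F. z \<noteq> \<zero> \<and> 0 \<le> ord P z \<and> ord Q z < 0"
    if P: "P \<in> Places" and Q: "Q \<in> Places" and ne: "P \<noteq> Q" for P Q
  proof -
    obtain z where z: "z \<in> VR P" "z \<notin> VR Q" using place_eqI[OF P Q] ne by blast
    have zc: "z \<in> carrier F" "z \<noteq> \<zero>" using z VR_closed(1)[OF P] VR_closed(2)[OF Q] by auto
    then show ?thesis using ord_nonneg_iff[OF P zc] ord_nonneg_iff[OF Q zc] z by auto
  qed
  obtain y where y: "y \<in> carrier F" "y \<noteq> \<zero>" "0 \<le> ord P y" "ord Q y < 0" using ex[OF P Q assms(3)] by blast
  obtain z where z: "z \<in> carrier F" "z \<noteq> \<zero>" "0 \<le> ord Q z" "ord P z < 0" using ex[OF Q P] assms(3) by blast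
  have i: "inv z \<in> carrier F" "inv z \<noteq> \<zero>" using z by auto
  have "ord R (y \<otimes> inv z) = ord R y - ord R z" if "R \<in> Places" for R
    using ord_mult[OF that y(1,2) i] ord_inv[OF that z(1,2)] by simp
  then have "0 < ord P (y \<otimes> inv z)" "ord Q (y \<otimes> inv z) < 0" using P Q y z by auto
  moreover have "y \<otimes> inv z \<noteq> \<zero>" "y \<otimes> inv z \<in> carrier F" using mult_nz y i by auto
  ultimately show ?thesis by blast
qed

text \<open>A new place \<open>R\<close> where \<open>y\<close> fails is treated by
  \<open>y + z^k\<close>, with \<open>z\<close> separating \<open>P\<close> from \<open>R\<close>.
  At poles of \<open>z\<close> the power dominates; at the other places of \<open>T\<close> the pole
  of \<open>y\<close> does.\<close>

lemma separate_places:
  assumes P: "P \<in> Places" and T: "finite T" "T \<subseteq> Places" "P \<notin> T"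
  shows "\<exists>u\<in>carrier F. u \<noteq> \<zero> \<and> 0 < ord P u \<and> (\<forall>Q\<in>T. ord Q u < 0)"
  using T
proof (induction rule: finite_induct)
  case empty
  obtain z where "z \<in> carrier F" "z \<noteq> \<zero>" "ord P z = 1" using exists_ord[OF P] by blast
  then show ?case by force
next
  case (insert R T)
  then obtain y where y: "y \<in> carrier F" "y \<noteq> \<zero>" "0 < ord P y" "\<And>Q. Q \<in> T \<Longrightarrow> ord Q y < 0" by auto
  have R: "R \<in> Places" "P \<noteq> R" and TP: "T \<subseteq> Places" using insert by auto
  show ?case
  proof (cases "ord R y < 0")
    case True
    then show ?thesis using y by (intro bexI[of _ y]) auto
  next
    case False
    obtain z where z: "z \<in> carrier F" "z \<noteq> \<zero>" "0 < ord P z" "ord R z < 0"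
      using separate_two_places[OF P R] by blast
    \<comment> \<open>Larger than every \<open>\<bar>ord Q y\<bar>\<close> on \<open>T\<close>, so
      that at a pole of \<open>z\<close> the order of \<open>z^k\<close> lies strictly below that of
      \<open>y\<close> and nothing cancels.\<close>
    define k where "k = Suc (nat (\<Sum>Q\<in>T. \<bar>ord Q y\<bar>))"
    have k: "\<bar>ord Q y\<bar> < int k" if "Q \<in> T" for Q
    proof -
      have "\<bar>ord Q y\<bar> \<le> (\<Sum>Q\<in>T. \<bar>ord Q y\<bar>)" by (rule member_le_sum) (use that insert in auto)
      then show ?thesis unfolding k_def by linarith
    qed
    have kpos: "0 < int k" unfolding k_def by (simp only: of_nat_0_less_iff zero_less_Suc)
    have zk: "z [^] k \<in> carrier F" "z [^] k \<noteq> \<zero>" using z nat_pow_nonzero by auto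
    let ?u = "y \<oplus> z [^] k"
    have o: "ord Q (z [^] k) = int k * ord Q z" if "Q \<in> Places" for Q using ord_pow[OF that z(1,2)] .
    have lt: "y \<oplus> w \<noteq> \<zero> \<and> ord Q (y \<oplus> w) = ord Q y"
      if "Q \<in> Places" "y \<in> carrier F" "y \<noteq> \<zero>" "w \<in> carrier F" "ord Q y < ord Q w" for Q y w
      by (rule ord_add_strict[OF that(1,2,3,4)]) (use that(4,5) in \<open>simp add: vpow_def\<close>)
    have uR: "?u \<noteq> \<zero> \<and> ord R ?u < 0"
    proof -
      have "ord R (z [^] k) < 0" using o[OF R(1)] z(4) kpos by (simp add: mult_pos_neg)
      then have "ord R (z [^] k) < ord R y" using False by simp
      from lt[OF R(1) zk y(1) this] show ?thesis using \<open>ord R (z [^] k) < 0\<close> a_comm[OF y(1) zk(1)] by simp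
    qed
    have uP: "0 < ord P ?u"
    proof -
      have "0 < ord P (z [^] k)" using o[OF P] z(3) kpos by simp
      then show ?thesis using ord_add[OF P y(1,2) zk] uR y(3) by auto
    qed
    have uQ: "ord Q ?u < 0" if Q: "Q \<in> T" for Q
    proof -
      have QP: "Q \<in> Places" using Q TP by blast
      have yQ: "ord Q y < 0" using y(4) Q by blast
      show ?thesis
      proof (cases "0 \<le> ord Q z")
        case True
        then have "ord Q y < ord Q (z [^] k)" using o[OF QP] yQ by (simp add: order_less_le_trans)
        then show ?thesis using lt[OF QP y(1,2) zk(1)] yQ by simp
      next
        case False
        then have "ord Q (z [^] k) \<le> - int k" using o[OF QP] mult_left_mono[of "ord Q z" "-1" "int k"] by simp
        then have "ord Q (z [^] k) < ord Q y" using k[OF Q] by linarith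
        from lt[OF QP zk y(1) this] show ?thesis using yQ a_comm[OF y(1) zk(1)] \<open>ord Q (z [^] k) < ord Q y\<close> by simp
      qed
    qed
    have "?u \<in> carrier F" using y(1) zk(1) by simp
    moreover have "\<forall>Q\<in>insert R T. ord Q ?u < 0" using uR uQ by simp
    ultimately show ?thesis using uR uP by blast
  qed
qed

text \<open>\<open>1/(1 + u^k)\<close> is close to 1 where \<open>u\<close> has a zero and close to
  0 where \<open>u\<close> has a pole.\<close>

lemma approximate_one:
  assumes P: "P \<in> Places" and T: "finite T" "T \<subseteq> Places" "P \<notin> T"
  shows "\<exists>w\<in>carrier F. w \<ominus> \<one> \<in> vpow P N \<and> (\<forall>Q\<in>T. w \<in> vpow Q N)"
proof -
  obtain u where u: "u \<in> carrier F" "u \<noteq> \<zero>" "0 < ord P u" "\<And>Q. Q \<in> T \<Longrightarrow> ord Q u < 0"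
    using separate_places[OF assms] by blast
  define k where "k = Suc (nat N)"
  have k: "N \<le> int k" "1 \<le> int k" unfolding k_def by auto
  have uk: "u [^] k \<in> carrier F" "u [^] k \<noteq> \<zero>" using u nat_pow_nonzero by auto
  let ?v = "\<one> \<oplus> u [^] k"
  have oP: "int k \<le> ord P (u [^] k)" 
    using ord_pow[OF P u(1,2)] u(3) mult_left_mono[of 1 "ord P u" "int k"] by simp
  have "u [^] k \<in> vpow P (ord P \<one> + 1)" using oP k uk ord_one[OF P] by (simp add: vpow_def)
  then have v: "?v \<noteq> \<zero>" "ord P ?v = 0" using ord_add_strict[OF P one_closed one_not_zero uk(1)] ord_one[OF P] by auto
  have vc: "?v \<in> carrier F" using uk by simp
  define w where "w = inv ?v"
  have w: "w \<in> carrier F" "w \<noteq> \<zero>" "?v \<otimes> w = \<one>" using v vc by (auto simp: w_def)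
  have ow: "ord Q w = - ord Q ?v" if "Q \<in> Places" for Q using ord_inv[OF that vc v(1)] by (simp add: w_def)
  have "w \<ominus> \<one> = w \<ominus> ?v \<otimes> w" using w by simp
  also have "\<dots> = \<ominus> (u [^] k \<otimes> w)" using w(1) uk(1) by algebra
  finally have e: "w \<ominus> \<one> = \<ominus> (u [^] k \<otimes> w)" .
  have "u [^] k \<otimes> w \<in> vpow P N"
    using ord_mult[OF P uk w(1,2)] ow[OF P] v(2) oP k uk w by (simp add: vpow_def)
  then have "w \<ominus> \<one> \<in> vpow P N" unfolding e by (rule vpow_neg[OF P])
  moreover have "w \<in> vpow Q N" if Q: "Q \<in> T" for Q
  proof -
    have QP: "Q \<in> Places" using Q T by blast
    have le: "ord Q (u [^] k) \<le> - int k"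
      using ord_pow[OF QP u(1,2)] u(4)[OF Q] mult_left_mono[of "ord Q u" "-1" "int k"] by simp
    then have "\<one> \<in> vpow Q (ord Q (u [^] k) + 1)" using k ord_one[OF QP] by (simp add: vpow_def)
    then have "ord Q (u [^] k \<oplus> \<one>) = ord Q (u [^] k)" using ord_add_strict[OF QP uk one_closed] by blast
    then have "ord Q ?v \<le> - int k" using le a_comm[OF one_closed uk(1)] by simp
    then show ?thesis using ow[OF QP] k w by (simp add: vpow_def)
  qed
  ultimately show ?thesis using w(1) by blast
qed

lemma weak_approximation:
  assumes T: "finite T" "T \<subseteq> Places" and a: "\<And>Q. Q \<in> T \<Longrightarrow> a Q \<in> carrier F"
  shows "\<exists>x\<in>carrier F. \<forall>Q\<in>T. x \<ominus> a Q \<in> vpow Q N"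
proof -
  have "U \<subseteq> T \<Longrightarrow> \<exists>x\<in>carrier F. (\<forall>Q\<in>U. x \<ominus> a Q \<in> vpow Q N) \<and> (\<forall>Q\<in>T - U. x \<in> vpow Q N)"
    if "finite U" for U
    using that
  proof (induction rule: finite_induct)
    case empty
    show ?case using zero_vpow by (intro bexI[of _ \<zero>]) auto
  next
    case (insert P U)
    then obtain x where x: "x \<in> carrier F" "\<And>Q. Q \<in> U \<Longrightarrow> x \<ominus> a Q \<in> vpow Q N"
      "\<And>Q. Q \<in> T - U \<Longrightarrow> x \<in> vpow Q N" by auto
    have P: "P \<in> Places" "P \<in> T" using insert T by auto
    have aP: "a P \<in> carrier F" using a P by blast
    \<comment> \<open>Extra precision that compensates the poles of \<open>a P\<close> at the places
      of \<open>T\<close>.\<close>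
    define B where "B = (\<Sum>Q\<in>T. \<bar>ord Q (a P)\<bar>)"
    have B: "a P \<in> vpow Q (- B)" if "Q \<in> T" for Q
    proof -
      have "\<bar>ord Q (a P)\<bar> \<le> B" unfolding B_def by (rule member_le_sum) (use that T in auto)
      then show ?thesis using aP by (auto simp: vpow_def)
    qed
    obtain w where w: "w \<in> carrier F" "w \<ominus> \<one> \<in> vpow P (N + B)" "\<And>Q. Q \<in> T - {P} \<Longrightarrow> w \<in> vpow Q (N + B)"
      using approximate_one[OF P(1), where T = "T - {P}" and N = "N + B"] T by blast
    let ?y = "x \<oplus> a P \<otimes> w"
    have yP: "?y \<ominus> a P \<in> vpow P N"
    proof -
      have "?y \<ominus> a P = x \<oplus> a P \<otimes> (w \<ominus> \<one>)" using x(1) aP w(1) by algebra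
      moreover have "a P \<otimes> (w \<ominus> \<one>) \<in> vpow P N" using vpow_mult[OF P(1) B[OF P(2)] w(2)] by simp
      moreover have "x \<in> vpow P N" using x(3) P insert by blast
      ultimately show ?thesis using vpow_add[OF P(1)] by simp
    qed
    have aw: "a P \<otimes> w \<in> vpow Q N" if Q: "Q \<in> T - {P}" for Q
    proof -
      have "Q \<in> T" "Q \<in> Places" using Q T by auto
      then show ?thesis using vpow_mult[OF _ B w(3)[OF Q]] by simp
    qed
    have yQ: "?y \<ominus> a Q \<in> vpow Q N" if Q: "Q \<in> U" for Q
    proof -
      have QT: "Q \<in> T - {P}" "Q \<in> Places" "a Q \<in> carrier F" using Q insert T a by auto
      have "?y \<ominus> a Q = (x \<ominus> a Q) \<oplus> a P \<otimes> w" using x(1) aP w(1) QT(3) by algebra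
      then show ?thesis using vpow_add[OF QT(2) x(2)[OF Q] aw[OF QT(1)]] by simp
    qed
    have yR: "?y \<in> vpow Q N" if Q: "Q \<in> T - insert P U" for Q
    proof -
      have "Q \<in> T - U" "Q \<in> T - {P}" "Q \<in> Places" using Q T by auto
      then show ?thesis using vpow_add x(3) aw by blast
    qed
    have "?y \<in> carrier F" using x(1) aP w(1) by simp
    then show ?case using yP yQ yR by (intro bexI[of _ ?y]) simp_all
  qed
  from this[of T] show ?thesis using T by auto
qed

section \<open>Zeros and poles\<close>

text \<open>In the semilocal ring of functions regular on \<open>T\<close>, weak approximation
  realises every tuple of residues modulo \<open>Q^(ord Q x)\<close>. Different tuples are
  incongruent modulo \<open>x\<close>, and \<open>A/xA\<close> has at most
  \<open>q ^ xrank x\<close> elements.\<close>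

lemma sum_zeros_le:
  assumes x: "x \<in> carrier F" "x \<noteq> \<zero>" and T: "finite T" "T \<subseteq> Places" "\<And>Q. Q \<in> T \<Longrightarrow> 0 < ord Q x"
  shows "(\<Sum>Q\<in>T. nat (ord Q x) * place_deg F K Q) \<le> xrank x"
proof (cases "T = {}")
  case False
  define A where "A = (\<Inter>Q\<in>T. VR Q)"
  have A: "subring A F" "K \<subseteq> A" "x \<in> A"
  proof -
    show "subring A F" unfolding A_def using subring_Inter[of "VR ` T"] VR_props(1) T(2) False by auto
    show "K \<subseteq> A" unfolding A_def using VR_props(2) T(2) by blast
    show "x \<in> A" unfolding A_def
    proof
      fix Q assume Q: "Q \<in> T"
      then show "x \<in> VR Q" using ord_nonneg_iff[OF _ x, of Q] T(2) T(3)[OF Q] by auto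
    qed
  qed
  let ?e = "\<lambda>Q. nat (ord Q x)"
  have "\<exists>t. \<forall>Q\<in>T. transversal (t Q) (vpow Q 0) (vpow Q (0 + int (?e Q))) \<and> card (t Q) = q ^ (?e Q * place_deg F K Q)"
    using vpow_transversal[of _ 0] T(2) by (intro bchoice) blast
  then obtain t where t: "\<And>Q. Q \<in> T \<Longrightarrow> transversal (t Q) (VR Q) (vpow Q (ord Q x))"
    "\<And>Q. Q \<in> T \<Longrightarrow> card (t Q) = q ^ (?e Q * place_deg F K Q)"
    using vpow_0 T(2,3) by (force simp: less_imp_le)
  have tf: "finite (t Q)" "t Q \<subseteq> VR Q" if "Q \<in> T" for Q using t(1)[OF that] by (auto simp: transversal_def)
  \<comment> \<open>\<open>weak_approximation\<close> takes one precision for all places; the sum of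
    the orders suffices everywhere.\<close>
  define N where "N = (\<Sum>Q\<in>T. ord Q x)"
  have N: "ord Q x \<le> N" if "Q \<in> T" for Q
    unfolding N_def by (rule member_le_sum) (use that T in \<open>auto simp: less_imp_le\<close>)
  let ?G = "PiE T t"
  have "\<exists>y\<in>carrier F. \<forall>Q\<in>T. y \<ominus> g Q \<in> vpow Q N" if g: "g \<in> ?G" for g
  proof (rule weak_approximation[OF T(1,2)])
    fix Q assume Q: "Q \<in> T"
    then have "g Q \<in> VR Q" using g tf(2) by (blast dest: PiE_mem)
    then show "g Q \<in> carrier F" using VR_closed(1) Q T(2) by blast
  qed
  then obtain y where y: "\<And>g. g \<in> ?G \<Longrightarrow> y g \<in> carrier F" "\<And>g Q. g \<in> ?G \<Longrightarrow> Q \<in> T \<Longrightarrow> y g \<ominus> g Q \<in> vpow Q N"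
    by metis
  have y': "y g \<ominus> g Q \<in> vpow Q (ord Q x)" "y g \<in> VR Q" "g Q \<in> t Q" "Q \<in> Places" if "g \<in> ?G" "Q \<in> T" for g Q
  proof -
    show QP: "Q \<in> Places" using that T(2) by blast
    show a: "y g \<ominus> g Q \<in> vpow Q (ord Q x)" using y(2)[OF that] vpow_mono[OF N[OF that(2)]] by blast
    show gt: "g Q \<in> t Q" using that by (blast dest: PiE_mem)
    then have gV: "g Q \<in> vpow Q 0" using tf(2) that(2) vpow_0[OF QP] by blast
    have c: "y g \<in> carrier F" "g Q \<in> carrier F" using y(1)[OF that(1)] gV vpow_carrier by auto
    have "y g \<ominus> g Q \<in> vpow Q 0" using a vpow_mono[of 0 "ord Q x"] T(3)[OF that(2)] by auto
    moreover have "y g = (y g \<ominus> g Q) \<oplus> g Q" using c by algebra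
    ultimately show "y g \<in> VR Q" using vpow_add[OF QP _ gV] vpow_0[OF QP] by metis
  qed
  have key: "g = h" if g: "g \<in> ?G" and h: "h \<in> ?G" and c: "c \<in> A" and e: "y g \<ominus> y h = x \<otimes> c" for g h c
  proof (rule PiE_ext[OF g h])
    fix Q assume Q: "Q \<in> T"
    note gQ = y'[OF g Q] and hQ = y'[OF h Q]
    have "c \<in> vpow Q 0" using c Q vpow_0[OF gQ(4)] by (auto simp: A_def)
    moreover have "x \<in> vpow Q (ord Q x)" using x by (simp add: vpow_def)
    ultimately have d: "y g \<ominus> y h \<in> vpow Q (ord Q x)" using vpow_mult[OF gQ(4), of x "ord Q x" c 0] e by simp
    have cc: "y g \<in> carrier F" "y h \<in> carrier F" "h Q \<in> carrier F"
      using y(1) g h hQ(3) tf(2)[OF Q] VR_closed(1)[OF gQ(4)] by auto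
    have "(y g \<ominus> y h) \<oplus> (y h \<ominus> h Q) = y g \<ominus> h Q" using cc by algebra
    then have "y g \<ominus> h Q \<in> vpow Q (ord Q x)" using vpow_add[OF gQ(4) d hQ(1)] by simp
    then show "g Q = h Q" using transversal_uniq[OF t(1)[OF Q] gQ(2,3) hQ(3) gQ(1)] by blast
  qed
  have self: "z \<ominus> z = x \<otimes> \<zero>" if "z \<in> carrier F" for z using that x by (simp add: a_minus_def r_neg)
  have zA: "\<zero> \<in> A" using subringE(2)[OF A(1)] .
  have inj: "inj_on y ?G"
  proof (rule inj_onI)
    fix g h assume "g \<in> ?G" "h \<in> ?G" "y g = y h"
    then show "g = h" using key[OF _ _ zA] self y(1) by metis
  qed
  have "finite (y ` ?G) \<and> card (y ` ?G) \<le> q ^ xrank x"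
  proof (rule card_incongruent_le[OF A x(2)])
    show "y ` ?G \<subseteq> A" unfolding A_def using y'(2) by blast
    fix a b c assume "a \<in> y ` ?G" "b \<in> y ` ?G" "c \<in> A" "a \<ominus> b = x \<otimes> c"
    then show "a = b" using key by blast
  qed
  then have "card ?G \<le> q ^ xrank x" using card_image[OF inj] by simp
  also have "card ?G = (\<Prod>Q\<in>T. q ^ (?e Q * place_deg F K Q))" 
    by (subst card_PiE[OF T(1)]) (intro prod.cong refl t(2))
  finally have "q ^ (\<Sum>Q\<in>T. ?e Q * place_deg F K Q) \<le> q ^ xrank x" by (simp add: power_sum)
  then show ?thesis by (rule power_le_imp_le_exp[rotated]) (use q_ge_2 in simp)
qed simp

lemma finite_zeros:
  assumes x: "x \<in> carrier F" "x \<noteq> \<zero>"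
  shows "finite {Q \<in> Places. 0 < ord Q x}"
proof (rule ccontr)
  assume "infinite {Q \<in> Places. 0 < ord Q x}"
  then obtain T where T: "T \<subseteq> {Q \<in> Places. 0 < ord Q x}" "finite T" "card T = Suc (xrank x)"
    using infinite_arbitrarily_large[of "{Q \<in> Places. 0 < ord Q x}" "Suc (xrank x)"] by blast
  have "card T = (\<Sum>Q\<in>T. 1 * 1)" by simp
  also have "\<dots> \<le> (\<Sum>Q\<in>T. nat (ord Q x) * place_deg F K Q)"
  proof (intro sum_mono mult_le_mono)
    fix Q assume "Q \<in> T"
    then have "Q \<in> Places" "0 < ord Q x" using T(1) by auto
    then show "1 \<le> nat (ord Q x)" "1 \<le> place_deg F K Q" using place_deg_pos by auto
  qed
  also have "\<dots> \<le> xrank x" using T by (intro sum_zeros_le[OF x]) auto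
  finally show False using T by simp
qed

lemma finite_ord_support:
  assumes x: "x \<in> carrier F" "x \<noteq> \<zero>"
  shows "finite {Q \<in> Places. ord Q x \<noteq> 0}"
proof -
  have "{Q \<in> Places. ord Q x \<noteq> 0} \<subseteq> {Q \<in> Places. 0 < ord Q x} \<union> {Q \<in> Places. 0 < ord Q (inv x)}"
    using ord_inv[OF _ x] by auto
  then show ?thesis using finite_zeros[OF x] finite_zeros[OF inv_closed[OF x] inv_nz[OF x]]
    by (rule finite_subset[OF _ finite_UnI])
qed


section \<open>Divisors and Riemann--Roch spaces\<close>

text \<open>Divisors are treated as integer-valued functions; only their values on places matter.\<close>

definition fsupp :: "('a set \<Rightarrow> int) \<Rightarrow> bool" where
  "fsupp A \<longleftrightarrow> finite {P \<in> Places. A P \<noteq> 0}"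

definition ddeg :: "('a set \<Rightarrow> int) \<Rightarrow> int" where
  "ddeg A = (\<Sum>P\<in>{P \<in> Places. A P \<noteq> 0}. A P * int (place_deg F K P))"

lemma ddeg_eq:
  assumes "finite U" "U \<subseteq> Places" "\<And>P. P \<in> Places \<Longrightarrow> P \<notin> U \<Longrightarrow> A P = 0"
  shows "ddeg A = (\<Sum>P\<in>U. A P * int (place_deg F K P))"
  unfolding ddeg_def by (rule sum.mono_neutral_left) (use assms in auto)

lemma fsupp_zero [simp]: "fsupp (\<lambda>_. 0)" and ddeg_zero [simp]: "ddeg (\<lambda>_. 0) = 0"
  by (simp_all add: fsupp_def ddeg_def)

lemma fsupp_comb:
  assumes "fsupp A" "fsupp B" "f 0 0 = (0::int)" shows "fsupp (\<lambda>P. f (A P) (B P))"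
proof -
  have "{P \<in> Places. f (A P) (B P) \<noteq> 0} \<subseteq> {P \<in> Places. A P \<noteq> 0} \<union> {P \<in> Places. B P \<noteq> 0}"
    using assms(3) by auto
  then show ?thesis using assms(1,2) unfolding fsupp_def by (rule finite_subset[OF _ finite_UnI])
qed

lemma fsupp_add [intro]: "fsupp A \<Longrightarrow> fsupp B \<Longrightarrow> fsupp (\<lambda>P. A P + B P)"
  and fsupp_diff [intro]: "fsupp A \<Longrightarrow> fsupp B \<Longrightarrow> fsupp (\<lambda>P. A P - B P)"
  and fsupp_max [intro]: "fsupp A \<Longrightarrow> fsupp B \<Longrightarrow> fsupp (\<lambda>P. max (A P) (B P))"
  and fsupp_scale [intro]: "fsupp A \<Longrightarrow> fsupp (\<lambda>P. c * A P)"
  using fsupp_comb[of A B "(+)"] fsupp_comb[of A B "(-)"] fsupp_comb[of A B max]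
    fsupp_comb[of A A "\<lambda>x _. c * x"] by auto

lemma fsupp_single [intro]: "finite T \<Longrightarrow> fsupp (\<lambda>P. if P \<in> T then f P else 0)"
  unfolding fsupp_def by (rule finite_subset[of _ T]) auto

lemma fsupp_ord [intro]: "x \<in> carrier F \<Longrightarrow> x \<noteq> \<zero> \<Longrightarrow> fsupp (\<lambda>P. ord P x)"
  unfolding fsupp_def by (rule finite_ord_support)

lemma ddeg_add:
  assumes "fsupp A" "fsupp B"
  shows "ddeg (\<lambda>P. A P + B P) = ddeg A + ddeg B" "ddeg (\<lambda>P. A P - B P) = ddeg A - ddeg B"
proof -
  let ?U = "{P \<in> Places. A P \<noteq> 0} \<union> {P \<in> Places. B P \<noteq> 0}"
  have U: "finite ?U" "?U \<subseteq> Places" using assms by (auto simp: fsupp_def)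
  have e: "ddeg A = (\<Sum>P\<in>?U. A P * int (place_deg F K P))" "ddeg B = (\<Sum>P\<in>?U. B P * int (place_deg F K P))"
    "ddeg (\<lambda>P. A P + B P) = (\<Sum>P\<in>?U. (A P + B P) * int (place_deg F K P))"
    "ddeg (\<lambda>P. A P - B P) = (\<Sum>P\<in>?U. (A P - B P) * int (place_deg F K P))"
    by (rule ddeg_eq[OF U]; auto)+
  show "ddeg (\<lambda>P. A P + B P) = ddeg A + ddeg B" "ddeg (\<lambda>P. A P - B P) = ddeg A - ddeg B"
    unfolding e by (simp_all add: sum.distrib sum_subtractf algebra_simps)
qed

lemma ddeg_scale:
  assumes "fsupp A"
  shows "ddeg (\<lambda>P. c * A P) = c * ddeg A"
proof -
  let ?U = "{P \<in> Places. A P \<noteq> 0}"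
  have U: "finite ?U" "?U \<subseteq> Places" using assms by (auto simp: fsupp_def)
  have "ddeg (\<lambda>P. c * A P) = (\<Sum>P\<in>?U. (c * A P) * int (place_deg F K P))"
    by (rule ddeg_eq[OF U]) auto
  then show ?thesis unfolding ddeg_def[of A] by (simp add: sum_distrib_left mult.assoc)
qed

definition L :: "('a set \<Rightarrow> int) \<Rightarrow> 'a set" where
  "L A = {z \<in> carrier F. z = \<zero> \<or> (\<forall>P\<in>Places. - A P \<le> ord P z)}"

lemma L_iff: "z \<in> L A \<longleftrightarrow> z \<in> carrier F \<and> (\<forall>P\<in>Places. z \<in> vpow P (- A P))"
  unfolding L_def vpow_def by auto

lemma L_carrier: "L A \<subseteq> carrier F"
  by (auto simp: L_def)

lemma L_lin_sub: "lin_sub K (L A)"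
  unfolding lin_sub_def
proof (intro conjI ballI)
  show "\<zero> \<in> L A" by (simp add: L_def)
  show "u \<oplus> v \<in> L A" if "u \<in> L A" "v \<in> L A" for u v
    using that vpow_add by (auto simp: L_iff)
  show "k \<otimes> v \<in> L A" if "k \<in> K" "v \<in> L A" for k v
    using that lin_subD(4)[OF vpow_lin_sub] by (auto simp: L_iff)
qed (rule L_carrier)

lemma L_mono: "(\<And>P. P \<in> Places \<Longrightarrow> A P \<le> B P) \<Longrightarrow> L A \<subseteq> L B"
  unfolding L_def by force

lemma L_mult: "z \<in> L A \<Longrightarrow> w \<in> L B \<Longrightarrow> z \<otimes> w \<in> L (\<lambda>P. A P + B P)"
  using vpow_mult unfolding L_iff by fastforce

text \<open>The base case for both \<open>finite_L\<close> and the upper bounds on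
  \<open>ell\<close>: other spaces are compared with this one by counting residues.\<close>

lemma L_zero: "L (\<lambda>_. 0) = K"
proof
  show "L (\<lambda>_. 0) \<subseteq> K"
  proof
    fix z assume z: "z \<in> L (\<lambda>_. 0)"
    show "z \<in> K"
    proof (rule ccontr)
      assume n: "z \<notin> K"
      then have "z \<noteq> \<zero>" by auto
      then show False using z exists_pole[of z] n by (force simp: L_def)
    qed
  qed
  show "K \<subseteq> L (\<lambda>_. 0)" using ord_K by (auto simp: L_def)
qed

section \<open>Fibres of the reduction of \<open>L B\<close> modulo \<open>A\<close>\<close>

definition fib :: "('a set \<Rightarrow> int) \<Rightarrow> ('a set \<Rightarrow> int) \<Rightarrow> 'a set set \<Rightarrow> ('a set \<Rightarrow> 'a) \<Rightarrow> 'a set" where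
  "fib A B U g = {z \<in> L B. \<forall>Q\<in>U. z \<ominus> g Q \<in> vpow Q (- A Q)}"

context
  fixes A B :: "'a set \<Rightarrow> int" and U :: "'a set set" and t :: "'a set \<Rightarrow> 'a set"
  assumes U: "finite U" "U \<subseteq> Places"
    and le: "\<And>P. P \<in> Places \<Longrightarrow> A P \<le> B P" and eq: "\<And>P. P \<in> Places \<Longrightarrow> P \<notin> U \<Longrightarrow> A P = B P"
    and t: "\<And>Q. Q \<in> U \<Longrightarrow> transversal (t Q) (vpow Q (- B Q)) (vpow Q (- A Q))"
    and fin: "finite (L A)"
begin

text \<open>Subtracting one member of the fibre embeds the rest into \<open>L A\<close>: off
  \<open>U\<close> the divisors agree, and on \<open>U\<close> the common residue cancels.\<close>

lemma fib_le: 
  assumes g: "g \<in> PiE U t"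
  shows "finite (fib A B U g) \<and> card (fib A B U g) \<le> card (L A)"
proof (cases "fib A B U g = {}")
  case False
  then obtain z0 where z0: "z0 \<in> fib A B U g" by blast
  have c0: "z0 \<in> carrier F" using z0 L_carrier by (auto simp: fib_def)
  have gc: "g Q \<in> carrier F" if "Q \<in> U" for Q
    using PiE_mem[OF g that] t[OF that] vpow_carrier by (auto simp: transversal_def)
  have inj: "inj_on (\<lambda>z. z \<ominus> z0) (fib A B U g)"
  proof (rule inj_onI)
    fix a b assume A: "a \<in> fib A B U g" "b \<in> fib A B U g" "a \<ominus> z0 = b \<ominus> z0"
    have c: "a \<in> carrier F" "b \<in> carrier F" using A(1,2) L_carrier by (auto simp: fib_def)
    have "a = (a \<ominus> z0) \<oplus> z0" "b = (b \<ominus> z0) \<oplus> z0" using c c0 by algebra+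
    then show "a = b" using A(3) by simp
  qed
  have im: "(\<lambda>z. z \<ominus> z0) ` fib A B U g \<subseteq> L A"
  proof (rule image_subsetI)
    fix z assume z: "z \<in> fib A B U g"
    have c: "z \<in> carrier F" using z L_carrier by (auto simp: fib_def)
    have "z \<ominus> z0 \<in> vpow P (- A P)" if P: "P \<in> Places" for P
    proof (cases "P \<in> U")
      case True
      have "z \<ominus> z0 = (z \<ominus> g P) \<ominus> (z0 \<ominus> g P)" using c c0 gc[OF True] by algebra
      then show ?thesis using vpow_minus[OF P, of "z \<ominus> g P" "- A P" "z0 \<ominus> g P"] z z0 True
        by (auto simp: fib_def)
    next
      case False
      then show ?thesis using vpow_minus[OF P, of z "- A P" z0] z z0 P eq[OF P] by (auto simp: fib_def L_iff)
    qed
    then show "z \<ominus> z0 \<in> L A" using c c0 by (simp add: L_iff)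
  qed
  show ?thesis using card_inj_on_le[OF inj im fin] inj_on_finite[OF inj im fin] by blast
qed simp

lemma L_eq_Union_fib: "L B = (\<Union>g\<in>PiE U t. fib A B U g)"
proof
  show "L B \<subseteq> (\<Union>g\<in>PiE U t. fib A B U g)"
  proof
    fix z assume z: "z \<in> L B"
    have "\<exists>r. r \<in> t Q \<and> z \<ominus> r \<in> vpow Q (- A Q)" if "Q \<in> U" for Q
      using transversal_ex[OF t[OF that], of z] z that U by (auto simp: L_iff)
    then obtain r where r: "\<And>Q. Q \<in> U \<Longrightarrow> r Q \<in> t Q \<and> z \<ominus> r Q \<in> vpow Q (- A Q)" by metis
    then have "z \<in> fib A B U (restrict r U)" "restrict r U \<in> PiE U t" using z by (auto simp: fib_def)
    then show "z \<in> (\<Union>g\<in>PiE U t. fib A B U g)" by blast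
  qed
qed (auto simp: fib_def)

lemma finite_PiE_t: "finite (PiE U t)"
  using U t by (intro finite_PiE) (auto simp: transversal_def)

lemma fib_disjoint:
  assumes g: "g \<in> PiE U t" and h: "h \<in> PiE U t" and z: "z \<in> fib A B U g" "z \<in> fib A B U h"
  shows "g = h"
proof (rule PiE_ext[OF g h])
  fix Q assume Q: "Q \<in> U"
  have "z \<in> vpow Q (- B Q)" using z(1) Q U by (auto simp: fib_def L_iff)
  then show "g Q = h Q"
    using transversal_uniq[OF t[OF Q], of z "g Q" "h Q"] PiE_mem[OF g Q] PiE_mem[OF h Q] z Q
    by (auto simp: fib_def)
qed

lemma finite_L_larger: "finite (L B)"
  unfolding L_eq_Union_fib using fib_le finite_PiE_t by auto

lemma card_L_eq_sum: "card (L B) = (\<Sum>g\<in>PiE U t. card (fib A B U g))"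
  unfolding L_eq_Union_fib
  by (rule card_UN_disjoint[OF finite_PiE_t]) (use fib_le fib_disjoint in blast)+

lemma card_L_le: "card (L B) \<le> card (PiE U t) * card (L A)"
proof -
  have "card (L B) \<le> (\<Sum>g\<in>PiE U t. card (L A))"
    unfolding card_L_eq_sum by (rule sum_mono) (use fib_le in blast)
  then show ?thesis by simp
qed

text \<open>Since no fibre exceeds \<open>L A\<close>, a total of the largest possible size leaves
  no room for a deficient fibre. Surjectivity and equidistribution thus follow from dimensions
  alone.\<close>

lemma card_fib_eq:
  assumes "card (L B) = card (PiE U t) * card (L A)" "g \<in> PiE U t"
  shows "card (fib A B U g) = card (L A)"
proof (rule ccontr)
  assume "card (fib A B U g) \<noteq> card (L A)"
  then have "card (fib A B U g) < card (L A)" using fib_le[OF assms(2)] by simp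
  then have "(\<Sum>g\<in>PiE U t. card (fib A B U g)) < (\<Sum>g\<in>PiE U t. card (L A))"
    using fib_le assms(2) by (intro sum_strict_mono_ex1[OF finite_PiE_t]) auto
  then show False using assms(1) card_L_eq_sum by simp
qed

end

lemma exists_transversals:
  assumes "U \<subseteq> Places" "\<And>P. P \<in> Places \<Longrightarrow> A P \<le> B P"
  shows "\<exists>t. \<forall>Q\<in>U. transversal (t Q) (vpow Q (- B Q)) (vpow Q (- A Q)) \<and>
    card (t Q) = q ^ (nat (B Q - A Q) * place_deg F K Q)"
proof -
  have "\<exists>T. transversal T (vpow Q (- B Q)) (vpow Q (- A Q)) \<and> card T = q ^ (nat (B Q - A Q) * place_deg F K Q)"
    if Q: "Q \<in> U" for Q
  proof -
    have "Q \<in> Places" using Q assms(1) by blast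
    moreover from this have "- B Q + int (nat (B Q - A Q)) = - A Q" using assms(2) by auto
    ultimately show ?thesis using vpow_transversal[of Q "- B Q" "nat (B Q - A Q)"] by simp
  qed
  then show ?thesis by (intro bchoice) blast
qed

lemma sum_nat_ddeg:
  assumes U: "finite U" "U \<subseteq> Places" and le: "\<And>P. P \<in> Places \<Longrightarrow> A P \<le> B P"
    and eq: "\<And>P. P \<in> Places \<Longrightarrow> P \<notin> U \<Longrightarrow> A P = B P"
  shows "int (\<Sum>Q\<in>U. nat (B Q - A Q) * place_deg F K Q) = ddeg (\<lambda>P. B P - A P)"
  using assms by (auto simp: ddeg_eq[of U] intro!: sum.cong)

text \<open>The positive part of \<open>A\<close> gives a larger space, which is finite because it
  has finitely many fibres over \<open>L 0 = K\<close>.\<close>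

lemma finite_L:
  assumes A: "fsupp A"
  shows "finite (L A)"
proof -
  let ?B = "\<lambda>P. max (A P) 0"
  have B: "fsupp ?B" using fsupp_max[OF A fsupp_zero] by simp
  let ?U = "{P \<in> Places. ?B P \<noteq> 0}"
  have U: "finite ?U" "?U \<subseteq> Places" using B by (auto simp: fsupp_def)
  obtain t where t: "\<And>Q. Q \<in> ?U \<Longrightarrow> transversal (t Q) (vpow Q (- ?B Q)) (vpow Q (- 0))"
    using exists_transversals[OF U(2), of "\<lambda>_. 0" ?B] by auto
  have "finite (L ?B)"
    by (rule finite_L_larger[OF U, of "\<lambda>_. 0" _ t]) (use t L_zero finite_K in auto)
  then show ?thesis using L_mono[of A ?B] finite_subset by auto
qed

definition ell :: "('a set \<Rightarrow> int) \<Rightarrow> nat" where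
  "ell A = dim K (L A)"

lemma card_L: "fsupp A \<Longrightarrow> card (L A) = q ^ ell A"
  unfolding ell_def using card_lin_sub[OF K_subfield finite_K finite_L L_lin_sub] .

lemma power_q_le_iff: "q ^ m \<le> q ^ n \<longleftrightarrow> m \<le> n"
  using q_ge_2 by (intro power_increasing_iff) simp

lemma power_q_eq_iff: "q ^ m = q ^ n \<longleftrightarrow> m = n"
  using power_q_le_iff[of m n] power_q_le_iff[of n m] by (metis order_antisym order_refl)

lemma ell_zero: "ell (\<lambda>_. 0) = 1"
  using card_L[of "\<lambda>_. 0"] power_q_eq_iff[of 1 "ell (\<lambda>_. 0)"] by (simp add: L_zero)

lemma card_PiE_transversals:
  assumes "finite U" "\<And>Q. Q \<in> U \<Longrightarrow> card (t Q) = q ^ (e Q)"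
  shows "card (PiE U t) = q ^ (\<Sum>Q\<in>U. e Q)"
  using card_PiE[OF assms(1), of t] assms(2) by (simp add: power_sum)

text \<open>The number of residue tuples is \<open>q\<close> to the power
  \<open>deg B - deg A\<close>, and each fibre has at most \<open>card (L A)\<close>
  elements.\<close>

lemma ell_le:
  assumes A: "fsupp A" and B: "fsupp B" and le: "\<And>P. P \<in> Places \<Longrightarrow> A P \<le> B P"
  shows "int (ell B) \<le> int (ell A) + (ddeg B - ddeg A)"
proof -
  let ?U = "{P \<in> Places. B P - A P \<noteq> 0}"
  have U: "finite ?U" "?U \<subseteq> Places" using fsupp_diff[OF B A] by (auto simp: fsupp_def)
  have eq: "\<And>P. P \<in> Places \<Longrightarrow> P \<notin> ?U \<Longrightarrow> A P = B P" by auto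
  obtain t where t0: "\<forall>Q\<in>?U. transversal (t Q) (vpow Q (- B Q)) (vpow Q (- A Q)) \<and>
      card (t Q) = q ^ (nat (B Q - A Q) * place_deg F K Q)"
    using exists_transversals[OF U(2) le] by (rule exE)
  have t: "transversal (t Q) (vpow Q (- B Q)) (vpow Q (- A Q))"
    "card (t Q) = q ^ (nat (B Q - A Q) * place_deg F K Q)" if "Q \<in> ?U" for Q
    using bspec[OF t0 that] by (rule conjunct1, rule conjunct2)
  let ?n = "\<Sum>Q\<in>?U. nat (B Q - A Q) * place_deg F K Q"
  have "card (L B) \<le> card (PiE ?U t) * card (L A)"
    by (rule card_L_le[OF U le eq t(1) finite_L[OF A]])
  also have "card (PiE ?U t) = q ^ ?n" by (rule card_PiE_transversals[OF U(1) t(2)])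
  finally have "ell B \<le> ?n + ell A" using A B by (simp add: card_L power_q_le_iff flip: power_add)
  moreover have "int ?n = ddeg B - ddeg A"
    using sum_nat_ddeg[OF U le eq] ddeg_add(2)[OF B A] by simp
  ultimately show ?thesis by linarith
qed

section \<open>Principal divisors\<close>

definition poles :: "'a \<Rightarrow> 'a set \<Rightarrow> int" where
  "poles x P = max 0 (- ord P x)"

lemma fsupp_poles: "x \<in> carrier F \<Longrightarrow> x \<noteq> \<zero> \<Longrightarrow> fsupp (poles x)"
  unfolding poles_def by (rule fsupp_comb[OF fsupp_ord fsupp_ord, of x x "\<lambda>a _. max 0 (- a)"]) auto

lemma ddeg_poles_le:
  assumes x: "x \<in> carrier F" "x \<noteq> \<zero>"
  shows "ddeg (poles x) \<le> int (xrank x)"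
proof -
  let ?T = "{Q \<in> Places. 0 < ord Q (inv x)}"
  have i: "inv x \<in> carrier F" "inv x \<noteq> \<zero>" using x by auto
  have T: "finite ?T" "?T \<subseteq> Places" using finite_zeros[OF i] by auto
  have "ddeg (poles x) = (\<Sum>P\<in>?T. poles x P * int (place_deg F K P))"
    by (rule ddeg_eq[OF T]) (use ord_inv[OF _ x] in \<open>auto simp: poles_def\<close>)
  also have "\<dots> = int (\<Sum>Q\<in>?T. nat (ord Q (inv x)) * place_deg F K Q)"
    using ord_inv[OF _ x] by (auto simp: poles_def intro!: sum.cong)
  also have "\<dots> \<le> int (xrank (inv x))" by (rule of_nat_mono[OF sum_zeros_le[OF i T]]) auto
  finally show ?thesis using xrank_inv[OF x] by simp
qed

text \<open>Let \<open>W\<close> be a free space of maximal size. The divisor \<open>C\<close>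
  bounds the poles of its elements, so the \<open>card W ^ l\<close> distinct values
  \<open>ev x ys\<close> with \<open>l\<close> coefficients all lie in the space on the
  right.\<close>

lemma xrank_growth:
  assumes x: "x \<in> carrier F" "x \<noteq> \<zero>"
  shows "\<exists>C. fsupp C \<and> (\<forall>P. 0 \<le> C P) \<and> (\<forall>l. xrank x * l \<le> ell (\<lambda>P. int l * poles x P + C P))"
proof -
  obtain W where W: "xfree x W" "card W = q ^ xrank x" using xrank_attained[OF x(1)] by blast
  have Wf: "finite W" "lin_sub K W" using W by (auto simp: xfree_def)
  note Wc = lin_subD(1)[OF Wf(2)]
  define C where "C P = (\<Sum>w\<in>W - {\<zero>}. poles w P)" for P
  have pos: "0 \<le> poles w P" for w P by (simp add: poles_def)
  have C0: "0 \<le> C P" for P unfolding C_def using pos by (intro sum_nonneg) auto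
  have fC: "fsupp C"
  proof -
    have "{P \<in> Places. C P \<noteq> 0} \<subseteq> (\<Union>w\<in>W - {\<zero>}. {P \<in> Places. poles w P \<noteq> 0})"
      unfolding C_def by (auto intro: ccontr)
    moreover have "finite (\<Union>w\<in>W - {\<zero>}. {P \<in> Places. poles w P \<noteq> 0})"
      using Wf(1) fsupp_poles Wc by (auto simp: fsupp_def)
    ultimately show ?thesis unfolding fsupp_def by (rule finite_subset)
  qed
  have WC: "w \<in> L C" if w: "w \<in> W" for w
  proof (cases "w = \<zero>")
    case False
    have "- C P \<le> ord P w" for P
    proof -
      have "poles w P \<le> C P" unfolding C_def
        by (rule member_le_sum) (use w False Wf pos in auto)
      then show ?thesis by (simp add: poles_def)
    qed
    then show ?thesis using w Wc by (auto simp: L_def)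
  qed (use lin_subD(2)[OF L_lin_sub] in auto)
  have xL: "x \<in> L (poles x)" using x by (auto simp: L_def poles_def)
  have evL: "ev x ys \<in> L (\<lambda>P. int (length ys) * poles x P + C P)" if "set ys \<subseteq> W" for ys
    using that
  proof (induction ys)
    case Nil
    then show ?case using lin_subD(2)[OF L_lin_sub] by simp
  next
    case (Cons y ys)
    let ?A = "\<lambda>P. int (length (y # ys)) * poles x P + C P"
    have "L C \<subseteq> L ?A" by (rule L_mono) (use pos in auto)
    then have "y \<in> L ?A" using WC Cons.prems by auto
    moreover have "x \<otimes> ev x ys \<in> L ?A"
      using L_mult[OF xL Cons.IH] Cons.prems by (simp add: algebra_simps)
    ultimately show ?case using lin_subD(3)[OF L_lin_sub] by simp
  qed
  have "xrank x * l \<le> ell (\<lambda>P. int l * poles x P + C P)" for l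
  proof -
    let ?Y = "{ys. set ys \<subseteq> W \<and> length ys = l}" and ?A = "\<lambda>P. int l * poles x P + C P"
    have fA: "fsupp ?A" using fsupp_add[OF fsupp_scale[OF fsupp_poles[OF x]] fC] .
    have "ev x ` ?Y \<subseteq> L ?A" using evL by auto
    from card_inj_on_le[OF inj_on_ev_xfree[OF x(1) W(1)] this finite_L[OF fA]]
    have "card W ^ l \<le> q ^ ell ?A" using card_lists_length_eq[OF Wf(1)] card_L[OF fA] by simp
    then show ?thesis using W(2) by (simp add: power_q_le_iff flip: power_mult)
  qed
  then show ?thesis using fC C0 by blast
qed

text \<open>One inequality is \<open>sum_zeros_le\<close> for \<open>1/x\<close>. For the other,
  \<open>xrank_growth\<close> forces \<open>xrank x * l\<close> below
  \<open>1 + l * deg (poles x) + deg C\<close> for every \<open>l\<close>, and the slopes in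
  \<open>l\<close> are compared.\<close>

lemma ddeg_poles:
  assumes x: "x \<in> carrier F" "x \<noteq> \<zero>" "x \<notin> K"
  shows "ddeg (poles x) = int (xrank x)"
proof (rule antisym)
  show "ddeg (poles x) \<le> int (xrank x)" by (rule ddeg_poles_le[OF x(1,2)])
  obtain C where C: "fsupp C" "\<And>P. 0 \<le> C P" "\<And>l. xrank x * l \<le> ell (\<lambda>P. int l * poles x P + C P)"
    using xrank_growth[OF x(1,2)] by blast
  have bound: "int (xrank x) * int l \<le> 1 + int l * ddeg (poles x) + ddeg C" for l
  proof -
    let ?A = "\<lambda>P. int l * poles x P + C P"
    have f: "fsupp (\<lambda>P. int l * poles x P)" by (intro fsupp_scale fsupp_poles x)
    have "int (ell ?A) \<le> int (ell (\<lambda>_. 0)) + (ddeg ?A - ddeg (\<lambda>_. 0))"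
      by (rule ell_le[OF fsupp_zero fsupp_add[OF f C(1)]]) (use C(2) in \<open>auto simp: poles_def\<close>)
    moreover have "ddeg ?A = int l * ddeg (poles x) + ddeg C"
      using ddeg_add(1)[OF f C(1)] ddeg_scale[OF fsupp_poles[OF x(1,2)]] by simp
    ultimately show ?thesis using C(3)[of l] ell_zero by (simp flip: of_nat_mult)
  qed
  show "int (xrank x) \<le> ddeg (poles x)"
  proof (rule ccontr)
    assume "\<not> ?thesis"
    then have d: "int (xrank x) - ddeg (poles x) \<ge> 1" by simp
    define l where "l = nat (2 + \<bar>ddeg C\<bar>)"
    have "int l \<le> int l * (int (xrank x) - ddeg (poles x))" using d mult_left_mono[OF d, of "int l"] by simp
    also have "\<dots> \<le> 1 + ddeg C" using bound[of l] by (simp add: algebra_simps)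
    finally show False unfolding l_def by simp
  qed
qed

text \<open>The zeros of \<open>x\<close> are the poles of \<open>1/x\<close>, and
  \<open>xrank\<close> does not distinguish \<open>x\<close> from its inverse.\<close>

lemma ddeg_ord:
  assumes x: "x \<in> carrier F" "x \<noteq> \<zero>"
  shows "ddeg (\<lambda>P. ord P x) = 0"
proof (cases "x \<in> K")
  case True
  then have "{P \<in> Places. ord P x \<noteq> 0} = {}" using ord_K x by auto
  then show ?thesis unfolding ddeg_def by simp
next
  case False
  have i: "inv x \<in> carrier F" "inv x \<noteq> \<zero>" "inv x \<notin> K" using x False inv_mem_K_iff by auto
  have "ddeg (\<lambda>P. ord P x) = ddeg (\<lambda>P. poles (inv x) P - poles x P)"
    unfolding ddeg_def by (rule sum.cong) (use ord_inv[OF _ x] in \<open>auto simp: poles_def\<close>)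
  also have "\<dots> = 0"
    using ddeg_add(2)[OF fsupp_poles[OF i(1,2)] fsupp_poles[OF x]] ddeg_poles[OF i] ddeg_poles[OF x False]
      xrank_inv[OF x] by simp
  finally show ?thesis .
qed

lemma ell_shift:
  assumes x: "x \<in> carrier F" "x \<noteq> \<zero>" and A: "fsupp A"
  shows "ell (\<lambda>P. A P - ord P x) \<le> ell A"
proof -
  let ?A = "\<lambda>P. A P - ord P x"
  have i: "inv x \<in> carrier F" "inv x \<noteq> \<zero>" using x by auto
  have fA: "fsupp ?A" using A fsupp_ord[OF x] by auto
  have "inv x \<in> L (\<lambda>P. ord P x)" using i ord_inv[OF _ x] by (auto simp: L_def)
  then have "(\<otimes>) (inv x) ` L ?A \<subseteq> L A" using L_mult[of "inv x" "\<lambda>P. ord P x" _ ?A] by auto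
  moreover have "inj_on ((\<otimes>) (inv x)) (L ?A)"
    by (rule inj_onI) (use m_lcancel[OF i(2,1)] L_carrier in blast)
  ultimately have "card (L ?A) \<le> card (L A)" using card_inj_on_le[OF _ _ finite_L[OF A]] by blast
  then show ?thesis using A fA by (simp add: card_L power_q_le_iff)
qed

text \<open>Adding the principal divisor of \<open>z\<close> makes \<open>A\<close> effective
  without changing its degree; an effective divisor can be compared with 0, whose space has
  dimension 1.\<close>

lemma ell_le_ddeg:
  assumes A: "fsupp A" and z: "z \<in> L A" "z \<noteq> \<zero>"
  shows "int (ell A) \<le> ddeg A + 1" "0 \<le> ddeg A"
proof -
  have zc: "z \<in> carrier F" using z L_carrier by blast
  have i: "inv z \<in> carrier F" "inv z \<noteq> \<zero>" using z zc by auto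
  let ?B = "\<lambda>P. A P + ord P z"
  have B: "fsupp ?B" using A fsupp_ord[OF zc z(2)] by auto
  have ge: "0 \<le> ?B P" if "P \<in> Places" for P using z that by (auto simp: L_def)
  have dB: "ddeg ?B = ddeg A" using ddeg_add(1)[OF A fsupp_ord[OF zc z(2)]] ddeg_ord[OF zc z(2)] by simp
  have "(\<lambda>P. ?B P - ord P z) = A" by auto
  then have "int (ell A) \<le> int (ell ?B)" using ell_shift[OF zc z(2) B] by simp
  also have "\<dots> \<le> int (ell (\<lambda>_. 0)) + (ddeg ?B - ddeg (\<lambda>_. 0))" by (rule ell_le[OF fsupp_zero B ge])
  finally show "int (ell A) \<le> ddeg A + 1" using ell_zero dB by simp
  have "0 \<le> ddeg ?B" unfolding ddeg_def using ge by (intro sum_nonneg) auto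
  then show "0 \<le> ddeg A" using dB by simp
qed


section \<open>Riemann's theorem and strong approximation\<close>

text \<open>In classical notation this is \<open>g - 1 - i(A)\<close>, with genus \<open>g\<close>
  and index of speciality \<open>i\<close>. It grows with \<open>A\<close> and is unaffected by
  principal divisors, so bounding it is Riemann's inequality.\<close>

definition defect :: "('a set \<Rightarrow> int) \<Rightarrow> int" where
  "defect A = ddeg A - int (ell A)"

lemma defect_mono:
  assumes "fsupp A" "fsupp B" "\<And>P. P \<in> Places \<Longrightarrow> A P \<le> B P"
  shows "defect A \<le> defect B"
  using ell_le[OF assms] unfolding defect_def by linarith

lemma defect_shift:
  assumes "x \<in> carrier F" "x \<noteq> \<zero>" "fsupp A"
  shows "defect A \<le> defect (\<lambda>P. A P - ord P x)"
  using ell_shift[OF assms] ddeg_add(2)[OF assms(3) fsupp_ord[OF assms(1,2)]] ddeg_ord[OF assms(1,2)]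
  unfolding defect_def by simp

lemma exists_nonzero_in_L:
  assumes A: "fsupp A" and pos: "1 \<le> ell A"
  shows "\<exists>z\<in>L A. z \<noteq> \<zero>"
proof (rule ccontr)
  assume "\<not> ?thesis"
  then have "L A \<subseteq> {\<zero>}" by blast
  then have "card (L A) \<le> 1" using card_mono[of "{\<zero>}" "L A"] by simp
  moreover have "q ^ 1 \<le> card (L A)" using card_L[OF A] pos power_q_le_iff[of 1 "ell A"] by simp
  ultimately show False using q_ge_2 by simp
qed

lemma xrank_pos:
  assumes x: "x \<in> carrier F" "x \<notin> K" shows "1 \<le> xrank x"
proof -
  have "xfree x K"
    unfolding xfree_def using ev_K_eq_zero[OF x] by (simp add: lin_sub_def K_sub)
  then have "q ^ 1 \<le> q ^ xrank x" using xfree_card_le[OF x(1)] by simp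
  then show ?thesis by (simp only: power_q_le_iff)
qed

text \<open>The divisors \<open>?M l\<close> have defect at most \<open>deg C\<close> by
  \<open>xrank_growth\<close>. A given effective \<open>A\<close> can be moved below some
  \<open>?M l\<close> by a principal divisor, since \<open>l * poles x - A\<close> eventually has a
  nonzero section \<open>z\<close>; monotonicity of the defect does the rest. A general
  \<open>A\<close> lies below its positive part.\<close>

lemma riemann_inequality:
  assumes x: "x \<in> carrier F" "x \<notin> K"
  shows "\<exists>\<gamma>. \<forall>A. fsupp A \<longrightarrow> defect A \<le> \<gamma>"
proof -
  have x0: "x \<noteq> \<zero>" using x by auto
  obtain C where C: "fsupp C" "\<And>P. 0 \<le> C P" "\<And>l. xrank x * l \<le> ell (\<lambda>P. int l * poles x P + C P)"
    using xrank_growth[OF x(1) x0] by blast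
  note fp = fsupp_scale[OF fsupp_poles[OF x(1) x0]]
  let ?M = "\<lambda>l P. int l * poles x P + C P"
  have fM: "fsupp (?M l)" for l :: nat using fp C(1) by auto
  have dM: "ddeg (?M l) = int l * int (xrank x) + ddeg C" for l :: nat
    using ddeg_add(1)[OF fp C(1)] ddeg_scale[OF fsupp_poles[OF x(1) x0]] ddeg_poles[OF x(1) x0 x(2)] by simp
  have MC: "defect (?M l) \<le> ddeg C" for l :: nat
    using dM[of l] C(3)[of l] unfolding defect_def by (simp add: mult.commute flip: of_nat_mult)
  have eff: "defect A \<le> ddeg C" if A: "fsupp A" "\<And>P. 0 \<le> A P" for A
  proof -
    \<comment> \<open>Chosen so that \<open>l - deg C - deg A\<close>, a lower bound for
      \<open>ell ?D\<close>, is at least 1.\<close>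
    define l where "l = nat (1 + \<bar>ddeg C\<bar> + \<bar>ddeg A\<bar>)"
    let ?D = "\<lambda>P. int l * poles x P - A P"
    have fD: "fsupp ?D" using fp A(1) by auto
    have "defect ?D \<ge> ddeg ?D - int (ell ?D)" by (simp add: defect_def)
    have "int (ell (?M l)) \<le> int (ell ?D) + (ddeg (?M l) - ddeg ?D)"
    proof (rule ell_le[OF fD fM])
      fix P show "?D P \<le> ?M l P" using A(2)[of P] C(2)[of P] by simp
    qed
    moreover have "ddeg ?D = int l * int (xrank x) - ddeg A"
      using ddeg_add(2)[OF fp A(1)] ddeg_scale[OF fsupp_poles[OF x(1) x0]] ddeg_poles[OF x(1) x0 x(2)] by simp
    moreover have "int l \<le> int (xrank x * l)"
      using mult_le_mono1[OF xrank_pos[OF x], of l] by (simp only: of_nat_le_iff mult_1)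
    moreover have "int (xrank x * l) \<le> int (ell (?M l))" using C(3)[of l] by (simp only: of_nat_le_iff)
    ultimately have "int l - ddeg C - ddeg A \<le> int (ell ?D)" using dM[of l] by linarith
    then have "1 \<le> ell ?D" unfolding l_def by linarith
    then obtain z where z: "z \<in> L ?D" "z \<noteq> \<zero>" using exists_nonzero_in_L[OF fD] by blast
    have zc: "z \<in> carrier F" using z L_carrier by blast
    have "defect A \<le> defect (\<lambda>P. A P - ord P z)" by (rule defect_shift[OF zc z(2) A(1)])
    moreover have "\<dots> \<le> defect (?M l)"
    proof (rule defect_mono[OF _ fM])
      show "fsupp (\<lambda>P. A P - ord P z)" using A(1) fsupp_ord[OF zc z(2)] by auto
      fix P assume P: "P \<in> Places"
      have "- ?D P \<le> ord P z" using z P by (auto simp: L_def)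
      then show "A P - ord P z \<le> ?M l P" using C(2)[of P] by linarith
    qed
    ultimately show ?thesis using MC[of l] by linarith
  qed
  have "defect A \<le> ddeg C" if A: "fsupp A" for A
  proof -
    have f: "fsupp (\<lambda>P. max (A P) 0)" using fsupp_max[OF A fsupp_zero] .
    have "defect A \<le> defect (\<lambda>P. max (A P) 0)" by (rule defect_mono[OF A f]) simp
    moreover have "\<dots> \<le> ddeg C" by (rule eff[OF f]) simp
    ultimately show ?thesis by linarith
  qed
  then show ?thesis by blast
qed

lemma place_imp_not_K: "P \<in> Places \<Longrightarrow> \<exists>x\<in>carrier F. x \<notin> K"
  using exists_ord[of P 1] ord_K by force

text \<open>A divisor of maximal defect can be moved below every sufficiently large divisor by a principal
  divisor, so that the defect is eventually constant.\<close>

lemma ell_diff_eventually: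
  assumes P0: "P0 \<in> Places" and W: "fsupp W" "\<And>P. 0 \<le> W P"
  shows "\<exists>m::nat. \<forall>A. fsupp A \<longrightarrow> (\<forall>P\<in>Places. (if P = P0 then int m else 0) \<le> A P) \<longrightarrow>
    int (ell A) = int (ell (\<lambda>P. A P - W P)) + ddeg W"
proof -
  obtain \<gamma> where \<gamma>: "\<And>A. fsupp A \<Longrightarrow> defect A \<le> \<gamma>"
    using riemann_inequality place_imp_not_K[OF P0] by blast
  \<comment> \<open>The defects are integers bounded above, so a largest one is attained; the
    distance to the bound is minimised as a natural number.\<close>
  obtain A0 where A0: "fsupp A0" "\<And>A. fsupp A \<Longrightarrow> nat (\<gamma> - defect A0) \<le> nat (\<gamma> - defect A)"
    using ex_has_least_nat[of fsupp "\<lambda>_. 0" "\<lambda>A. nat (\<gamma> - defect A)"] fsupp_zero by blast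
  have max: "defect A \<le> defect A0" if "fsupp A" for A
    using A0(2)[OF that] \<gamma>[OF that] \<gamma>[OF A0(1)] by linarith
  \<comment> \<open>Makes the degree of \<open>E - W - A0\<close> exceed the largest defect, so that
    this divisor has a nonzero section \<open>z\<close>.\<close>
  define m where "m = nat (1 + \<bar>ddeg W\<bar> + \<bar>ddeg A0\<bar> + \<bar>\<gamma>\<bar>)"
  define E where "E P = (if P = P0 then int m else 0)" for P
  have fE: "fsupp E" and dE: "ddeg E = int m * int (place_deg F K P0)"
  proof -
    show "fsupp E" unfolding E_def fsupp_def by (rule finite_subset[of _ "{P0}"]) auto
    have "ddeg E = (\<Sum>P\<in>{P0}. E P * int (place_deg F K P))"
      by (rule ddeg_eq) (use P0 in \<open>auto simp: E_def\<close>)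
    then show "ddeg E = int m * int (place_deg F K P0)" by (simp add: E_def)
  qed
  let ?D = "\<lambda>P. E P - W P - A0 P"
  have fD: "fsupp ?D" using fE W(1) A0(1) by auto
  have dD: "ddeg ?D = ddeg E - ddeg W - ddeg A0"
    using ddeg_add(2)[OF fsupp_diff[OF fE W(1)] A0(1)] ddeg_add(2)[OF fE W(1)] by simp
  have "int m \<le> ddeg E" using dE place_deg_pos[OF P0] mult_left_mono[of 1 "int (place_deg F K P0)" "int m"] by simp
  moreover have "ddeg ?D - int (ell ?D) \<le> \<gamma>" using \<gamma>[OF fD] by (simp only: defect_def)
  ultimately have "1 \<le> int (ell ?D)" unfolding dD m_def by linarith
  then obtain z where z: "z \<in> L ?D" "z \<noteq> \<zero>" using exists_nonzero_in_L[OF fD] by auto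
  have zc: "z \<in> carrier F" using z L_carrier by blast
  have "int (ell A) = int (ell (\<lambda>P. A P - W P)) + ddeg W"
    if A: "fsupp A" "\<And>P. P \<in> Places \<Longrightarrow> E P \<le> A P" for A
  proof -
    have fAW: "fsupp (\<lambda>P. A P - W P)" using A(1) W(1) by auto
    have "defect A0 \<le> defect (\<lambda>P. A0 P - ord P z)" by (rule defect_shift[OF zc z(2) A0(1)])
    moreover have "\<dots> \<le> defect (\<lambda>P. A P - W P)"
    proof (rule defect_mono[OF _ fAW])
      show "fsupp (\<lambda>P. A0 P - ord P z)" using A0(1) fsupp_ord[OF zc z(2)] by auto
      fix P assume P: "P \<in> Places"
      have "- ?D P \<le> ord P z" using z P by (auto simp: L_def)
      then show "A0 P - ord P z \<le> A P - W P" using A(2)[OF P] by linarith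
    qed
    ultimately have "defect A0 \<le> defect (\<lambda>P. A P - W P)" by (rule order_trans)
    moreover have "defect (\<lambda>P. A P - W P) \<le> defect A"
      by (rule defect_mono[OF fAW A(1)]) (use W(2) in simp)
    ultimately have "defect (\<lambda>P. A P - W P) = defect A" using max[OF A(1)] by linarith
    then show ?thesis using ddeg_add(2)[OF A(1) W(1)] unfolding defect_def by simp
  qed
  then show ?thesis unfolding E_def by blast
qed

section \<open>Equidistribution of residues and strong approximation\<close>

definition ind_div :: "'a set set \<Rightarrow> nat \<Rightarrow> 'a set \<Rightarrow> int" where
  "ind_div T N P = (if P \<in> T then int N else 0)"

lemma fsupp_ind_div: "finite T \<Longrightarrow> fsupp (ind_div T N)"
  unfolding ind_div_def by (rule fsupp_single)

text \<open>Once \<open>A\<close> is large at \<open>P0\<close>, removing \<open>N T\<close> lowers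
  the dimension by the full degree \<open>N deg T\<close>, and \<open>card_fib_eq\<close> applies.
  Hence residues modulo all \<open>Q^N\<close> are exactly, not just asymptotically, equidistributed
  on \<open>L A\<close>; this makes the local conditions independent.\<close>

lemma fibers_equal:
  assumes P0: "P0 \<in> Places" and T: "finite T" "T \<subseteq> Places"
    and t: "\<And>Q. Q \<in> T \<Longrightarrow> transversal (t Q) (VR Q) (vpow Q (int N))"
      "\<And>Q. Q \<in> T \<Longrightarrow> card (t Q) = q ^ (N * place_deg F K Q)"
  shows "\<exists>m::nat. \<forall>A. fsupp A \<longrightarrow> (\<forall>P\<in>Places. (if P = P0 then int m else 0) \<le> A P) \<longrightarrow> (\<forall>Q\<in>T. A Q = 0) \<longrightarrow>
    card (L A) = card (PiE T t) * card (L (\<lambda>P. A P - ind_div T N P)) \<and>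
    (\<forall>g\<in>PiE T t. card {z \<in> L A. \<forall>Q\<in>T. z \<ominus> g Q \<in> vpow Q (int N)} = card (L (\<lambda>P. A P - ind_div T N P)))"
proof -
  let ?W = "ind_div T N"
  have W: "fsupp ?W" "\<And>P. 0 \<le> ?W P" using fsupp_ind_div[OF T(1)] by (auto simp: ind_div_def)
  have dW: "ddeg ?W = int (\<Sum>Q\<in>T. N * place_deg F K Q)"
    using ddeg_eq[OF T, of ?W] by (simp add: ind_div_def)
  have cP: "card (PiE T t) = q ^ (\<Sum>Q\<in>T. N * place_deg F K Q)"
    by (rule card_PiE_transversals[OF T(1) t(2)])
  obtain m :: nat where m: "\<And>A. fsupp A \<Longrightarrow> (\<forall>P\<in>Places. (if P = P0 then int m else 0) \<le> A P) \<Longrightarrow>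
    int (ell A) = int (ell (\<lambda>P. A P - ?W P)) + ddeg ?W"
    using ell_diff_eventually[OF P0 W] by blast
  have "card (L A) = card (PiE T t) * card (L (\<lambda>P. A P - ?W P)) \<and>
      (\<forall>g\<in>PiE T t. card {z \<in> L A. \<forall>Q\<in>T. z \<ominus> g Q \<in> vpow Q (int N)} = card (L (\<lambda>P. A P - ?W P)))"
    if A: "fsupp A" "\<forall>P\<in>Places. (if P = P0 then int m else 0) \<le> A P" "\<forall>Q\<in>T. A Q = 0" for A
  proof -
    let ?B = "\<lambda>P. A P - ?W P"
    have fB: "fsupp ?B" using A(1) W(1) by auto
    have "int (ell A) = int (ell ?B) + int (\<Sum>Q\<in>T. N * place_deg F K Q)"
      using m[OF A(1,2)] dW by simp
    then have "ell A = (\<Sum>Q\<in>T. N * place_deg F K Q) + ell ?B" by linarith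
    then have c: "card (L A) = card (PiE T t) * card (L ?B)"
      using card_L[OF A(1)] card_L[OF fB] cP by (simp add: power_add)
    have e: "- ?B Q = int N" "- A Q = 0" if "Q \<in> T" for Q using A(3) that by (auto simp: ind_div_def)
    have tt: "transversal (t Q) (vpow Q (- A Q)) (vpow Q (- ?B Q))" if "Q \<in> T" for Q
      using t(1)[OF that] e[OF that] vpow_0[of Q] that T(2) by auto
    have "card {z \<in> L A. \<forall>Q\<in>T. z \<ominus> g Q \<in> vpow Q (int N)} = card (L ?B)" if g: "g \<in> PiE T t" for g
    proof -
      have "card (fib ?B A T g) = card (L ?B)"
        by (rule card_fib_eq[OF T _ _ tt finite_L[OF fB] c g]) (auto simp: ind_div_def)
      moreover have "fib ?B A T g = {z \<in> L A. \<forall>Q\<in>T. z \<ominus> g Q \<in> vpow Q (int N)}"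
        unfolding fib_def using e(1) by (intro Collect_cong conj_cong refl ball_cong) simp
      ultimately show ?thesis by simp
    qed
    then show ?thesis using c by blast
  qed
  then show ?thesis by blast
qed

text \<open>Take \<open>A = m P0\<close>: the relevant fibre has as many elements as some
  \<open>L\<close> space, which is never empty, and its members have poles at \<open>P0\<close>
  only.\<close>

lemma strong_approximation:
  assumes P0: "P0 \<in> Places" "P0 \<notin> T" and T: "finite T" "T \<subseteq> Places"
    and a: "\<And>Q. Q \<in> T \<Longrightarrow> a Q \<in> VR Q"
  shows "\<exists>h\<in>carrier F. (\<forall>Q\<in>T. h \<ominus> a Q \<in> vpow Q (int N)) \<and> (\<forall>P\<in>Places - {P0}. h \<in> VR P)"
proof -
  have "\<exists>t. \<forall>Q\<in>T. transversal (t Q) (VR Q) (vpow Q (int N)) \<and> card (t Q) = q ^ (N * place_deg F K Q)"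
    using vpow_transversal[of _ 0 N] vpow_0 T(2) by (intro bchoice) (auto simp: subset_iff)
  then obtain t where t0: "\<forall>Q\<in>T. transversal (t Q) (VR Q) (vpow Q (int N)) \<and> card (t Q) = q ^ (N * place_deg F K Q)"
    by (rule exE)
  have t: "transversal (t Q) (VR Q) (vpow Q (int N))" "card (t Q) = q ^ (N * place_deg F K Q)" if "Q \<in> T" for Q
    using bspec[OF t0 that] by (rule conjunct1, rule conjunct2)
  have "\<exists>r. \<forall>Q\<in>T. r Q \<in> t Q \<and> a Q \<ominus> r Q \<in> vpow Q (int N)"
    using transversal_ex[OF t(1) a] by (intro bchoice) blast
  then obtain r where r: "\<And>Q. Q \<in> T \<Longrightarrow> r Q \<in> t Q \<and> a Q \<ominus> r Q \<in> vpow Q (int N)" by blast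
  let ?g = "restrict r T"
  have g: "?g \<in> PiE T t" using r by auto
  obtain m :: nat where m: "\<And>A. fsupp A \<Longrightarrow> (\<forall>P\<in>Places. (if P = P0 then int m else 0) \<le> A P) \<Longrightarrow>
    (\<forall>Q\<in>T. A Q = 0) \<Longrightarrow> (\<forall>g\<in>PiE T t. card {z \<in> L A. \<forall>Q\<in>T. z \<ominus> g Q \<in> vpow Q (int N)} = card (L (\<lambda>P. A P - ind_div T N P)))"
    using fibers_equal[OF P0(1) T t] by blast
  let ?A = "ind_div {P0} m"
  have fA: "fsupp ?A" by (rule fsupp_ind_div) simp
  have "card {z \<in> L ?A. \<forall>Q\<in>T. z \<ominus> ?g Q \<in> vpow Q (int N)} = card (L (\<lambda>P. ?A P - ind_div T N P))"
    by (rule bspec[OF m[OF fA] g]) (use P0 in \<open>auto simp: ind_div_def\<close>)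
  moreover have "card (L (\<lambda>P. ?A P - ind_div T N P)) \<noteq> 0"
    
    unfolding card_L[OF fsupp_diff[OF fA fsupp_ind_div[OF T(1), of N]]]
    using zero_less_power[of q] q_ge_2 by (metis less_le_trans not_gr_zero pos2)
  ultimately have "{z \<in> L ?A. \<forall>Q\<in>T. z \<ominus> ?g Q \<in> vpow Q (int N)} \<noteq> {}" by (metis card.empty)
  then obtain h where h: "h \<in> L ?A" "\<And>Q. Q \<in> T \<Longrightarrow> h \<ominus> r Q \<in> vpow Q (int N)" by auto
  have hc: "h \<in> carrier F" using h L_carrier by blast
  have "h \<ominus> a Q \<in> vpow Q (int N)" if Q: "Q \<in> T" for Q
  proof -
    have QP: "Q \<in> Places" using Q T by blast
    have c: "a Q \<in> carrier F" "r Q \<in> carrier F"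
      using a[OF Q] VR_closed(1)[OF QP] r[OF Q] t(1)[OF Q] by (auto simp: transversal_def)
    have "h \<ominus> a Q = (h \<ominus> r Q) \<ominus> (a Q \<ominus> r Q)" using c hc by algebra
    then show ?thesis using vpow_minus[OF QP h(2)[OF Q]] r[OF Q] by simp
  qed
  moreover have "h \<in> VR P" if "P \<in> Places - {P0}" for P
  proof -
    have "h \<in> vpow P (- ?A P)" using h(1) that by (auto simp: L_iff)
    then show ?thesis using that vpow_0[of P] by (simp add: ind_div_def)
  qed
  ultimately show ?thesis using hc by blast
qed

end

section \<open>Prime ideals of the holomorphy ring\<close>

locale holomorphy = global_function_field +
  fixes S :: "'a set set"
  assumes S_nonempty: "S \<noteq> {}" and S_proper: "S \<subset> places F K"
begin

abbreviation "H \<equiv> holomorphy_ring F K S"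

lemma S_Places: "Q \<in> S \<Longrightarrow> Q \<in> Places"
  using S_proper by blast

lemma H_carrier: "h \<in> H \<Longrightarrow> h \<in> carrier F"
  using S_nonempty S_Places VR_closed(1) unfolding holomorphy_ring_def by blast

lemma H_vpow: "h \<in> H \<Longrightarrow> Q \<in> S \<Longrightarrow> h \<in> vpow Q 0"
  using vpow_0[OF S_Places] unfolding holomorphy_ring_def by blast

lemma HI: "(\<And>Q. Q \<in> S \<Longrightarrow> h \<in> vpow Q 0) \<Longrightarrow> h \<in> H"
  using vpow_0[OF S_Places] unfolding holomorphy_ring_def by blast

lemma H_subring: "subring H F"
  unfolding holomorphy_ring_def
  using subring_Inter[of "VR ` S"] VR_props(1)[OF S_Places] S_nonempty by auto

lemmas H_closed = subringE(2,3,5,6,7)[OF H_subring]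

lemma H_minus: "a \<in> H \<Longrightarrow> b \<in> H \<Longrightarrow> a \<ominus> b \<in> H"
  using H_closed by (simp add: a_minus_def)

lemma H_approximation:
  assumes T: "finite T" "T \<subseteq> S" and a: "\<And>Q. Q \<in> T \<Longrightarrow> a Q \<in> VR Q"
  shows "\<exists>h\<in>H. \<forall>Q\<in>T. h \<ominus> a Q \<in> vpow Q (int N)"
proof -
  obtain P0 where P0: "P0 \<in> Places" "P0 \<notin> S" using S_proper by blast
  have P0T: "P0 \<notin> T" "T \<subseteq> Places" using P0 T S_proper by auto
  obtain h where h: "h \<in> carrier F" "\<forall>Q\<in>T. h \<ominus> a Q \<in> vpow Q (int N)" "\<forall>P\<in>Places - {P0}. h \<in> VR P"
    using strong_approximation[OF P0(1) P0T(1) T(1) P0T(2) a] by blast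
  have "h \<in> H" unfolding holomorphy_ring_def using h(3) P0(2) S_Places by auto
  then show ?thesis using h(2) by blast
qed

lemma H_ord_nonneg: "h \<in> H \<Longrightarrow> h \<noteq> \<zero> \<Longrightarrow> Q \<in> S \<Longrightarrow> 0 \<le> ord Q h"
  using H_vpow[of h Q] by (simp add: vpow_def)

text \<open>Divisibility in \<open>H\<close> is tested place by place, and only zeros of
  \<open>a\<close> impose a condition. Since these are finite in number, divisibility can be
  arranged by \<open>H_approximation\<close>.\<close>

lemma H_divide:
  assumes a: "a \<in> H" "a \<noteq> \<zero>" and y: "y \<in> H" 
    and d: "\<And>Q. Q \<in> S \<Longrightarrow> 0 < ord Q a \<Longrightarrow> y \<in> vpow Q (ord Q a)"
  shows "y \<otimes> inv a \<in> H"
proof (rule HI)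
  fix Q assume Q: "Q \<in> S"
  have ac: "a \<in> carrier F" using H_carrier a by blast
  have "y \<in> vpow Q (ord Q a)"
    using d[OF Q] H_vpow[OF y Q] H_ord_nonneg[OF a Q] by (cases "ord Q a = 0") auto
  moreover have "inv a \<in> vpow Q (- ord Q a)" using ac a ord_inv[OF S_Places[OF Q] ac a(2)] by (simp add: vpow_def)
  ultimately show "y \<otimes> inv a \<in> vpow Q 0" using vpow_mult[OF S_Places[OF Q]] by fastforce
qed

lemma finite_S_zeros: "a \<in> H \<Longrightarrow> a \<noteq> \<zero> \<Longrightarrow> finite {Q \<in> S. 0 < ord Q a}"
  using finite_zeros[of a] H_carrier S_Places by (auto intro: finite_subset[rotated])

lemma S_place_vpow: "Q \<in> S \<Longrightarrow> Q = vpow Q 1"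
  using vpow_1[OF S_Places] by simp

lemma H_ideal_place: "Q \<in> S \<Longrightarrow> ideal (Q \<inter> H) (F\<lparr>carrier := H\<rparr>)"
proof -
  assume Q: "Q \<in> S"
  note QP = S_Places[OF Q] and e = S_place_vpow[OF Q]
  have m: "v \<otimes> z \<in> Q" if "v \<in> H" "z \<in> Q" for v z
    using vpow_mult[OF QP H_vpow[OF that(1) Q], of z 1] that(2) vpow_1[OF QP] by simp
  have z: "\<zero> \<in> Q" using zero_vpow[of Q 1] vpow_1[OF QP] by simp
  have a: "x \<oplus> y \<in> Q" if "x \<in> Q" "y \<in> Q" for x y
    using vpow_add[OF QP, of x 1 y] that vpow_1[OF QP] by simp
  show ?thesis
    by (rule ideal_subringI[OF H_subring]) (use m z a H_closed in auto)
qed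

lemma place_prime:
  assumes Q: "Q \<in> S" and ab: "a \<in> H" "b \<in> H" "a \<otimes> b \<in> Q"
  shows "a \<in> Q \<or> b \<in> Q"
proof (rule ccontr)
  assume n: "\<not> ?thesis"
  note QP = S_Places[OF Q]
  have z: "\<zero> \<in> Q" using zero_vpow[of Q 1] vpow_1[OF QP] by simp
  have nz: "a \<noteq> \<zero>" "b \<noteq> \<zero>" using n z by auto
  have c: "a \<in> carrier F" "b \<in> carrier F" using ab H_carrier by auto
  have "ord Q a \<le> 0" "ord Q b \<le> 0" using n ord_pos_iff[OF QP c(1) nz(1)] ord_pos_iff[OF QP c(2) nz(2)] by auto
  moreover have "1 \<le> ord Q (a \<otimes> b)" using ord_pos_iff[OF QP, of "a \<otimes> b"] ab(3) c nz mult_nz by simp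
  ultimately show False using ord_mult[OF QP c(1) nz(1) c(2) nz(2)] by simp
qed

lemma H_primeideal_place:
  assumes Q: "Q \<in> S"
  shows "primeideal (Q \<inter> H) (F\<lparr>carrier := H\<rparr>)"
proof (rule primeidealI[OF H_ideal_place[OF Q]])
  show "cring (F\<lparr>carrier := H\<rparr>)" by (rule subring_is_cring[OF H_subring])
  show "carrier (F\<lparr>carrier := H\<rparr>) \<noteq> Q \<inter> H"
    using one_notin_place[OF S_Places[OF Q]] H_closed(2) by auto
  fix a b assume "a \<in> carrier (F\<lparr>carrier := H\<rparr>)" "b \<in> carrier (F\<lparr>carrier := H\<rparr>)"
    "a \<otimes>\<^bsub>F\<lparr>carrier := H\<rparr>\<^esub> b \<in> Q \<inter> H"
  then show "a \<in> Q \<inter> H \<or> b \<in> Q \<inter> H" using place_prime[OF Q, of a b] by auto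
qed

section \<open>Classification of the nonzero primes of the holomorphy ring\<close>

context
  fixes I assumes I: "primeideal I (F\<lparr>carrier := H\<rparr>)"
begin

lemma I_props:
  "I \<subseteq> H" "\<And>a b. a \<in> I \<Longrightarrow> b \<in> I \<Longrightarrow> a \<oplus> b \<in> I" "\<And>h a. h \<in> H \<Longrightarrow> a \<in> I \<Longrightarrow> h \<otimes> a \<in> I"
  "\<And>h a. h \<in> H \<Longrightarrow> a \<in> I \<Longrightarrow> a \<otimes> h \<in> I" "\<one> \<notin> I"
  "\<And>a b. a \<in> H \<Longrightarrow> b \<in> H \<Longrightarrow> a \<otimes> b \<in> I \<Longrightarrow> a \<in> I \<or> b \<in> I"
proof -
  interpret I: primeideal I "F\<lparr>carrier := H\<rparr>" by (rule I)
  show "I \<subseteq> H" using I.a_subset by simp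
  show "\<And>a b. a \<in> I \<Longrightarrow> b \<in> I \<Longrightarrow> a \<oplus> b \<in> I" using additive_subgroup.a_closed[OF I.is_additive_subgroup] by simp
  show "\<And>h a. h \<in> H \<Longrightarrow> a \<in> I \<Longrightarrow> h \<otimes> a \<in> I" using I.I_l_closed by simp
  show "\<And>h a. h \<in> H \<Longrightarrow> a \<in> I \<Longrightarrow> a \<otimes> h \<in> I" using I.I_r_closed by simp
  show "\<one> \<notin> I" using I.one_imp_carrier I.I_notcarr by auto
  show "\<And>a b. a \<in> H \<Longrightarrow> b \<in> H \<Longrightarrow> a \<otimes> b \<in> I \<Longrightarrow> a \<in> I \<or> b \<in> I" using I.I_prime by simp
qed

text \<open>If \<open>c\<close> lies in the new place \<open>R\<close>, it is corrected by
  \<open>s b\<close> with \<open>b\<close> in \<open>I\<close> outside \<open>R\<close>, where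
  \<open>s\<close> is close to 1 at \<open>R\<close> and to 0 at the earlier places.\<close>

lemma prime_avoidance:
  assumes a: "a \<in> I" and no: "\<And>Q. Q \<in> S \<Longrightarrow> \<not> I \<subseteq> Q" and T: "finite T" "T \<subseteq> S"
  shows "\<exists>c\<in>I. \<forall>Q\<in>T. c \<notin> Q"
  using T
proof (induction rule: finite_induct)
  case empty
  then show ?case using a by blast
next
  case (insert R T)
  then obtain c where c: "c \<in> I" "\<forall>Q\<in>T. c \<notin> Q" by auto
  show ?case
  proof (cases "c \<in> R")
    case False
    then show ?thesis using c by auto
  next
    case True
    obtain b where b: "b \<in> I" "b \<notin> R" using no[of R] insert by auto
    let ?u = "\<lambda>Q. if Q = R then \<one> else \<zero>"
    have "\<exists>s\<in>H. \<forall>Q\<in>insert R T. s \<ominus> ?u Q \<in> vpow Q (int 1)"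
      by (rule H_approximation) (use insert VR_closed[OF S_Places] in auto)
    then obtain s where s0: "s \<in> H" "\<forall>Q\<in>insert R T. s \<ominus> ?u Q \<in> vpow Q (int 1)" by (rule bexE)
    note s = s0(1) bspec[OF s0(2)]
    have cc: "c \<in> carrier F" "b \<in> carrier F" "s \<in> carrier F" and cb: "c \<in> H" "b \<in> H"
      using c b s I_props(1) H_carrier by auto
    have "c \<oplus> s \<otimes> b \<notin> Q" if Q: "Q \<in> insert R T" for Q
    proof
      assume A: "c \<oplus> s \<otimes> b \<in> Q"
      have QS: "Q \<in> S" using Q insert by auto
      note QP = S_Places[OF QS] and v1 = vpow_1[OF QP]
      show False
      proof (cases "Q = R")
        case True
        have "s \<ominus> \<one> \<in> vpow Q 1" using s(2)[OF Q] True by simp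
        then have "(s \<ominus> \<one>) \<otimes> b \<in> vpow Q 1" using vpow_mult[OF QP _ H_vpow[OF cb(2) QS]] by fastforce
        moreover have "c \<oplus> s \<otimes> b \<ominus> c \<in> vpow Q 1"
          using vpow_minus[OF QP, of "c \<oplus> s \<otimes> b" 1 c] A \<open>c \<in> R\<close> True v1 by simp
        ultimately have "(c \<oplus> s \<otimes> b \<ominus> c) \<ominus> (s \<ominus> \<one>) \<otimes> b \<in> vpow Q 1" using vpow_minus[OF QP] by blast
        moreover have "(c \<oplus> s \<otimes> b \<ominus> c) \<ominus> (s \<ominus> \<one>) \<otimes> b = b" using cc by algebra
        ultimately show False using b v1 True by simp
      next
        case False
        then have "s \<in> vpow Q 1" using s(2)[OF Q] cc by (simp add: a_minus_def)
        then have "s \<otimes> b \<in> vpow Q 1" using vpow_mult[OF QP _ H_vpow[OF cb(2) QS]] by fastforce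
        then have "(c \<oplus> s \<otimes> b) \<ominus> s \<otimes> b \<in> vpow Q 1" using vpow_minus[OF QP] A v1 by blast
        moreover have "(c \<oplus> s \<otimes> b) \<ominus> s \<otimes> b = c" using cc by algebra
        ultimately show False using c(2) Q False v1 by auto
      qed
    qed
    moreover have "c \<oplus> s \<otimes> b \<in> I" by (rule I_props(2)[OF c(1) I_props(3)[OF s(1) b(1)]])
    ultimately show ?thesis by blast
  qed
qed

text \<open>Otherwise \<open>I\<close> contains some \<open>c\<close> that is a unit at all zeros of
  \<open>a\<close>. With \<open>u\<close> close to \<open>1/c\<close> there, \<open>1 - u c\<close>
  is divisible by \<open>a\<close>, and 1 would lie in \<open>I\<close>.\<close>

lemma prime_ideal_subset_place:
  assumes a: "a \<in> I" "a \<noteq> \<zero>"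
  shows "\<exists>Q\<in>S. I \<subseteq> Q"
proof (rule ccontr)
  assume "\<not> ?thesis"
  then have no: "\<And>Q. Q \<in> S \<Longrightarrow> \<not> I \<subseteq> Q" by blast
  have aH: "a \<in> H" using a I_props(1) by blast
  let ?Z = "{Q \<in> S. 0 < ord Q a}"
  have Z: "finite ?Z" "?Z \<subseteq> S" using finite_S_zeros[OF aH a(2)] by auto
  obtain c where c: "c \<in> I" "\<forall>Q\<in>?Z. c \<notin> Q" using prime_avoidance[OF a(1) no Z] by blast
  have cH: "c \<in> H" "c \<in> carrier F" using c I_props(1) H_carrier by auto
  have c0: "c \<noteq> \<zero>" "inv c \<in> VR Q" if "Q \<in> ?Z" for Q
  proof -
    have Q: "Q \<in> S" "c \<notin> Q" using that c by auto
    have z: "\<zero> \<in> Q" using zero_vpow[of Q 1] vpow_1[OF S_Places[OF Q(1)]] by simp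
    show nz: "c \<noteq> \<zero>" using z Q by auto
    have "c \<in> VR Q" using H_vpow[OF cH(1) Q(1)] vpow_0[OF S_Places[OF Q(1)]] by simp
    then show "inv c \<in> VR Q" using place_iff[OF S_Places[OF Q(1)], of c] Q(2) by blast
  qed
  define N where "N = nat (\<Sum>Q\<in>?Z. ord Q a)"
  have N: "ord Q a \<le> int N" if "Q \<in> ?Z" for Q
  proof -
    have "ord Q a \<le> (\<Sum>Q\<in>?Z. ord Q a)" by (rule member_le_sum) (use that Z in auto)
    then show ?thesis unfolding N_def by linarith
  qed
  obtain u where u: "u \<in> H" "\<forall>Q\<in>?Z. u \<ominus> inv c \<in> vpow Q (int N)"
    using H_approximation[OF Z, of "\<lambda>_. inv c" N] c0(2) by auto
  have uc: "u \<in> carrier F" using u H_carrier by blast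
  let ?y = "\<one> \<ominus> u \<otimes> c"
  have yH: "?y \<in> H" by (rule H_minus[OF H_closed(2) H_closed(4)[OF u(1) cH(1)]])
  have "?y \<in> vpow Q (ord Q a)" if Q: "Q \<in> S" "0 < ord Q a" for Q
  proof -
    have QZ: "Q \<in> ?Z" using Q by simp
    note QP = S_Places[OF Q(1)]
    have ic: "inv c \<in> carrier F" "c \<otimes> inv c = \<one>" using c0(1)[OF QZ] cH by auto
    have "c \<otimes> (u \<ominus> inv c) \<in> vpow Q (0 + int N)"
      using vpow_mult[OF QP H_vpow[OF cH(1) Q(1)]] u(2) QZ by blast
    moreover have "\<ominus> (c \<otimes> (u \<ominus> inv c)) = c \<otimes> inv c \<ominus> u \<otimes> c" using ic(1) uc cH(2) by algebra
    ultimately have "?y \<in> vpow Q (0 + int N)" using vpow_neg[OF QP] ic(2) by metis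
    then show ?thesis using vpow_mono[OF N[OF QZ], of Q] by auto
  qed
  then have q: "?y \<otimes> inv a \<in> H" by (rule H_divide[OF aH a(2) yH])
  have ac: "a \<in> carrier F" "inv a \<in> carrier F" "?y \<in> carrier F" using aH H_carrier a yH by auto
  have "(?y \<otimes> inv a) \<otimes> a = ?y" using ac a(2) by (simp add: m_assoc)
  then have "?y \<in> I" using I_props(3)[OF q a(1)] by simp
  moreover have "u \<otimes> c \<in> I" using I_props(3)[OF u(1) c(1)] .
  moreover have "?y \<oplus> u \<otimes> c = \<one>" using uc cH(2) by algebra
  ultimately show False using I_props(2,5) by metis
qed

text \<open>For \<open>h\<close> in \<open>Q\<close> the product \<open>s h^N\<close> is divisible
  by \<open>a\<close> when \<open>s\<close> is close to 1 at \<open>Q\<close> and vanishes to high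
  order at the other zeros of \<open>a\<close>. So it lies in \<open>I\<close>; as \<open>s\<close>
  does not, primality gives \<open>h\<close>.\<close>

lemma prime_ideal_eq_place:
  assumes a: "a \<in> I" "a \<noteq> \<zero>"
  shows "\<exists>Q\<in>S. I = Q \<inter> H"
proof -
  obtain Q where Q: "Q \<in> S" "I \<subseteq> Q" using prime_ideal_subset_place[OF a] by blast
  note QP = S_Places[OF Q(1)]
  have aH: "a \<in> H" "a \<in> carrier F" using a I_props(1) H_carrier by auto
  let ?Z = "insert Q {R \<in> S. 0 < ord R a}"
  have Z: "finite ?Z" "?Z \<subseteq> S" using finite_S_zeros[OF aH(1) a(2)] Q by auto
  \<comment> \<open>The successor keeps the precision at least 1, which is what makes
    \<open>s\<close> a unit at \<open>Q\<close>.\<close>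
  define N where "N = Suc (nat (\<Sum>R\<in>?Z. \<bar>ord R a\<bar>))"
  have N: "ord R a \<le> int N" if "R \<in> ?Z" for R
  proof -
    have "\<bar>ord R a\<bar> \<le> (\<Sum>R\<in>?Z. \<bar>ord R a\<bar>)" by (rule member_le_sum) (use that Z in auto)
    then show ?thesis unfolding N_def by linarith
  qed
  have "Q \<inter> H \<subseteq> I"
  proof
    fix h assume h: "h \<in> Q \<inter> H"
    then have hc: "h \<in> carrier F" "h \<in> H" "h \<in> vpow Q 1" using H_carrier vpow_1[OF QP] by auto
    let ?u = "\<lambda>R. if R = Q then \<one> else \<zero>"
    have "\<exists>s\<in>H. \<forall>R\<in>?Z. s \<ominus> ?u R \<in> vpow R (int N)"
      by (rule H_approximation[OF Z]) (use Z(2) VR_closed[OF S_Places] in auto)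
    then obtain s where s0: "s \<in> H" "\<forall>R\<in>?Z. s \<ominus> ?u R \<in> vpow R (int N)" by (rule bexE)
    note s = s0(1) bspec[OF s0(2)]
    have sc: "s \<in> carrier F" using s H_carrier by blast
    have sQ: "s \<notin> Q"
    proof
      assume A: "s \<in> Q"
      have "s \<ominus> \<one> \<in> vpow Q (int N)" using s(2)[of Q] by simp
      then have "s \<ominus> \<one> \<in> vpow Q 1" using vpow_mono[of 1 "int N" Q] by (auto simp: N_def)
      then have "s \<ominus> (s \<ominus> \<one>) \<in> vpow Q 1" using vpow_minus[OF QP] A vpow_1[OF QP] by blast
      moreover have "s \<ominus> (s \<ominus> \<one>) = \<one>" using sc by algebra
      ultimately show False using one_notin_place[OF QP] vpow_1[OF QP] by simp
    qed
    have pow: "h [^] k \<in> H \<and> h [^] k \<in> vpow Q (int k)" for k :: nat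
    proof (induction k)
      case 0
      then show ?case using H_closed(2) ord_one[OF QP] by (simp add: vpow_def)
    next
      case (Suc k)
      then show ?case using H_closed(4)[of "h [^] k" h] hc vpow_mult[OF QP, of "h [^] k" "int k" h 1]
        by (simp add: add.commute)
    qed
    let ?w = "s \<otimes> h [^] N"
    have "?w \<in> vpow R (ord R a)" if R: "R \<in> S" "0 < ord R a" for R
    proof -
      note RP = S_Places[OF R(1)]
      have RZ: "R \<in> ?Z" using R by simp
      have "?w \<in> vpow R (int N)"
      proof (cases "R = Q")
        case True
        then show ?thesis using vpow_mult[OF QP H_vpow[OF s(1) Q(1)]] pow[of N] by fastforce
      next
        case False
        then have "s \<in> vpow R (int N)" using s(2)[OF RZ] sc by (simp add: a_minus_def)
        then show ?thesis using vpow_mult[OF RP _ H_vpow[OF _ R(1)], of s "int N" "h [^] N"] pow[of N] by simp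
      qed
      then show ?thesis using vpow_mono[OF N[OF RZ], of R] by blast
    qed
    moreover have wH: "?w \<in> H" using H_closed(4)[OF s(1)] pow by blast
    ultimately have "?w \<otimes> inv a \<in> H" using H_divide[OF aH(1) a(2)] by blast
    then have "(?w \<otimes> inv a) \<otimes> a \<in> I" using I_props(3) a(1) by blast
    moreover have "(?w \<otimes> inv a) \<otimes> a = ?w" using wH H_carrier aH a(2) by (simp add: m_assoc)
    ultimately have "s \<in> I \<or> h [^] N \<in> I" using I_props(6)[OF s(1)] pow by metis
    then have hN: "h [^] N \<in> I" using sQ Q(2) by blast
    have "h [^] k \<in> I \<Longrightarrow> h \<in> I" for k :: nat
    proof (induction k)
      case 0
      then show ?case using I_props(5) by simp
    next
      case (Suc k)
      then show ?case using I_props(6)[of "h [^] k" h] pow[of k] hc by auto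
    qed
    then show "h \<in> I" using hN by blast
  qed
  then show ?thesis using Q I_props(1) by blast
qed

end

text \<open>For the converse choose \<open>t\<close> in \<open>H\<close> with a simple zero at
  \<open>Q\<close>, and write \<open>h = s h + (1 - s) h\<close>. The factor \<open>s\<close>, close
  to 1 at \<open>Q\<close>, kills the other zeros of \<open>t\<close>, so \<open>t^2\<close> divides
  \<open>s h\<close>; the second summand is a product of two elements of \<open>Q\<close>.\<close>

lemma ideal_prod_place_iff:
  assumes Q: "Q \<in> S" and h: "h \<in> H"
  shows "h \<in> ideal_prod (F\<lparr>carrier := H\<rparr>) (Q \<inter> H) (Q \<inter> H) \<longleftrightarrow> h \<in> vpow Q 2"
proof
  note QP = S_Places[OF Q] and v1 = vpow_1[OF S_Places[OF Q]]
  show "h \<in> vpow Q 2" if "h \<in> ideal_prod (F\<lparr>carrier := H\<rparr>) (Q \<inter> H) (Q \<inter> H)"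
    using that
  proof induction
    case (prod i j)
    then show ?case using vpow_mult[OF QP, of i 1 j 1] v1 by simp
  next
    case (sum a b)
    then show ?case using vpow_add[OF QP] by simp
  qed
  assume h2: "h \<in> vpow Q 2"
  have hc: "h \<in> carrier F" using h H_carrier by blast
  \<comment> \<open>\<open>p\<close> has order 1 at \<open>Q\<close> but may have poles in
    \<open>S\<close>. Approximating it modulo \<open>Q^2\<close> yields \<open>t\<close> in
    \<open>H\<close> of the same order.\<close>
  obtain p where p: "p \<in> carrier F" "p \<noteq> \<zero>" "ord Q p = 1" using exists_ord[OF QP] by blast
  have pV: "p \<in> VR Q" using ord_nonneg_iff[OF QP p(1,2)] p by simp
  have "\<exists>t\<in>H. \<forall>R\<in>{Q}. t \<ominus> p \<in> vpow R (int 2)"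
    by (rule H_approximation) (use Q pV in auto)
  then obtain t where t: "t \<in> H" "t \<ominus> p \<in> vpow Q 2" by auto
  have tc: "t \<in> carrier F" using t H_carrier by blast
  have "p \<oplus> (t \<ominus> p) = t" using p(1) tc by algebra
  then have t1: "t \<noteq> \<zero>" "ord Q t = 1"
    using ord_add_strict[OF QP p(1,2), of "t \<ominus> p"] t(2) p tc by auto
  have tQ: "t \<in> Q \<inter> H" using ord_pos_iff[OF QP tc t1(1)] t1 t by simp
  let ?a = "t \<otimes> t"
  have a: "?a \<in> H" "?a \<noteq> \<zero>" using t t1 tc mult_nz H_closed by auto
  have oa: "ord R ?a = 2 * ord R t" if "R \<in> S" for R
    using ord_mult[OF S_Places[OF that] tc t1(1) tc t1(1)] by simp
  let ?Z = "insert Q {R \<in> S. 0 < ord R ?a}"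
  have Z: "finite ?Z" "?Z \<subseteq> S" using finite_S_zeros[OF a] Q by auto
  define N where "N = Suc (nat (\<Sum>R\<in>?Z. \<bar>ord R ?a\<bar>))"
  have N: "ord R ?a \<le> int N" if "R \<in> ?Z" for R
  proof -
    have "\<bar>ord R ?a\<bar> \<le> (\<Sum>R\<in>?Z. \<bar>ord R ?a\<bar>)" by (rule member_le_sum) (use that Z in auto)
    then show ?thesis unfolding N_def by linarith
  qed
  let ?u = "\<lambda>R. if R = Q then \<one> else \<zero>"
  have "\<exists>s\<in>H. \<forall>R\<in>?Z. s \<ominus> ?u R \<in> vpow R (int N)"
    by (rule H_approximation[OF Z]) (use Z(2) VR_closed[OF S_Places] in auto)
  then obtain s where s0: "s \<in> H" "\<forall>R\<in>?Z. s \<ominus> ?u R \<in> vpow R (int N)" by (rule bexE)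
    note s = s0(1) bspec[OF s0(2)]
  have sc: "s \<in> carrier F" using s H_carrier by blast
  have shH: "s \<otimes> h \<in> H" by (rule H_closed(4)[OF s(1) h])
  have "s \<otimes> h \<in> vpow R (ord R ?a)" if R: "R \<in> S" "0 < ord R ?a" for R
  proof (cases "R = Q")
    case True
    then show ?thesis using vpow_mult[OF QP H_vpow[OF s(1) Q] h2] oa[OF Q] t1 by simp
  next
    case False
    have RZ: "R \<in> ?Z" using R by simp
    have "s \<in> vpow R (int N)" using False s(2)[OF RZ] sc by (simp add: a_minus_def)
    then have "s \<otimes> h \<in> vpow R (int N + 0)" using vpow_mult[OF S_Places[OF R(1)] _ H_vpow[OF h R(1)]] by blast
    then show ?thesis using vpow_mono[OF N[OF RZ], of R] by auto
  qed
  then have w: "(s \<otimes> h) \<otimes> inv ?a \<in> H" by (rule H_divide[OF a shH])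
  let ?w = "(s \<otimes> h) \<otimes> inv ?a"
  have wc: "?w \<in> carrier F" using w H_carrier by blast
  have aic: "inv ?a \<in> carrier F" using a H_carrier by auto
  have "t \<otimes> (t \<otimes> ?w) = (s \<otimes> h) \<otimes> (?a \<otimes> inv ?a)" using tc sc hc aic by algebra
  also have "?a \<otimes> inv ?a = \<one>" using a H_carrier by simp
  finally have tw: "t \<otimes> (t \<otimes> ?w) = s \<otimes> h" using sc hc by simp
  have "\<one> \<ominus> s \<in> Q \<inter> H"
  proof -
    have "s \<ominus> \<one> \<in> vpow Q (int N)" using s(2)[of Q] by simp
    then have "s \<ominus> \<one> \<in> vpow Q 1" using vpow_mono[of 1 "int N" Q] by (auto simp: N_def)
    then have "\<ominus> (s \<ominus> \<one>) \<in> vpow Q 1" using vpow_neg[OF QP] by blast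
    moreover have "\<ominus> (s \<ominus> \<one>) = \<one> \<ominus> s" using sc by algebra
    ultimately show ?thesis using v1 H_minus[OF H_closed(2) s(1)] by simp
  qed
  moreover have "h \<in> Q \<inter> H" using h h2 vpow_mono[of 1 2 Q] v1 by auto
  moreover have "t \<otimes> ?w \<in> Q \<inter> H"
    using vpow_mult[OF QP _ H_vpow[OF w Q], of t 1] tQ v1 H_closed(4)[OF t(1) w] by simp
  ultimately have "t \<otimes> (t \<otimes> ?w) \<oplus> (\<one> \<ominus> s) \<otimes> h \<in> ideal_prod (F\<lparr>carrier := H\<rparr>) (Q \<inter> H) (Q \<inter> H)"
    using ideal_prod.sum[OF ideal_prod.prod[OF tQ, of "t \<otimes> ?w" _ "F\<lparr>carrier := H\<rparr>"] ideal_prod.prod[of "\<one> \<ominus> s" _ h _ "F\<lparr>carrier := H\<rparr>"]]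
    by simp
  moreover have "t \<otimes> (t \<otimes> ?w) \<oplus> (\<one> \<ominus> s) \<otimes> h = h" unfolding tw using sc hc by algebra
  ultimately show "h \<in> ideal_prod (F\<lparr>carrier := H\<rparr>) (Q \<inter> H) (Q \<inter> H)" by simp
qed

section \<open>Eisenstein polynomials\<close>

lemma coeff_monic:
  assumes hs: "set hs \<subseteq> H"
  shows "i < length hs \<Longrightarrow> ring.coeff (F\<lparr>carrier := H\<rparr>) (\<one> # rev hs) i = hs ! i"
    and "ring.coeff (F\<lparr>carrier := H\<rparr>) (\<one> # rev hs) (length hs) = \<one>"
proof -
  interpret R: ring "F\<lparr>carrier := H\<rparr>" by (rule subring_is_ring[OF H_subring])
  show "R.coeff (\<one> # rev hs) i = hs ! i" if "i < length hs"
    using that R.coeff_nth[of i "\<one> # rev hs"] by (simp add: nth_Cons' rev_nth)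
  show "R.coeff (\<one> # rev hs) (length hs) = \<one>"
    using R.coeff_nth[of "length hs" "\<one> # rev hs"] by simp
qed

lemma monic_eisenstein_iff:
  assumes hs: "set hs \<subseteq> H" "hs \<noteq> []"
  shows "eisenstein (F\<lparr>carrier := H\<rparr>) (\<one> # rev hs) \<longleftrightarrow> (\<exists>Q\<in>S. set hs \<subseteq> Q \<and> hd hs \<notin> vpow Q 2)"
proof -
  let ?R = "F\<lparr>carrier := H\<rparr>" and ?f = "\<one> # rev hs"
  interpret R: ring ?R by (rule subring_is_ring[OF H_subring])
  have deg: "degree ?f = length hs" by simp
  have poly: "?f \<in> carrier (poly_ring ?R)"
    using hs H_closed(2) by (auto simp: univ_poly_def polynomial_def)
  have all: "(\<forall>i<degree ?f. ring.coeff ?R ?f i \<in> I) \<longleftrightarrow> set hs \<subseteq> I" for I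
    unfolding deg using coeff_monic(1)[OF hs(1)]
    by (simp add: subset_code(1) all_set_conv_all_nth del: R.coeff.simps)
  have c0: "ring.coeff ?R ?f 0 = hd hs" using coeff_monic(1)[OF hs(1), of 0] hs(2) by (simp add: hd_conv_nth)
  have cd: "ring.coeff ?R ?f (degree ?f) = \<one>" unfolding deg by (rule coeff_monic(2)[OF hs(1)])
  have hH: "hd hs \<in> H" using hs by (cases hs) auto
  have E: "eisenstein ?R ?f \<longleftrightarrow>
      (\<exists>I. primeideal I ?R \<and> set hs \<subseteq> I \<and> hd hs \<notin> ideal_prod ?R I I \<and> \<one> \<notin> I)"
    unfolding eisenstein_def using poly all c0 cd by simp
  show ?thesis
  proof
    assume "eisenstein ?R ?f"
    then obtain I where I: "primeideal I ?R" "set hs \<subseteq> I" "hd hs \<notin> ideal_prod ?R I I" using E by blast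
    have hI: "hd hs \<in> I" using I(2) hs(2) by (cases hs) auto
    \<comment> \<open>The zero ideal is no witness: the constant coefficient would be zero, which is
      the product of zero with itself and so lies in the square.\<close>
    have "\<exists>a\<in>I. a \<noteq> \<zero>"
    proof (rule ccontr)
      assume "\<not> ?thesis"
      then have z: "hd hs = \<zero>" using hI by blast
      have "hd hs \<otimes> hd hs \<in> ideal_prod ?R I I" using ideal_prod.prod[OF hI hI, of ?R] by simp
      then show False using I(3) z by simp
    qed
    then obtain Q where Q: "Q \<in> S" "I = Q \<inter> H" using prime_ideal_eq_place[OF I(1)] by blast
    then show "\<exists>Q\<in>S. set hs \<subseteq> Q \<and> hd hs \<notin> vpow Q 2"
      using I(2,3) ideal_prod_place_iff[OF Q(1) hH] by auto
  next
    assume "\<exists>Q\<in>S. set hs \<subseteq> Q \<and> hd hs \<notin> vpow Q 2"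
    then obtain Q where Q: "Q \<in> S" "set hs \<subseteq> Q" "hd hs \<notin> vpow Q 2" by blast
    then show "eisenstein ?R ?f"
      unfolding E using H_primeideal_place[OF Q(1)] ideal_prod_place_iff[OF Q(1) hH] hs(1)
        one_notin_place[OF S_Places[OF Q(1)]] by (intro exI[of _ "Q \<inter> H"]) auto
  qed
qed

end

section \<open>Counting lists\<close>

lemma card_lists_nth:
  assumes "\<And>i. i < d \<Longrightarrow> finite (A i) \<and> card (A i) = c"
  shows "finite {xs. length xs = d \<and> (\<forall>i<d. xs ! i \<in> A i)} \<and>
    card {xs. length xs = d \<and> (\<forall>i<d. xs ! i \<in> A i)} = c ^ d"
  using assms
proof (induction d)
  case 0
  have "{xs::'a list. length xs = 0 \<and> (\<forall>i<0. xs ! i \<in> A i)} = {[]}" by auto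
  then show ?case by simp
next
  case (Suc d)
  let ?B = "{xs. length xs = d \<and> (\<forall>i<d. xs ! i \<in> A i)}"
  let ?C = "{xs. length xs = Suc d \<and> (\<forall>i<Suc d. xs ! i \<in> A i)}"
  let ?f = "\<lambda>(xs, y). xs @ [y]"
  have IH: "finite ?B" "card ?B = c ^ d" using Suc by auto
  have eq: "?C = ?f ` (?B \<times> A d)"
  proof (intro equalityI subsetI)
    fix xs assume xs: "xs \<in> ?C"
    then obtain ys y where y: "xs = ys @ [y]" by (cases xs rule: rev_cases) auto
    have "ys ! i \<in> A i" if "i < d" for i
    proof -
      have "xs ! i \<in> A i" using xs that by simp
      then show ?thesis using y xs that by (simp add: nth_append)
    qed
    moreover have "y \<in> A d"
    proof -
      have "xs ! d \<in> A d" using xs by simp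
      then show ?thesis using y xs by (simp add: nth_append)
    qed
    ultimately show "xs \<in> ?f ` (?B \<times> A d)" using y xs by force
  next
    fix xs assume "xs \<in> ?f ` (?B \<times> A d)"
    then show "xs \<in> ?C" by (auto simp: nth_append less_Suc_eq)
  qed
  have "inj_on ?f (?B \<times> A d)" by (auto simp: inj_on_def)
  then have "card ?C = card (?B \<times> A d)" unfolding eq by (rule card_image)
  then show ?case unfolding eq using IH Suc.prems[of d] by (simp add: card_cartesian_product mult.commute)
qed

lemma sum_linear_geometric_le: "(\<Sum>m\<le>M. real m / 2 ^ m) \<le> 2"
proof -
  have "(\<Sum>m\<le>M. real m / 2 ^ m) = 2 - (real M + 2) / 2 ^ M"
    by (induction M) (auto simp: field_simps)
  then show ?thesis by simp
qed

section \<open>Unordered sums and products over arbitrary index sets\<close>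

lemma exists_small_tail:
  fixes f :: "'b \<Rightarrow> real"
  assumes pos: "\<And>x. x \<in> A \<Longrightarrow> 0 \<le> f x" and bound: "\<And>T. finite T \<Longrightarrow> T \<subseteq> A \<Longrightarrow> sum f T \<le> B"
    and e: "0 < e"
  shows "\<exists>T. finite T \<and> T \<subseteq> A \<and> (\<forall>T'. finite T' \<and> T' \<subseteq> A - T \<longrightarrow> sum f T' \<le> e)"
proof -
  let ?S = "{sum f T | T. finite T \<and> T \<subseteq> A}"
  have bdd: "bdd_above ?S" using bound by (auto intro!: bdd_aboveI[of _ B])
  have ne: "?S \<noteq> {}" by blast
  have "Sup ?S - e < Sup ?S" using e by simp
  then obtain T where T: "finite T" "T \<subseteq> A" "Sup ?S - e < sum f T" using less_cSup_iff[OF ne bdd] by blast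
  have "sum f T' \<le> e" if T': "finite T'" "T' \<subseteq> A - T" for T'
  proof -
    have "sum f (T \<union> T') = sum f T + sum f T'" using T T' by (intro sum.union_disjoint) auto
    moreover have "sum f (T \<union> T') \<le> Sup ?S"
      by (rule cSup_upper[OF _ bdd]) (use T T' in \<open>auto intro!: exI[of _ "T \<union> T'"]\<close>)
    ultimately show ?thesis using T(3) by linarith
  qed
  then show ?thesis using T by blast
qed

text \<open>Finite products of factors in the unit interval decrease as the index set grows, so the
  limit is their infimum. The density estimate uses the two characteristic properties of that
  infimum.\<close>

lemma has_unordered_prod_Inf:
  fixes f :: "'b \<Rightarrow> real"
  assumes f: "\<And>x. x \<in> A \<Longrightarrow> 0 \<le> f x \<and> f x \<le> 1"
  shows "\<exists>p. has_unordered_prod f p A \<and> (\<forall>T. finite T \<and> T \<subseteq> A \<longrightarrow> p \<le> prod f T) \<and>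
    (\<forall>e>0. \<exists>T. finite T \<and> T \<subseteq> A \<and> prod f T < p + e)"
proof -
  let ?S = "{prod f T | T. finite T \<and> T \<subseteq> A}"
  define p where "p = Inf ?S"
  have nn: "0 \<le> prod f T" if "T \<subseteq> A" for T using that f by (intro prod_nonneg) auto
  have bdd: "bdd_below ?S" using nn by (auto intro!: bdd_belowI[of _ 0])
  have ne: "?S \<noteq> {}" by blast
  have low: "p \<le> prod f T" if "finite T" "T \<subseteq> A" for T
    unfolding p_def by (rule cInf_lower[OF _ bdd]) (use that in blast)
  have up: "\<exists>T. finite T \<and> T \<subseteq> A \<and> prod f T < p + e" if "e > 0" for e
  proof -
    have "Inf ?S < p + e" using that by (simp add: p_def)
    then show ?thesis using cInf_less_iff[OF ne bdd] by blast
  qed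
  have anti: "prod f T' \<le> prod f T" if "finite T'" "T \<subseteq> T'" "T' \<subseteq> A" for T T'
  proof -
    have "prod f T' = prod f (T' - T) * prod f T" using that prod.subset_diff by blast
    also have "\<dots> \<le> 1 * prod f T"
      by (intro mult_right_mono nn prod_le_1) (use that f in auto)
    finally show ?thesis by simp
  qed
  have "(prod f \<longlongrightarrow> p) (finite_subsets_at_top A)"
  proof (rule tendstoI)
    fix e :: real assume e: "0 < e"
    obtain T where T: "finite T" "T \<subseteq> A" "prod f T < p + e" using up[OF e] by blast
    have "\<forall>T'. finite T' \<and> T \<subseteq> T' \<and> T' \<subseteq> A \<longrightarrow> dist (prod f T') p < e"
    proof (intro allI impI)
      fix T' assume T': "finite T' \<and> T \<subseteq> T' \<and> T' \<subseteq> A"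
      have "p \<le> prod f T'" "prod f T' \<le> prod f T" using T' by (auto intro: low anti)
      then show "dist (prod f T') p < e" using T(3) by (simp add: dist_real_def)
    qed
    then show "\<forall>\<^sub>F T' in finite_subsets_at_top A. dist (prod f T') p < e"
      unfolding eventually_finite_subsets_at_top using T(1,2) by (intro exI[of _ T] conjI)
  qed
  then show ?thesis unfolding has_unordered_prod_def using low up by blast
qed

section \<open>The number of places of given degree\<close>

context global_function_field
begin

lemma transversal_card_le:
  assumes T: "transversal T A B" and U: "transversal U A B" and lin: "lin_sub K A" "lin_sub K B"
  shows "card T \<le> card U"
proof -
  have TU: "T \<subseteq> A" "U \<subseteq> A" "finite U" using T U by (auto simp: transversal_def)
  note Ac = lin_subD(1)[OF lin(1)]
  have "\<forall>r\<in>T. \<exists>u\<in>U. r \<ominus> u \<in> B" using transversal_ex[OF U] TU by blast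
  then obtain f where f: "\<And>r. r \<in> T \<Longrightarrow> f r \<in> U" "\<And>r. r \<in> T \<Longrightarrow> r \<ominus> f r \<in> B" by metis
  have neg: "f r \<ominus> r \<in> B" if r: "r \<in> T" for r
  proof -
    have c: "r \<in> carrier F" "f r \<in> carrier F" using r f(1) TU Ac by blast+
    have "f r \<ominus> r = \<ominus> (r \<ominus> f r)" using c by algebra
    then show ?thesis using lin_sub_neg[OF lin(2) K_subfield f(2)[OF r]] by simp
  qed
  have "inj_on f T"
  proof (rule inj_onI)
    fix r s assume A: "r \<in> T" "s \<in> T" "f r = f s"
    have "f r \<in> A" using f(1)[OF A(1)] TU by blast
    then show "r = s" using transversal_uniq[OF T _ A(1,2) neg[OF A(1)]] neg[OF A(2)] A(3) by simp
  qed
  then show ?thesis using f(1) TU(3) by (intro card_inj_on_le[of f]) auto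
qed

lemma ev_in_L_poles:
  assumes x: "x \<in> carrier F" "x \<noteq> \<zero>" and cs: "set cs \<subseteq> K" "length cs \<le> Suc m"
  shows "ev x cs \<in> L (\<lambda>P. int m * poles x P)"
  using cs
proof (induction cs arbitrary: m)
  case Nil
  then show ?case using lin_subD(2)[OF L_lin_sub] by simp
next
  case (Cons c cs)
  have pos: "0 \<le> poles x P" for P by (simp add: poles_def)
  have "L (\<lambda>_. 0) \<subseteq> L (\<lambda>P. int m * poles x P)" by (rule L_mono) (use pos in simp)
  then have c: "c \<in> L (\<lambda>P. int m * poles x P)" using Cons.prems L_zero by auto
  have "x \<otimes> ev x cs \<in> L (\<lambda>P. int m * poles x P)"
  proof (cases m)
    case 0
    then have "cs = []" using Cons.prems by simp
    then show ?thesis using x lin_subD(2)[OF L_lin_sub] by simp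
  next
    case (Suc k)
    have xL: "x \<in> L (poles x)" using x by (auto simp: L_def poles_def)
    have "ev x cs \<in> L (\<lambda>P. int k * poles x P)" using Cons Suc by simp
    from L_mult[OF xL this] show ?thesis using Suc by (simp add: algebra_simps)
  qed
  then show ?case using c lin_subD(3)[OF L_lin_sub] by simp
qed

text \<open>A common zero at all of \<open>T\<close> makes \<open>p\<close> a nonzero section of
  \<open>m * poles x - T\<close>, whose degree therefore cannot be negative.\<close>

lemma card_zeros_le:
  assumes x: "x \<in> carrier F" "x \<noteq> \<zero>" and p: "p \<in> L (\<lambda>P. int m * poles x P)" "p \<noteq> \<zero>"
    and T: "finite T" "T \<subseteq> Places" "\<And>Q. Q \<in> T \<Longrightarrow> p \<in> Q \<and> x \<in> VR Q"
  shows "card T \<le> m * xrank x"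
proof -
  let ?A = "\<lambda>P. int m * poles x P - ind_div T 1 P"
  have f: "fsupp (\<lambda>P. int m * poles x P)" using fsupp_scale[OF fsupp_poles[OF x]] .
  have fA: "fsupp ?A" using fsupp_diff[OF f fsupp_ind_div[OF T(1)]] .
  have pc: "p \<in> carrier F" using p L_carrier by blast
  have "- ?A P \<le> ord P p" if P: "P \<in> Places" for P
  proof (cases "P \<in> T")
    case True
    have "1 \<le> ord P p" using ord_pos_iff[OF P pc p(2)] T(3)[OF True] by simp
    moreover have "poles x P = 0" using ord_nonneg_iff[OF P x] T(3)[OF True] by (simp add: poles_def)
    ultimately show ?thesis using True by (simp add: ind_div_def)
  next
    case False
    then show ?thesis using p P by (auto simp: L_def ind_div_def)
  qed
  then have "p \<in> L ?A" using pc by (simp add: L_def)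
  then have "0 \<le> ddeg ?A" using ell_le_ddeg(2)[OF fA _ p(2)] by blast
  moreover have "ddeg ?A = int m * ddeg (poles x) - ddeg (ind_div T 1)"
    using ddeg_add(2)[OF f fsupp_ind_div[OF T(1)]] ddeg_scale[OF fsupp_poles[OF x]] by simp
  moreover have "ddeg (ind_div T 1) = (\<Sum>Q\<in>T. int (place_deg F K Q))"
    using ddeg_eq[OF T(1,2), of "ind_div T 1"] by (simp add: ind_div_def)
  moreover have "(\<Sum>Q\<in>T. 1) \<le> (\<Sum>Q\<in>T. int (place_deg F K Q))"
    using place_deg_pos T(2) by (intro sum_mono) force
  moreover have "int m * ddeg (poles x) \<le> int m * int (xrank x)"
    using ddeg_poles_le[OF x] by (intro mult_left_mono) auto
  ultimately have "int (card T) \<le> int m * int (xrank x)" by simp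
  then show ?thesis by (simp only: of_nat_le_iff flip: of_nat_mult)
qed

text \<open>Pigeonhole: there are \<open>q\<close> times as many polynomials with
  \<open>deg Q + 1\<close> coefficients as residue classes at \<open>Q\<close>, so two of them are
  congruent.\<close>

lemma exists_polynomial_in_place:
  assumes x: "x \<in> carrier F" "x \<notin> K" and Q: "Q \<in> Places" "x \<in> VR Q"
  shows "\<exists>p\<in>evs K x (Suc (place_deg F K Q)). p \<noteq> \<zero> \<and> p \<in> Q"
proof -
  let ?m = "Suc (place_deg F K Q)"
  let ?Y = "{cs. set cs \<subseteq> K \<and> length cs = ?m}"
  have xf: "xfree x K" unfolding xfree_def using ev_K_eq_zero[OF x] by (simp add: lin_sub_def K_sub)
  have inj: "inj_on (ev x) ?Y" by (rule inj_on_ev_xfree[OF x(1) xf])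
  have eY: "evs K x ?m = ev x ` ?Y" by (rule PL_eq_image)
  then have card: "card (evs K x ?m) = q ^ ?m" using card_image[OF inj] card_lists_length_eq[OF finite_K] by simp
  have sub: "evs K x ?m \<subseteq> VR Q"
  proof
    fix p assume "p \<in> evs K x ?m"
    then obtain cs where cs: "set cs \<subseteq> K" "p = ev x cs" by (metis evs_E)
    have "set cs \<subseteq> K \<Longrightarrow> ev x cs \<in> VR Q"
      using VR_closed(2,5,6)[OF Q(1)] VR_props(2)[OF Q(1)] Q(2) by (induction cs) auto
    then show "p \<in> VR Q" using cs by simp
  qed
  obtain t where t: "transversal t (VR Q) Q" "card t = q ^ place_deg F K Q"
    using residue_transversal[OF Q(1)] by blast
  have tf: "finite t" "t \<subseteq> VR Q" using t by (auto simp: transversal_def)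
  have "\<forall>p\<in>evs K x ?m. \<exists>r\<in>t. p \<ominus> r \<in> Q" using transversal_ex[OF t(1)] sub by blast
  then obtain f where f: "\<And>p. p \<in> evs K x ?m \<Longrightarrow> f p \<in> t" "\<And>p. p \<in> evs K x ?m \<Longrightarrow> p \<ominus> f p \<in> Q" by metis
  have "\<not> inj_on f (evs K x ?m)"
  proof
    assume "inj_on f (evs K x ?m)"
    then have "card (evs K x ?m) \<le> card t" using f(1) tf(1) by (intro card_inj_on_le[of f]) auto
    then have "?m \<le> place_deg F K Q" unfolding card t(2) power_q_le_iff .
    then show False by simp
  qed
  then obtain p r where pr: "p \<in> evs K x ?m" "r \<in> evs K x ?m" "f p = f r" "p \<noteq> r" by (auto simp: inj_on_def)
  have c: "p \<in> carrier F" "r \<in> carrier F" "f r \<in> carrier F"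
    using pr sub f(1) tf(2) VR_closed(1)[OF Q(1)] by auto
  have "p \<ominus> r = (p \<ominus> f r) \<ominus> (r \<ominus> f r)" using c by algebra
  moreover have "p \<ominus> f r \<in> Q" using f(2)[OF pr(1)] pr(3) by simp
  ultimately have "p \<ominus> r \<in> Q"
    using vpow_minus[OF Q(1), of "p \<ominus> f r" 1 "r \<ominus> f r"] vpow_1[OF Q(1)] f(2)[OF pr(2)] pr(3) by simp
  moreover have "p \<ominus> r \<noteq> \<zero>" using pr(4) c by simp
  moreover have "p \<ominus> r \<in> evs K x ?m"
    using PL_add[OF x(1) pr(1) PL_uminus[OF x(1) pr(2)]] by (simp add: a_minus_def)
  ultimately show ?thesis by blast
qed

text \<open>Each such place contains one of at most \<open>q^(m+1)\<close> polynomials of degree at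
  most \<open>m\<close> in \<open>x\<close>, and each of these has at most
  \<open>m * xrank x\<close> zeros.\<close>

lemma card_places_of_degree_le:
  assumes x: "x \<in> carrier F" "x \<notin> K"
    and T: "finite T" "T \<subseteq> Places" "\<And>Q. Q \<in> T \<Longrightarrow> x \<in> VR Q \<and> place_deg F K Q = m"
  shows "card T \<le> q ^ Suc m * (m * xrank x)"
proof -
  have x0: "x \<noteq> \<zero>" using x by auto
  let ?E = "evs K x (Suc m) - {\<zero>}"
  have "T \<subseteq> (\<Union>p\<in>?E. {Q \<in> T. p \<in> Q})"
  proof
    fix Q assume Q: "Q \<in> T"
    then show "Q \<in> (\<Union>p\<in>?E. {Q \<in> T. p \<in> Q})"
      using exists_polynomial_in_place[OF x, of Q] T(2) T(3)[OF Q] by auto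
  qed
  then have "card T \<le> card (\<Union>p\<in>?E. {Q \<in> T. p \<in> Q})"
    using T(1) finite_PL by (intro card_mono) auto
  also have "\<dots> \<le> (\<Sum>p\<in>?E. card {Q \<in> T. p \<in> Q})"
    using finite_PL by (intro card_UN_le) auto
  also have "\<dots> \<le> (\<Sum>p\<in>?E. m * xrank x)"
  proof (rule sum_mono)
    fix p assume p: "p \<in> ?E"
    then obtain cs where cs: "set cs \<subseteq> K" "length cs = Suc m" "p = ev x cs" by (metis DiffD1 evs_E)
    have "p \<in> L (\<lambda>P. int m * poles x P)" using ev_in_L_poles[OF x(1) x0 cs(1)] cs by simp
    then show "card {Q \<in> T. p \<in> Q} \<le> m * xrank x"
      using p T by (intro card_zeros_le[OF x(1) x0]) auto
  qed
  also have "\<dots> \<le> q ^ Suc m * (m * xrank x)"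
  proof -
    have "card ?E \<le> card (evs K x (Suc m))" using finite_PL by (intro card_mono) auto
    then have "card ?E \<le> q ^ Suc m" using card_PL[of x "Suc m"] by linarith
    then show ?thesis by (simp only: sum_constant mult_le_mono1 of_nat_id)
  qed
  finally show ?thesis .
qed

lemma places_sum_bounded:
  assumes "Places \<noteq> {}"
  shows "\<exists>B. \<forall>T. finite T \<and> T \<subseteq> Places \<longrightarrow> (\<Sum>Q\<in>T. 1 / real q ^ (2 * place_deg F K Q)) \<le> B"
proof -
  obtain x where x: "x \<in> carrier F" "x \<notin> K" using place_imp_not_K assms by blast
  have x0: "x \<noteq> \<zero>" using x by auto
  \<comment> \<open>The pigeonhole argument needs \<open>x\<close> to be integral at
    \<open>Q\<close>. The finitely many poles of \<open>x\<close> are split off, with a contribution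
    of at most 1 each.\<close>
  let ?N = "{Q \<in> Places. x \<notin> VR Q}"
  have "?N \<subseteq> {Q \<in> Places. ord Q x \<noteq> 0}" 
  proof clarify
    fix Q assume "Q \<in> Places" "x \<notin> VR Q" "ord Q x = 0"
    then show False using ord_nonneg_iff[of Q x] x(1) x0 by simp
  qed
  then have finN: "finite ?N" using finite_ord_support[OF x(1) x0] finite_subset by blast
  let ?f = "\<lambda>Q. 1 / real q ^ (2 * place_deg F K Q)"
  let ?n = "real (xrank x)"
  have q2: "2 \<le> real q" using q_ge_2 by simp
  have "sum ?f T \<le> real (card ?N) + 2 * (real q * ?n)" if T: "finite T" "T \<subseteq> Places" for T
  proof -
    let ?T1 = "T \<inter> ?N" and ?T2 = "T - ?N"
    have "sum ?f ?T1 \<le> (\<Sum>Q\<in>?T1. 1)" using q2 by (intro sum_mono) (simp add: divide_le_eq)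
    also have "\<dots> \<le> real (card ?N)" using card_mono[OF finN, of ?T1] by simp
    finally have 1: "sum ?f ?T1 \<le> real (card ?N)" .
    define M where "M = Max (insert 0 (place_deg F K ` ?T2))"
    have M: "place_deg F K ` ?T2 \<subseteq> {..M}" unfolding M_def using T by auto
    have "sum ?f ?T2 = (\<Sum>m\<le>M. \<Sum>Q\<in>{Q \<in> ?T2. place_deg F K Q = m}. ?f Q)"
      using T M by (intro sum.group[symmetric]) auto
    also have "\<dots> \<le> (\<Sum>m\<le>M. real q * ?n * (real m / 2 ^ m))"
    proof (rule sum_mono)
      fix m
      let ?U = "{Q \<in> ?T2. place_deg F K Q = m}"
      have "(\<Sum>Q\<in>?U. ?f Q) = real (card ?U) / real q ^ (2 * m)" by simp
      also have "\<dots> \<le> real (q ^ Suc m * (m * xrank x)) / real q ^ (2 * m)"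
      proof (intro divide_right_mono of_nat_mono)
        show "card ?U \<le> q ^ Suc m * (m * xrank x)"
          by (rule card_places_of_degree_le[OF x]) (use T in auto)
      qed simp
      also have "\<dots> = real q * ?n * (real m / real q ^ m)"
        using q2 unfolding mult_2 power_add power_Suc of_nat_mult of_nat_power by (simp add: field_simps)
      also have "\<dots> \<le> real q * ?n * (real m / 2 ^ m)"
        using q2 by (intro mult_left_mono divide_left_mono power_mono) auto
      finally show "(\<Sum>Q\<in>?U. ?f Q) \<le> real q * ?n * (real m / 2 ^ m)" .
    qed
    also have "\<dots> = real q * ?n * (\<Sum>m\<le>M. real m / 2 ^ m)" by (simp add: sum_distrib_left)
    also have "\<dots> \<le> real q * ?n * 2" by (intro mult_left_mono sum_linear_geometric_le) simp
    finally have 2: "sum ?f ?T2 \<le> real q * ?n * 2" .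
    have "sum ?f T = sum ?f ?T1 + sum ?f ?T2" using T(1) by (rule sum.Int_Diff)
    then show ?thesis using 1 2 by simp
  qed
  then show ?thesis by blast
qed

end

section \<open>Local densities\<close>

context global_function_field
begin

text \<open>The Eisenstein condition at one place. For a nonempty list \<open>hd hs\<close> is the
  constant coefficient, as tuples begin with \<open>h_0\<close>.\<close>

definition eis :: "'a set \<Rightarrow> 'a list set" where
  "eis Q = {hs. set hs \<subseteq> Q \<and> hd hs \<notin> vpow Q 2}"

lemma vpow_congruent:
  assumes P: "P \<in> Places" and c: "a \<in> carrier F" "b \<in> carrier F" and ab: "a \<ominus> b \<in> vpow P k"
  shows "a \<in> vpow P k \<longleftrightarrow> b \<in> vpow P k"
proof -
  have "(a \<ominus> b) \<oplus> b = a" "a \<ominus> (a \<ominus> b) = b" using c by algebra+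
  then show ?thesis using vpow_add[OF P ab, of b] vpow_minus[OF P _ ab, of a] by auto
qed

text \<open>Membership in \<open>Q\<close> and in \<open>Q^2\<close> is visible modulo
  \<open>Q^2\<close>, so the condition can be counted on residues.\<close>

lemma eis_congruent:
  assumes P: "P \<in> Places" and len: "length as = length bs" "as \<noteq> []"
    and c: "set as \<subseteq> carrier F" "set bs \<subseteq> carrier F"
    and cong: "\<And>i. i < length as \<Longrightarrow> as ! i \<ominus> bs ! i \<in> vpow P 2"
  shows "as \<in> eis P \<longleftrightarrow> bs \<in> eis P"
proof -
  have ci: "as ! i \<in> carrier F" "bs ! i \<in> carrier F" if "i < length as" for i
    using c that len by (auto simp: subset_iff)
  have i1: "as ! i \<in> P \<longleftrightarrow> bs ! i \<in> P" if i: "i < length as" for i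
  proof -
    have "as ! i \<ominus> bs ! i \<in> vpow P 1" using cong[OF i] vpow_mono[of 1 2 P] by auto
    then show ?thesis using vpow_congruent[OF P ci[OF i], of 1] vpow_1[OF P] by simp
  qed
  have "as ! 0 \<in> vpow P 2 \<longleftrightarrow> bs ! 0 \<in> vpow P 2"
    using vpow_congruent[OF P ci cong] len(2) by blast
  then have "hd as \<in> vpow P 2 \<longleftrightarrow> hd bs \<in> vpow P 2" using len by (metis hd_conv_nth length_0_conv)
  moreover have "set as \<subseteq> P \<longleftrightarrow> set bs \<subseteq> P"
    unfolding subset_code(1) all_set_conv_all_nth using i1 len(1) by auto
  ultimately show ?thesis by (simp add: eis_def)
qed

text \<open>Of the \<open>q^(2e)\<close> classes modulo \<open>P^2\<close>, those inside
  \<open>P\<close> represent \<open>P/P^2\<close> and number \<open>q^e\<close>. The constant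
  coefficient avoids the zero class among them; each other coefficient may take all
  \<open>q^e\<close>.\<close>

lemma card_eis_transversal:
  assumes P: "P \<in> Places" and t: "transversal t (VR P) (vpow P 2)" "card t = q ^ (2 * place_deg F K P)"
    and d: "1 < d"
  defines "e \<equiv> place_deg F K P"
  shows "card {rs. set rs \<subseteq> t \<and> length rs = d \<and> rs \<in> eis P} = (q ^ e - 1) * q ^ (e * (d - 1))"
proof -
  have tf: "finite t" "t \<subseteq> VR P" using t by (auto simp: transversal_def)
  have tc: "t \<subseteq> carrier F" using tf VR_closed(1)[OF P] by blast
  note v = vpow_0[OF P] vpow_1[OF P]
  let ?t1 = "t \<inter> P"
  have tr1: "transversal ?t1 (vpow P 1) (vpow P 2)"
    unfolding transversal_def
  proof (intro conjI ballI)
    show "?t1 \<subseteq> vpow P 1" "finite ?t1" using tf v by auto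
    fix z assume z: "z \<in> vpow P 1"
    have zc: "z \<in> carrier F" "z \<in> VR P" using z vpow_carrier[of P 1] vpow_mono[of 0 1 P] v by auto
    obtain r where r: "r \<in> t" "z \<ominus> r \<in> vpow P 2" using transversal_ex[OF t(1) zc(2)] by blast
    have rc: "r \<in> carrier F" using r tc by blast
    have "z \<ominus> r \<in> vpow P 1" using r(2) vpow_mono[of 1 2 P] by auto
    then have "r \<in> P" using vpow_congruent[OF P zc(1) rc, of 1] z v by simp
    then show "\<exists>!r. r \<in> ?t1 \<and> z \<ominus> r \<in> vpow P 2"
      using r transversal_uniq[OF t(1) zc(2)] by (intro ex1I[of _ r]) blast+
  qed
  obtain u where u: "transversal u (vpow P 1) (vpow P (1 + int 1))" "card u = q ^ (1 * e)"
    using vpow_transversal[OF P, of 1 1] unfolding e_def by blast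
  have u': "transversal u (vpow P 1) (vpow P 2)" using u(1) by simp
  have card1: "card ?t1 = q ^ e"
    using transversal_card_le[OF tr1 u' vpow_lin_sub[OF P] vpow_lin_sub[OF P]]
      transversal_card_le[OF u' tr1 vpow_lin_sub[OF P] vpow_lin_sub[OF P]] u(2) by simp
  \<comment> \<open>The representative of the zero class; it need not be zero itself.\<close>
  obtain r0 where r0: "r0 \<in> ?t1" "\<zero> \<ominus> r0 \<in> vpow P 2" using transversal_ex[OF tr1 zero_vpow] by blast
  have r02: "r \<in> vpow P 2 \<longleftrightarrow> r = r0" if r: "r \<in> ?t1" for r
  proof -
    have c: "r \<in> carrier F" "r0 \<in> carrier F" using r r0 tc by auto
    have z0: "r0 \<in> vpow P 2" using vpow_congruent[OF P zero_closed c(2) r0(2)] zero_vpow by simp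
    have "r = r0" if "r \<in> vpow P 2"
    proof -
      have "\<zero> \<ominus> r \<in> vpow P 2" using vpow_minus[OF P zero_vpow that] .
      then show ?thesis using transversal_uniq[OF tr1 zero_vpow r r0(1) _ r0(2)] by simp
    qed
    then show ?thesis using z0 by blast
  qed
  let ?A = "?t1 - {r0}" and ?B = "{rs. set rs \<subseteq> ?t1 \<and> length rs = d - 1}"
  have eq: "{rs. set rs \<subseteq> t \<and> length rs = d \<and> rs \<in> eis P} = (\<lambda>(r, rs). r # rs) ` (?A \<times> ?B)"
  proof (intro equalityI subsetI)
    fix xs assume xs: "xs \<in> {rs. set rs \<subseteq> t \<and> length rs = d \<and> rs \<in> eis P}"
    then obtain r rs where r: "xs = r # rs" using d by (cases xs) auto
    have "r \<in> ?t1" "r \<notin> vpow P 2" "set rs \<subseteq> ?t1" "length rs = d - 1" using xs r by (auto simp: eis_def)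
    then have "(r, rs) \<in> ?A \<times> ?B" using r02 by auto
    then show "xs \<in> (\<lambda>(r, rs). r # rs) ` (?A \<times> ?B)" using r by force
  next
    fix xs assume "xs \<in> (\<lambda>(r, rs). r # rs) ` (?A \<times> ?B)"
    then obtain r rs where r: "xs = r # rs" "r \<in> ?t1" "r \<noteq> r0" "set rs \<subseteq> ?t1" "length rs = d - 1" by auto
    then have "r \<notin> vpow P 2" using r02 by blast
    then show "xs \<in> {rs. set rs \<subseteq> t \<and> length rs = d \<and> rs \<in> eis P}" using r d by (auto simp: eis_def)
  qed
  have "inj_on (\<lambda>(r, rs). r # rs) (?A \<times> ?B)" by (auto simp: inj_on_def)
  then have "card {rs. set rs \<subseteq> t \<and> length rs = d \<and> rs \<in> eis P} = card ?A * card ?B"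
    unfolding eq by (simp only: card_image card_cartesian_product)
  also have "card ?A = q ^ e - 1" using r0 card1 tf by (simp add: card_Diff_singleton)
  also have "card ?B = q ^ (e * (d - 1))"
    using card_lists_length_eq[of ?t1 "d - 1"] tf card1 by (simp add: power_mult)
  finally show ?thesis .
qed

text \<open>The subtracted quotient is \<open>(q^e - 1) q^(e(d-1)) / q^(2ed)\<close>, the proportion
  of Eisenstein residue tuples, with \<open>e\<close> the degree of \<open>Q\<close>.\<close>

definition local_factor :: "nat \<Rightarrow> 'a set \<Rightarrow> real" where
  "local_factor d Q = 1 - (real q ^ place_deg F K Q - 1) / real q ^ ((d + 1) * place_deg F K Q)"

lemma local_factor_bounds:
  "0 \<le> local_factor d Q" "local_factor d Q \<le> 1"
proof -
  have q1: "1 \<le> real q" using q_ge_2 by simp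
  have "real q ^ place_deg F K Q - 1 \<le> real q ^ ((d + 1) * place_deg F K Q)"
    using power_increasing[OF _ q1, of "place_deg F K Q" "(d + 1) * place_deg F K Q"] by simp
  then show "0 \<le> local_factor d Q" using q1 by (simp add: local_factor_def divide_le_eq)
  show "local_factor d Q \<le> 1" using q1 by (simp add: local_factor_def)
qed

lemma card_not_eis_transversal:
  assumes P: "P \<in> Places" and t: "transversal t (VR P) (vpow P 2)" "card t = q ^ (2 * place_deg F K P)"
    and d: "1 < d"
  shows "finite {rs. set rs \<subseteq> t \<and> length rs = d \<and> rs \<notin> eis P}"
    "real (card {rs. set rs \<subseteq> t \<and> length rs = d \<and> rs \<notin> eis P}) = local_factor d P * real (card t ^ d)"
proof -
  let ?e = "place_deg F K P"
  let ?all = "{rs. set rs \<subseteq> t \<and> length rs = d}" and ?bad = "{rs. set rs \<subseteq> t \<and> length rs = d \<and> rs \<in> eis P}"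
  have tf: "finite t" using t by (auto simp: transversal_def)
  have fin: "finite ?all" by (rule finite_lists_length_eq[OF tf])
  have g: "{rs. set rs \<subseteq> t \<and> length rs = d \<and> rs \<notin> eis P} = ?all - ?bad" by auto
  show "finite {rs. set rs \<subseteq> t \<and> length rs = d \<and> rs \<notin> eis P}" unfolding g using fin by simp
  have sub: "?bad \<subseteq> ?all" by auto
  have "real (card (?all - ?bad)) = real (card ?all) - real (card ?bad)"
    using card_Diff_subset[OF finite_subset[OF sub fin] sub] card_mono[OF fin sub] by (simp add: of_nat_diff)
  also have "real (card ?all) = real (card t ^ d)" using card_lists_length_eq[OF tf] by simp
  also have "real (card ?bad) = (real q ^ ?e - 1) * real q ^ (?e * (d - 1))"
    using card_eis_transversal[OF assms] q_ge_2 by (simp add: of_nat_diff)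
  also have "\<dots> = (real q ^ ?e - 1) / real q ^ ((d + 1) * ?e) * real (card t ^ d)"
  proof -
    have "?e * (d - 1) + (d + 1) * ?e = 2 * ?e * d"
    proof -
      obtain k where "d = Suc k" using d by (cases d) auto
      then show ?thesis by (simp add: algebra_simps)
    qed
    then have "real q ^ (?e * (d - 1)) * real q ^ ((d + 1) * ?e) = real q ^ (2 * ?e * d)"
      unfolding power_add[symmetric] by (rule arg_cong)
    also have "\<dots> = real (card t ^ d)" unfolding t(2) by (simp flip: power_mult)
    finally have "real q ^ (?e * (d - 1)) * real q ^ ((d + 1) * ?e) = real (card t ^ d)" .
    moreover have q0: "0 < real q" using q_ge_2 by linarith
    have "0 < real q ^ ((d + 1) * ?e)" by (rule zero_less_power[OF q0])
    then have "real q ^ ((d + 1) * ?e) \<noteq> 0" by linarith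
    ultimately show ?thesis by (simp add: field_simps)
  qed
  finally show "real (card {rs. set rs \<subseteq> t \<and> length rs = d \<and> rs \<notin> eis P}) = local_factor d P * real (card t ^ d)"
    unfolding g local_factor_def by (simp add: algebra_simps)
qed

section \<open>Global counts: finitely many places exactly, the others by a bound\<close>

definition Ld :: "nat \<Rightarrow> ('a set \<Rightarrow> int) \<Rightarrow> 'a list set" where
  "Ld d A = {hs. set hs \<subseteq> L A \<and> length hs = d}"

lemma finite_Ld: "fsupp A \<Longrightarrow> finite (Ld d A)"
  unfolding Ld_def by (intro finite_lists_length_eq finite_L)

lemma card_Ld: "fsupp A \<Longrightarrow> card (Ld d A) = q ^ (d * ell A)"
  unfolding Ld_def using card_lists_length_eq[OF finite_L] card_L by (simp flip: power_mult add: mult.commute)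

text \<open>By \<open>fibers_equal\<close> each simultaneous residue tuple on \<open>T\<close> is
  attained by the same number \<open>c\<close> of elements of \<open>L A\<close>, separately for
  every coefficient. The proportion of good lists thus equals the proportion of good residue data,
  which is a product over \<open>T\<close>.\<close>

lemma count_not_eis:
  assumes P0: "P0 \<in> Places" and T: "finite T" "T \<subseteq> Places" and d: "1 < d"
  shows "\<exists>m::nat. \<forall>A. fsupp A \<longrightarrow> (\<forall>P\<in>Places. (if P = P0 then int m else 0) \<le> A P) \<longrightarrow> (\<forall>Q\<in>T. A Q = 0) \<longrightarrow>
    real (card {hs \<in> Ld d A. \<forall>Q\<in>T. hs \<notin> eis Q}) = (\<Prod>Q\<in>T. local_factor d Q) * real (card (Ld d A))"
proof -
  have "\<exists>t. \<forall>Q\<in>T. transversal (t Q) (VR Q) (vpow Q (int 2)) \<and> card (t Q) = q ^ (2 * place_deg F K Q)"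
    using vpow_transversal[of _ 0 2] vpow_0 T(2) by (intro bchoice) (auto simp: subset_iff)
  then obtain t where t0: "\<forall>Q\<in>T. transversal (t Q) (VR Q) (vpow Q (int 2)) \<and> card (t Q) = q ^ (2 * place_deg F K Q)"
    by (rule exE)
  have t: "transversal (t Q) (VR Q) (vpow Q (int 2))" "card (t Q) = q ^ (2 * place_deg F K Q)" if "Q \<in> T" for Q
    using bspec[OF t0 that] by (rule conjunct1, rule conjunct2)
  have t2: "transversal (t Q) (VR Q) (vpow Q 2)" if "Q \<in> T" for Q using t(1)[OF that] by simp
  have tf: "finite (t Q)" "t Q \<subseteq> VR Q" "t Q \<subseteq> carrier F" if "Q \<in> T" for Q
    using t2[OF that] VR_closed(1) that T(2) by (auto simp: transversal_def)
  define good where "good Q = {rs. set rs \<subseteq> t Q \<and> length rs = d \<and> rs \<notin> eis Q}" for Q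
  obtain m :: nat where m: "\<And>A. fsupp A \<Longrightarrow> (\<forall>P\<in>Places. (if P = P0 then int m else 0) \<le> A P) \<Longrightarrow> (\<forall>Q\<in>T. A Q = 0) \<Longrightarrow>
    card (L A) = card (PiE T t) * card (L (\<lambda>P. A P - ind_div T 2 P)) \<and>
    (\<forall>g\<in>PiE T t. card {z \<in> L A. \<forall>Q\<in>T. z \<ominus> g Q \<in> vpow Q (int 2)} = card (L (\<lambda>P. A P - ind_div T 2 P)))"
    using fibers_equal[OF P0 T t] by blast
  have "real (card {hs \<in> Ld d A. \<forall>Q\<in>T. hs \<notin> eis Q}) = (\<Prod>Q\<in>T. local_factor d Q) * real (card (Ld d A))"
    if A: "fsupp A" "\<forall>P\<in>Places. (if P = P0 then int m else 0) \<le> A P" "\<forall>Q\<in>T. A Q = 0" for A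
  proof -
    define c where "c = card (L (\<lambda>P. A P - ind_div T 2 P))"
    have cL: "card (L A) = card (PiE T t) * c" using m[OF A] unfolding c_def by blast
    have fib: "card {z \<in> L A. \<forall>Q\<in>T. z \<ominus> g Q \<in> vpow Q 2} = c" if "g \<in> PiE T t" for g
      using m[OF A] that unfolding c_def by simp
    \<comment> \<open>\<open>G\<close> prescribes a list of \<open>d\<close> residues at every place
      of \<open>T\<close>. Coefficient by coefficient the prescription is a fibre in the sense of
      \<open>fibers_equal\<close>, so the fibre over \<open>G\<close> has \<open>c ^ d\<close>
      members.\<close>
    define Fib where "Fib G = {hs. length hs = d \<and> (\<forall>i<d. hs ! i \<in> {z \<in> L A. \<forall>Q\<in>T. z \<ominus> G Q ! i \<in> vpow Q 2})}" for G
    have GtQ: "G Q ! i \<in> t Q" "length (G Q) = d" "set (G Q) \<subseteq> t Q" "G Q \<notin> eis Q"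
      if "G \<in> PiE T good" "Q \<in> T" "i < d" for G Q i
      using PiE_mem[OF that(1,2)] that(3) by (auto simp: good_def subset_iff)
    have cF: "finite (Fib G) \<and> card (Fib G) = c ^ d" if G: "G \<in> PiE T good" for G
      unfolding Fib_def
    proof (rule card_lists_nth)
      fix i assume i: "i < d"
      let ?g = "restrict (\<lambda>Q. G Q ! i) T"
      have "?g \<in> PiE T t" using GtQ(1)[OF G _ i] by auto
      from fib[OF this] have "card {z \<in> L A. \<forall>Q\<in>T. z \<ominus> G Q ! i \<in> vpow Q 2} = c" by simp
      moreover have "finite {z \<in> L A. \<forall>Q\<in>T. z \<ominus> G Q ! i \<in> vpow Q 2}" using finite_L[OF A(1)] by simp
      ultimately show "finite {z \<in> L A. \<forall>Q\<in>T. z \<ominus> G Q ! i \<in> vpow Q 2} \<and>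
          card {z \<in> L A. \<forall>Q\<in>T. z \<ominus> G Q ! i \<in> vpow Q 2} = c" by blast
    qed
    have LV: "z \<in> VR Q" "z \<in> carrier F" if "z \<in> L A" "Q \<in> T" for z Q
    proof -
      have "Q \<in> Places" "A Q = 0" using that A(3) T(2) by auto
      then show "z \<in> VR Q" "z \<in> carrier F" using that(1) vpow_0[of Q] by (auto simp: L_iff)
    qed
    have d0: "0 < d" using d by simp
    have un: "{hs \<in> Ld d A. \<forall>Q\<in>T. hs \<notin> eis Q} = (\<Union>G\<in>PiE T good. Fib G)"
    proof (intro equalityI subsetI)
      fix hs assume hs: "hs \<in> {hs \<in> Ld d A. \<forall>Q\<in>T. hs \<notin> eis Q}"
      then have hL: "length hs = d" "\<And>z. z \<in> set hs \<Longrightarrow> z \<in> L A" by (auto simp: Ld_def)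
      have "\<forall>Q\<in>T. \<exists>r. \<forall>z\<in>set hs. r z \<in> t Q \<and> z \<ominus> r z \<in> vpow Q 2"
      proof
        fix Q assume Q: "Q \<in> T"
        have "\<exists>r. r \<in> t Q \<and> z \<ominus> r \<in> vpow Q 2" if "z \<in> set hs" for z
          using transversal_ex[OF t2[OF Q] LV(1)[OF hL(2)[OF that] Q]] by blast
        then show "\<exists>r. \<forall>z\<in>set hs. r z \<in> t Q \<and> z \<ominus> r z \<in> vpow Q 2" by (intro bchoice) blast
      qed
      then obtain r where r: "\<And>Q z. Q \<in> T \<Longrightarrow> z \<in> set hs \<Longrightarrow> r Q z \<in> t Q \<and> z \<ominus> r Q z \<in> vpow Q 2"
        using bchoice[of T "\<lambda>Q r. \<forall>z\<in>set hs. r z \<in> t Q \<and> z \<ominus> r z \<in> vpow Q 2"] by blast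
      let ?G = "restrict (\<lambda>Q. map (r Q) hs) T"
      have "map (r Q) hs \<in> good Q" if Q: "Q \<in> T" for Q
      proof -
        have s: "set (map (r Q) hs) \<subseteq> t Q" using r[OF Q] by auto
        have "hs \<in> eis Q \<longleftrightarrow> map (r Q) hs \<in> eis Q"
        proof (rule eis_congruent)
          show "Q \<in> Places" using Q T by blast
          show "hs \<noteq> []" using hL(1) d by auto
          show "set hs \<subseteq> carrier F" using hL(2) L_carrier by blast
          show "set (map (r Q) hs) \<subseteq> carrier F" using s tf(3)[OF Q] by blast
          show "hs ! i \<ominus> map (r Q) hs ! i \<in> vpow Q 2" if "i < length hs" for i
            using r[OF Q, of "hs ! i"] that by simp
        qed simp
        then show ?thesis using hs Q s hL(1) by (simp add: good_def)
      qed
      then have G: "?G \<in> PiE T good" by auto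
      have "hs ! i \<in> {z \<in> L A. \<forall>Q\<in>T. z \<ominus> ?G Q ! i \<in> vpow Q 2}" if i: "i < d" for i
      proof -
        have "hs ! i \<in> set hs" using i hL(1) by simp
        then show ?thesis using hL r i by simp
      qed
      then have "hs \<in> Fib ?G" using hL(1) unfolding Fib_def by blast
      then show "hs \<in> (\<Union>G\<in>PiE T good. Fib G)" using G by blast
    next
      fix hs assume "hs \<in> (\<Union>G\<in>PiE T good. Fib G)"
      then obtain G where G: "G \<in> PiE T good" "hs \<in> Fib G" by blast
      then have len: "length hs = d" and nth: "\<And>i. i < d \<Longrightarrow> hs ! i \<in> L A"
        "\<And>i Q. i < d \<Longrightarrow> Q \<in> T \<Longrightarrow> hs ! i \<ominus> G Q ! i \<in> vpow Q 2" by (auto simp: Fib_def)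
      have sL: "set hs \<subseteq> L A" using nth(1) len by (auto simp: in_set_conv_nth)
      have "hs \<notin> eis Q" if Q: "Q \<in> T" for Q
      proof -
        note GQ = GtQ(2,3,4)[OF G(1) Q d0]
        have "hs \<in> eis Q \<longleftrightarrow> G Q \<in> eis Q"
        proof (rule eis_congruent)
          show "Q \<in> Places" using Q T by blast
          show "length hs = length (G Q)" "hs \<noteq> []" using len GQ(1) d by auto
          show "set hs \<subseteq> carrier F" using sL L_carrier by blast
          show "set (G Q) \<subseteq> carrier F" using GQ(2) tf(3)[OF Q] by blast
          show "hs ! i \<ominus> G Q ! i \<in> vpow Q 2" if "i < length hs" for i using nth(2) Q that len by blast
        qed
        then show ?thesis using GQ(3) by blast
      qed
      then show "hs \<in> {hs \<in> Ld d A. \<forall>Q\<in>T. hs \<notin> eis Q}" using sL len by (simp add: Ld_def)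
    qed
    have disj: "G = G'" if G: "G \<in> PiE T good" "G' \<in> PiE T good" "hs \<in> Fib G" "hs \<in> Fib G'" for G G' hs
    proof (rule PiE_ext[OF G(1,2)])
      fix Q assume Q: "Q \<in> T"
      show "G Q = G' Q"
      proof (rule nth_equalityI)
        show "length (G Q) = length (G' Q)" using GtQ(2) G(1,2) Q d0 by simp
        fix i assume "i < length (G Q)"
        then have i: "i < d" using GtQ(2)[OF G(1) Q d0] by simp
        have h: "hs ! i \<in> L A" "hs ! i \<ominus> G Q ! i \<in> vpow Q 2" "hs ! i \<ominus> G' Q ! i \<in> vpow Q 2"
          using G(3,4) i Q by (auto simp: Fib_def)
        show "G Q ! i = G' Q ! i"
          by (rule transversal_uniq[OF t2[OF Q] LV(1)[OF h(1) Q] GtQ(1)[OF G(1) Q i] GtQ(1)[OF G(2) Q i] h(2,3)])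
      qed
    qed
    have gfin: "finite (good Q)" and gcard: "real (card (good Q)) = local_factor d Q * real (card (t Q) ^ d)" if Q: "Q \<in> T" for Q
      using card_not_eis_transversal[OF _ t2[OF Q] t(2)[OF Q] d] Q T(2) unfolding good_def by auto
    have fP: "finite (PiE T good)" using T(1) gfin by (intro finite_PiE) auto
    have "card {hs \<in> Ld d A. \<forall>Q\<in>T. hs \<notin> eis Q} = (\<Sum>G\<in>PiE T good. card (Fib G))"
      unfolding un by (rule card_UN_disjoint[OF fP]) (use cF disj in blast)+
    also have "\<dots> = card (PiE T good) * c ^ d" using cF by simp
    finally have e1: "card {hs \<in> Ld d A. \<forall>Q\<in>T. hs \<notin> eis Q} = card (PiE T good) * c ^ d" .
    have "real (card (PiE T good)) = (\<Prod>Q\<in>T. real (card (good Q)))"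
      by (subst card_PiE[OF T(1)]) simp
    also have "\<dots> = (\<Prod>Q\<in>T. local_factor d Q * real (card (t Q)) ^ d)" using gcard by (intro prod.cong) auto
    also have "\<dots> = (\<Prod>Q\<in>T. local_factor d Q) * real (card (PiE T t)) ^ d"
      using card_PiE[OF T(1), of t] by (simp add: prod.distrib prod_power_distrib)
    finally have e2: "real (card (PiE T good)) = (\<Prod>Q\<in>T. local_factor d Q) * real (card (PiE T t)) ^ d" .
    have "card (Ld d A) = (card (PiE T t) * c) ^ d"
      unfolding Ld_def using card_lists_length_eq[OF finite_L[OF A(1)], of d] cL by simp
    then show ?thesis using e1 e2 by (simp add: power_mult_distrib)
  qed
  then show ?thesis by blast
qed

text \<open>Uniform bound for the places of large degree: a nonzero tuple in \<open>\<L>(D - Q)\<close> forces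
  \<open>\<ell>(D - Q) \<le> deg D - deg Q + 1\<close>, while \<open>\<ell>(D) \<ge> deg D - \<gamma>\<close>.\<close>

lemma card_eis_bound:
  assumes ne: "Places \<noteq> {}" and d: "1 < d"
  shows "\<exists>C>0. \<forall>A Q. fsupp A \<longrightarrow> Q \<in> Places \<longrightarrow>
    A Q = 0 \<longrightarrow> real (card (Ld d A \<inter> eis Q)) \<le> C / real q ^ (2 * place_deg F K Q) * real (card (Ld d A))"
proof -
  obtain \<gamma> where \<gamma>: "\<And>A. fsupp A \<Longrightarrow> defect A \<le> \<gamma>"
  proof -
    obtain P where "P \<in> Places" using ne by blast
    from place_imp_not_K[OF this] show ?thesis using that riemann_inequality by blast
  qed
  \<comment> \<open>Combines the two estimates: \<open>ell ?B + deg Q\<close> is at most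
    \<open>deg A + 1\<close>, hence at most \<open>ell A + \<gamma> + 1\<close>.\<close>
  define g where "g = nat (\<gamma> + 1)"
  have q0: "0 < real q" "1 \<le> real q" using q_ge_2 by linarith+
  have "real (card (Ld d A \<inter> eis Q)) \<le> real q ^ (d * g) / real q ^ (2 * place_deg F K Q) * real (card (Ld d A))"
    if A: "fsupp A" "A Q = 0" and Q: "Q \<in> Places" for A Q
  proof (cases "Ld d A \<inter> eis Q = {}")
    case True
    then show ?thesis using q0 by simp
  next
    case False
    let ?e = "place_deg F K Q"
    let ?B = "\<lambda>P. A P - ind_div {Q} 1 P"
    have fi: "fsupp (ind_div {Q} 1)" by (rule fsupp_ind_div) simp
    have fB: "fsupp ?B" using fsupp_diff[OF A(1) fi] .
    have LB: "z \<in> L ?B" if z: "z \<in> L A" "z \<in> Q" for z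
    proof -
      have "z \<in> vpow P (- ?B P)" if P: "P \<in> Places" for P
        using z P A(2) vpow_1[OF Q] by (cases "P = Q") (auto simp: L_iff ind_div_def)
      then show ?thesis using z(1) by (simp add: L_iff)
    qed
    have dB: "ddeg ?B = ddeg A - int ?e"
      using ddeg_add(2)[OF A(1) fi] ddeg_eq[of "{Q}" "ind_div {Q} 1"] Q by (simp add: ind_div_def)
    have sub: "Ld d A \<inter> eis Q \<subseteq> Ld d ?B" using LB by (auto simp: Ld_def eis_def)
    obtain hs where hs: "hs \<in> Ld d A" "hs \<in> eis Q" using False by blast
    have "hd hs \<in> set hs" using hs(1) d by (cases hs) (auto simp: Ld_def)
    then have z: "hd hs \<in> L ?B" using hs LB by (auto simp: Ld_def eis_def)
    have "hd hs \<noteq> \<zero>" using hs(2) zero_vpow by (auto simp: eis_def)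
    then have "int (ell ?B) \<le> ddeg A - int ?e + 1" using ell_le_ddeg(1)[OF fB z] dB by simp
    moreover have "ddeg A - int (ell A) \<le> \<gamma>" using \<gamma>[OF A(1)] by (simp only: defect_def)
    ultimately have le: "ell ?B + ?e \<le> ell A + g" unfolding g_def by linarith
    have "card (Ld d A \<inter> eis Q) * q ^ (2 * ?e) \<le> q ^ (d * ell ?B) * q ^ (d * ?e)"
    proof (rule mult_le_mono)
      show "card (Ld d A \<inter> eis Q) \<le> q ^ (d * ell ?B)"
        using card_mono[OF finite_Ld[OF fB] sub] card_Ld[OF fB] by simp
      \<comment> \<open>This is where \<open>d > 1\<close> turns the natural exponent
        \<open>d\<close> into the summable exponent 2.\<close>
      show "q ^ (2 * ?e) \<le> q ^ (d * ?e)" unfolding power_q_le_iff using d by simp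
    qed
    also have "\<dots> = q ^ (d * (ell ?B + ?e))" by (simp add: power_add algebra_simps)
    also have "\<dots> \<le> q ^ (d * (ell A + g))" unfolding power_q_le_iff using le by simp
    also have "\<dots> = q ^ (d * g) * card (Ld d A)" unfolding card_Ld[OF A(1)] by (simp add: power_add algebra_simps)
    finally have "real (card (Ld d A \<inter> eis Q) * q ^ (2 * ?e)) \<le> real (q ^ (d * g) * card (Ld d A))"
      by (rule of_nat_mono)
    then show ?thesis using q0 by (simp add: field_simps)
  qed
  then show ?thesis using q0 by (intro exI[of _ "real q ^ (d * g)"]) auto
qed

end

section \<open>The density of Eisenstein polynomials\<close>

context holomorphy
begin

section \<open>Translation into the given divisors, densities and filter\<close>

lemma RR_space_eq: "RR_space F K D = L (Poly_Mapping.lookup D)"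
  and RR_dim_eq: "RR_dim F K D = ell (Poly_Mapping.lookup D)"
  unfolding RR_dim_def ell_def RR_space_def L_def by simp_all

lemma pos_divisors_off_iff:
  "D \<in> pos_divisors_off F K S \<longleftrightarrow>
    Poly_Mapping.keys D \<subseteq> Places \<and> (\<forall>P. 0 \<le> Poly_Mapping.lookup D P) \<and> (\<forall>Q\<in>S. Poly_Mapping.lookup D Q = 0)"
proof -
  have "Poly_Mapping.keys D \<inter> S = {} \<longleftrightarrow> (\<forall>Q\<in>S. Poly_Mapping.lookup D Q = 0)"
    by (auto simp: in_keys_iff)
  then show ?thesis by (simp add: pos_divisors_off_def divisor_le_def)
qed

lemma fsupp_lookup: "fsupp (Poly_Mapping.lookup D)"
  unfolding fsupp_def by (rule finite_subset[of _ "Poly_Mapping.keys D"]) (auto simp: in_keys_iff)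

lemma monic_eisenstein_inter:
  assumes D: "D \<in> pos_divisors_off F K S" and d: "1 < d"
  shows "monic_eisenstein F K S d \<inter> cartesian_power (RR_space F K D) d =
    {hs \<in> Ld d (Poly_Mapping.lookup D). \<exists>Q\<in>S. hs \<in> eis Q}"
proof -
  let ?A = "Poly_Mapping.lookup D"
  have LH: "L ?A \<subseteq> H"
  proof
    fix z assume z: "z \<in> L ?A"
    show "z \<in> H"
    proof (rule HI)
      fix Q assume Q: "Q \<in> S"
      then have "?A Q = 0" using D by (simp add: pos_divisors_off_iff)
      moreover have "z \<in> vpow Q (- ?A Q)" using z S_Places[OF Q] by (simp add: L_iff)
      ultimately show "z \<in> vpow Q 0" by simp
    qed
  qed
  have "hs \<in> monic_eisenstein F K S d \<longleftrightarrow> (\<exists>Q\<in>S. hs \<in> eis Q)" if "hs \<in> Ld d ?A" for hs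
  proof -
    have hs: "set hs \<subseteq> H" "length hs = d" "hs \<noteq> []" using that LH d by (auto simp: Ld_def)
    then show ?thesis using monic_eisenstein_iff[OF hs(1,3)]
      by (simp add: monic_eisenstein_def cartesian_power_def eis_def Let_def)
  qed
  moreover have "cartesian_power (RR_space F K D) d = Ld d ?A"
    unfolding RR_space_eq cartesian_power_def Ld_def by blast
  ultimately show ?thesis by blast
qed

lemma density_ratio_eq:
  assumes D: "D \<in> pos_divisors_off F K S" and d: "1 < d"
  shows "density_ratio F K d (monic_eisenstein F K S d) D =
    real (card {hs \<in> Ld d (Poly_Mapping.lookup D). \<exists>Q\<in>S. hs \<in> eis Q}) / real (card (Ld d (Poly_Mapping.lookup D)))"
  unfolding density_ratio_def monic_eisenstein_inter[OF assms] RR_dim_eq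
  using card_Ld[OF fsupp_lookup] by simp

lemma divisor_le_iff:
  "divisor_le D D' \<longleftrightarrow> (\<forall>P. Poly_Mapping.lookup D P \<le> Poly_Mapping.lookup D' P)"
  by (simp add: divisor_le_def lookup_minus)

text \<open>Effective divisors are directed, with the sum as upper bound of two of them, so the
  filter has the sets above a single divisor as a base.\<close>

lemma eventually_divisor_filter:
  "eventually R (divisor_filter F K S) \<longleftrightarrow>
    (\<exists>D\<in>pos_divisors_off F K S. \<forall>D'\<in>pos_divisors_off F K S. divisor_le D D' \<longrightarrow> R D')"
  unfolding divisor_filter_def
proof (subst eventually_INF_base)
  show "pos_divisors_off F K S \<noteq> {}" using pos_divisors_off_iff[of 0] by auto
  fix D D' assume D: "D \<in> pos_divisors_off F K S" "D' \<in> pos_divisors_off F K S"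
  have "Poly_Mapping.keys (D + D') \<subseteq> Places"
    using D Poly_Mapping.keys_add[of D D'] by (auto simp: pos_divisors_off_iff)
  then have "D + D' \<in> pos_divisors_off F K S" using D by (simp add: pos_divisors_off_iff lookup_add)
  moreover have "divisor_le D D''" "divisor_le D' D''" if "divisor_le (D + D') D''" for D''
  proof -
    have "Poly_Mapping.lookup D P \<le> Poly_Mapping.lookup D'' P \<and> Poly_Mapping.lookup D' P \<le> Poly_Mapping.lookup D'' P" for P
    proof -
      have "Poly_Mapping.lookup D P + Poly_Mapping.lookup D' P \<le> Poly_Mapping.lookup D'' P"
        using that by (simp add: divisor_le_iff lookup_add)
      moreover have "0 \<le> Poly_Mapping.lookup D P" "0 \<le> Poly_Mapping.lookup D' P"
        using D by (simp_all add: pos_divisors_off_iff)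
      ultimately show ?thesis by linarith
    qed
    then show "divisor_le D D''" "divisor_le D' D''" by (simp_all add: divisor_le_iff)
  qed
  ultimately show "\<exists>D''\<in>pos_divisors_off F K S.
      principal {E \<in> pos_divisors_off F K S. divisor_le D'' E} \<le>
      inf (principal {E \<in> pos_divisors_off F K S. divisor_le D E})
          (principal {E \<in> pos_divisors_off F K S. divisor_le D' E})"
    by (intro bexI[of _ "D + D'"]) auto
qed (auto simp: eventually_principal)

lemma divisor_filter_nontrivial: "divisor_filter F K S \<noteq> bot"
proof
  assume "divisor_filter F K S = bot"
  then have "eventually (\<lambda>_. False) (divisor_filter F K S)" by simp
  then obtain D where "D \<in> pos_divisors_off F K S" "\<forall>D'\<in>pos_divisors_off F K S. \<not> divisor_le D D'"
    unfolding eventually_divisor_filter by blast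
  moreover have "divisor_le D D" by (simp add: divisor_le_iff)
  ultimately show False by blast
qed

text \<open>The Eisenstein tuples and those failing at all of \<open>T\<close> cover everything.
  Their overlap consists of tuples that are Eisenstein only at places outside \<open>T\<close>, so
  it is controlled by the tail, and inclusion-exclusion gives both bounds.\<close>

lemma card_eisenstein_estimate:
  assumes A: "fsupp A" and C: "\<And>Q. Q \<in> S \<Longrightarrow>
      real (card (Ld d A \<inter> eis Q)) \<le> C / real q ^ (2 * place_deg F K Q) * real (card (Ld d A))" "0 < C"
    and T: "T \<subseteq> S" 
    and tail: "\<And>T'. finite T' \<Longrightarrow> T' \<subseteq> S - T \<Longrightarrow> (\<Sum>Q\<in>T'. 1 / real q ^ (2 * place_deg F K Q)) \<le> e / C"
    and loc: "real (card {hs \<in> Ld d A. \<forall>Q\<in>T. hs \<notin> eis Q}) = \<pi> * real (card (Ld d A))"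
  defines "r \<equiv> real (card {hs \<in> Ld d A. \<exists>Q\<in>S. hs \<in> eis Q}) / real (card (Ld d A))"
  shows "1 - \<pi> \<le> r \<and> r \<le> 1 - \<pi> + e"
proof -
  let ?N = "Ld d A" and ?E = "{hs \<in> Ld d A. \<exists>Q\<in>S. hs \<in> eis Q}" and ?G = "{hs \<in> Ld d A. \<forall>Q\<in>T. hs \<notin> eis Q}"
  have fin: "finite ?N" by (rule finite_Ld[OF A])
  have "0 < q ^ (d * ell A)" using q_ge_2 by (intro zero_less_power) linarith
  then have pos: "0 < real (card ?N)" unfolding card_Ld[OF A] by (simp only: of_nat_0_less_iff)
  \<comment> \<open>\<open>S - T\<close> may be infinite. Choosing one place per tuple of the finite
    overlap yields a finite set \<open>?T'\<close> for the union bound.\<close>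
  have "\<forall>hs\<in>?E \<inter> ?G. \<exists>Q. Q \<in> S - T \<and> hs \<in> eis Q" by blast
  then have "\<exists>f. \<forall>hs\<in>?E \<inter> ?G. f hs \<in> S - T \<and> hs \<in> eis (f hs)" by (rule bchoice)
  then obtain f where f0: "\<forall>hs\<in>?E \<inter> ?G. f hs \<in> S - T \<and> hs \<in> eis (f hs)" by (rule exE)
  have f: "f hs \<in> S - T \<and> hs \<in> eis (f hs)" if "hs \<in> ?E \<inter> ?G" for hs
    by (rule bspec[OF f0 that])
  let ?T' = "f ` (?E \<inter> ?G)"
  have finT': "finite ?T'" "?T' \<subseteq> S - T"
  proof -
    show "finite ?T'" using fin by simp
    show "?T' \<subseteq> S - T" using f by blast
  qed
  have "?E \<inter> ?G \<subseteq> (\<Union>Q\<in>?T'. ?N \<inter> eis Q)" using f by blast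
  then have "card (?E \<inter> ?G) \<le> card (\<Union>Q\<in>?T'. ?N \<inter> eis Q)" using fin finT' by (intro card_mono) auto
  also have "\<dots> \<le> (\<Sum>Q\<in>?T'. card (?N \<inter> eis Q))" by (rule card_UN_le[OF finT'(1)])
  finally have "real (card (?E \<inter> ?G)) \<le> real (\<Sum>Q\<in>?T'. card (?N \<inter> eis Q))" by (rule of_nat_mono)
  also have "\<dots> = (\<Sum>Q\<in>?T'. real (card (?N \<inter> eis Q)))" by simp
  also have "\<dots> \<le> (\<Sum>Q\<in>?T'. C / real q ^ (2 * place_deg F K Q) * real (card ?N))"
    by (rule sum_mono) (use C(1) finT'(2) in blast)
  also have "\<dots> = C * real (card ?N) * (\<Sum>Q\<in>?T'. 1 / real q ^ (2 * place_deg F K Q))"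
    by (simp add: sum_distrib_left mult_ac)
  also have "\<dots> \<le> C * real (card ?N) * (e / C)"
    using tail[OF finT'] C(2) by (intro mult_left_mono) auto
  finally have EG: "real (card (?E \<inter> ?G)) \<le> e * real (card ?N)" using C(2) by (simp add: mult.commute)
  have "?N = ?E \<union> ?G" using T by blast
  then have "card ?N + card (?E \<inter> ?G) = card ?E + card ?G"
    using card_Un_Int[of ?E ?G] fin by simp
  then have cE: "real (card ?E) = real (card ?N) + real (card (?E \<inter> ?G)) - \<pi> * real (card ?N)"
    using loc by (simp flip: of_nat_add)
  then have "(1 - \<pi>) * real (card ?N) \<le> real (card ?E)" by (simp add: algebra_simps)
  moreover have "real (card ?E) \<le> (1 - \<pi> + e) * real (card ?N)" using cE EG by (simp add: algebra_simps)
  ultimately show ?thesis unfolding r_def using pos by (simp add: le_divide_eq divide_le_eq)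
qed

lemma eisenstein_density:
  assumes d: "1 < d"
  shows "\<exists>p. has_unordered_prod (local_factor d) p S \<and> has_density F K S d (monic_eisenstein F K S d) (1 - p)"
proof -
  obtain P0 where P0: "P0 \<in> Places" "P0 \<notin> S" using S_proper by blast
  then have ne: "Places \<noteq> {}" by blast
  have lf: "0 \<le> local_factor d Q \<and> local_factor d Q \<le> 1" for Q using local_factor_bounds by simp
  from has_unordered_prod_Inf[of S "local_factor d", OF lf]
  obtain p where p: "has_unordered_prod (local_factor d) p S"
    "\<forall>T. finite T \<and> T \<subseteq> S \<longrightarrow> p \<le> prod (local_factor d) T"
    "\<forall>e>0. \<exists>T. finite T \<and> T \<subseteq> S \<and> prod (local_factor d) T < p + e"
    by (elim exE conjE)
  obtain C where C: "C > 0" "\<forall>A Q. fsupp A \<longrightarrow> Q \<in> Places \<longrightarrow> A Q = 0 \<longrightarrow>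
      real (card (Ld d A \<inter> eis Q)) \<le> C / real q ^ (2 * place_deg F K Q) * real (card (Ld d A))"
    using card_eis_bound[OF ne d] by blast
  obtain B where B: "\<forall>T. finite T \<and> T \<subseteq> Places \<longrightarrow> (\<Sum>Q\<in>T. 1 / real q ^ (2 * place_deg F K Q)) \<le> B"
    using places_sum_bounded[OF ne] by blast
  let ?r = "density_ratio F K d (monic_eisenstein F K S d)"
  have "(?r \<longlongrightarrow> 1 - p) (divisor_filter F K S)"
  proof (rule tendstoI)
    fix e :: real assume e: "0 < e"
    \<comment> \<open>\<open>T1\<close> brings the finite product close to \<open>p\<close>, and
      \<open>T2\<close> below makes the tail small. Their union does both, since further factors
      only lower the product towards \<open>p\<close>.\<close>
    obtain T1 where T1: "finite T1" "T1 \<subseteq> S" "prod (local_factor d) T1 < p + e / 2"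
      using spec[OF p(3), of "e / 2"] e by auto
    have "\<exists>T. finite T \<and> T \<subseteq> S \<and>
      (\<forall>T'. finite T' \<and> T' \<subseteq> S - T \<longrightarrow> (\<Sum>Q\<in>T'. 1 / real q ^ (2 * place_deg F K Q)) \<le> (e / 2) / C)"
    proof (rule exists_small_tail)
      show "(\<Sum>Q\<in>T. 1 / real q ^ (2 * place_deg F K Q)) \<le> B" if "finite T" "T \<subseteq> S" for T
        using B that S_Places by blast
      show "0 < e / 2 / C" using e C(1) by simp
    qed simp
    then obtain T2 where T2: "finite T2" "T2 \<subseteq> S"
      "\<forall>T'. finite T' \<and> T' \<subseteq> S - T2 \<longrightarrow> (\<Sum>Q\<in>T'. 1 / real q ^ (2 * place_deg F K Q)) \<le> (e / 2) / C" by blast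
    let ?T = "T1 \<union> T2"
    let ?\<pi> = "prod (local_factor d) ?T"
    have T: "finite ?T" "?T \<subseteq> S" "?T \<subseteq> Places" using T1 T2 S_Places by blast+
    have "?\<pi> = prod (local_factor d) (?T - T1) * prod (local_factor d) T1"
      using T(1) by (intro prod.subset_diff) auto
    also have "\<dots> \<le> 1 * prod (local_factor d) T1"
      using lf by (intro mult_right_mono prod_nonneg prod_le_1) auto
    finally have pi: "p \<le> ?\<pi>" "?\<pi> < p + e / 2" using p(2) T T1(3) by auto
    obtain m :: nat where m: "\<And>A. fsupp A \<Longrightarrow> (\<forall>P\<in>Places. (if P = P0 then int m else 0) \<le> A P) \<Longrightarrow> (\<forall>Q\<in>?T. A Q = 0) \<Longrightarrow>
        real (card {hs \<in> Ld d A. \<forall>Q\<in>?T. hs \<notin> eis Q}) = ?\<pi> * real (card (Ld d A))"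
      using count_not_eis[OF P0(1) T(1,3) d] by blast
    \<comment> \<open>Admissible because \<open>P0\<close> lies outside \<open>S\<close>; every
      divisor above it has coefficient at least \<open>m\<close> at \<open>P0\<close>, as the exact
      count requires.\<close>
    let ?D0 = "Poly_Mapping.single P0 (int m)"
    have D0: "?D0 \<in> pos_divisors_off F K S"
      using P0 by (auto simp: pos_divisors_off_iff lookup_single when_def)
    have "dist (?r D) (1 - p) < e" if D: "D \<in> pos_divisors_off F K S" "divisor_le ?D0 D" for D
    proof -
      let ?A = "Poly_Mapping.lookup D"
      have A: "\<And>P. 0 \<le> ?A P" "\<And>Q. Q \<in> S \<Longrightarrow> ?A Q = 0" "int m \<le> ?A P0"
      proof -
        show "\<And>P. 0 \<le> ?A P" "\<And>Q. Q \<in> S \<Longrightarrow> ?A Q = 0" using D(1) by (auto simp: pos_divisors_off_iff)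
        have "Poly_Mapping.lookup ?D0 P0 \<le> ?A P0" using D(2) unfolding divisor_le_iff by blast
        then show "int m \<le> ?A P0" by simp
      qed
      have "1 - ?\<pi> \<le> ?r D \<and> ?r D \<le> 1 - ?\<pi> + e / 2"
        unfolding density_ratio_eq[OF D(1) d]
      proof (rule card_eisenstein_estimate[OF fsupp_lookup _ C(1) T(2)])
        show "real (card (Ld d ?A \<inter> eis Q)) \<le> C / real q ^ (2 * place_deg F K Q) * real (card (Ld d ?A))"
          if "Q \<in> S" for Q using C(2) fsupp_lookup S_Places[OF that] A(2)[OF that] by blast
        show "(\<Sum>Q\<in>T'. 1 / real q ^ (2 * place_deg F K Q)) \<le> e / 2 / C"
          if "finite T'" "T' \<subseteq> S - ?T" for T' using T2(3) that by blast
        show "real (card {hs \<in> Ld d ?A. \<forall>Q\<in>?T. hs \<notin> eis Q}) = ?\<pi> * real (card (Ld d ?A))"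
        proof (rule m[OF fsupp_lookup])
          show "\<forall>P\<in>Places. (if P = P0 then int m else 0) \<le> ?A P" using A(1,3) by simp
          show "\<forall>Q\<in>?T. ?A Q = 0" using A(2) T(2) by blast
        qed
      qed
      then show ?thesis using pi by (auto simp: dist_real_def)
    qed
    then show "\<forall>\<^sub>F D in divisor_filter F K S. dist (?r D) (1 - p) < e"
      unfolding eventually_divisor_filter using D0 by blast
  qed
  then have lim: "((\<lambda>D. ereal (?r D)) \<longlongrightarrow> ereal (1 - p)) (divisor_filter F K S)" by simp
  have "has_density F K S d (monic_eisenstein F K S d) (1 - p)"
    unfolding has_density_def upper_density_def lower_density_def
    using lim_imp_Limsup[OF divisor_filter_nontrivial lim] lim_imp_Liminf[OF divisor_filter_nontrivial lim] by blast
  then show ?thesis using p(1) by blast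
qed

end

theorem theorem2p3:
  fixes F :: "('a, 'b) ring_scheme" and K :: "'a set" and S :: "'a set set"
    and q d :: nat
  assumes "primepow q"
    and "function_field F K" and "full_constant_field F K"
    and "finite K" and "card K = q"
    and "S \<noteq> {}" and "S \<subset> places F K"
    and "d > 1"
  shows "\<exists>p. has_unordered_prod
              (\<lambda>Q. 1 - (real q ^ place_deg F K Q - 1) / real q ^ ((d + 1) * place_deg F K Q)) p S \<and>
             has_density F K S d (monic_eisenstein F K S d) (1 - p)"
proof -
  have ff: "field F" "subfield K F" "\<exists>x\<in>carrier F. ring.finite_dimension F (generate_field F (insert x K)) (carrier F)"
    using assms(2) unfolding function_field_def by auto
  have tr: "\<And>z. z \<in> carrier F \<Longrightarrow> z \<notin> K \<Longrightarrow> ring.transcendental F K z"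
    using assms(3) unfolding full_constant_field_def by (auto simp: over_def)
  interpret field F by (rule ff(1))
  interpret holomorphy F K S
    by (intro holomorphy.intro global_function_field.intro global_function_field_axioms.intro
        holomorphy_axioms.intro) (fact ff tr assms)+
  have "local_factor d = (\<lambda>Q. 1 - (real q ^ place_deg F K Q - 1) / real q ^ ((d + 1) * place_deg F K Q))"
    unfolding local_factor_def assms(5) by (rule ext) simp
  then show ?thesis using eisenstein_density[OF assms(8)] by simp
qed

end
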